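(* Let $\mathcal{C}$ be a unitary multitensor category and let $\vee_1,\vee_2$ be two unitary dual functors on $\mathcal{C}$. Then the bi-involutive structures on $\mathcal{C}$ induced by $\vee_1$ and $\vee_2$ are canonically unitarily equivalent.
   Context: Unitary multitensor category: a semisimple, locally finite $\mathbb{C}$-linear abelian rigid monoidal category $\mathcal{C}$ with bilinear $\otimes$ ($1_{\mathcal C}$ not necessarily simple), equipped with a dagger structure (antilinear maps $\dagger:\mathcal{C}(a\to b)\to\mathcal{C}(b\to a)$, $f^{\dagger\dagger}=f$, $(f\circ g)^\dagger=g^\dagger\circ f^\dagger$, $(f\otimes g)^\dagger=f^\dagger\otimes g^\dagger$) such that associators and unitors are unitary, endomorphism algebras are $C^*$-algebras, and $\mathcal{C}$ has orthogonal direct sums and is idempotent complete. Unitary means $u^\dagger=u^{-1}$. Associators and unitors are suppressed. Dual functor $\vee$: a choice, for each $c\in\mathcal{C}$, of a dual $(c^\vee,\mathrm{ev}_c:c^\vee\otimes c\to 1,\mathrm{coev}_c:1\to c\otimes c^\vee)$ satisfying the zig-zag axioms; $f^\vee=(\mathrm{ev}_b\otimes\mathrm{id}_{a^\vee})\circ(\mathrm{id}_{b^\vee}\otimes f\otimes\mathrm{id}_{a^\vee})\circ(\mathrm{id}_{b^\vee}\otimes\mathrm{coev}_a)$ for $f\in\mathcal{C}(a\to b)$; its canonical tensorator is $\nu_{a,b}=(\mathrm{ev}_b\otimes \mathrm{id})\circ(\mathrm{id}_{b^\vee}\otimes\mathrm{ev}_a\otimes\mathrm{id}_b\otimes\mathrm{id})\circ(\mathrm{id}_{b^\vee\otimes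 a^\vee}\otimes\mathrm{coev}_{a\otimes b}): b^\vee\otimes a^\vee\to(a\otimes b)^\vee$. $\vee$ is unitary if $f^{\vee\dagger}=f^{\dagger\vee}$ for all $f$ and all $\nu_{a,b}$ are unitary; then $\varphi_c:=(\mathrm{coev}_c^\dagger\otimes\mathrm{id}_{c^{\vee\vee}})\circ(\mathrm{id}_c\otimes\mathrm{coev}_{c^\vee})$ is a unitary monoidal natural isomorphism $\mathrm{id}\Rightarrow\vee\circ\vee$. Bi-involutive structure on $\mathcal{C}$: a conjugate-linear covariant anti-monoidal dagger functor $\overline{\,\cdot\,}:\mathcal{C}\to\mathcal{C}$ with unitary tensorator (natural isomorphisms $\nu_{a,b}:\overline a\otimes\overline b\to\overline{b\otimes a}$) and a unitary monoidal natural isomorphism $\varphi:\mathrm{id}_{\mathcal C}\Rightarrow\overline{\overline{\,\cdot\,}}$. A unitary dual functor $\vee$ induces one by $\overline c:=c^\vee$, $\overline f:=f^{\vee\dagger}=f^{\dagger\vee}$, with the canonical tensorator of $\vee$ (regarded as a map $\overline a\otimes\overline b\to\overline{b\otimes a}$) and $\varphi_c:=(\mathrm{coev}_c^\dagger\otimes\mathrm{id}_{c^{\vee\vee}})\circ(\mathrm{id}_c\otimes\mathrm{coev}_{c^\vee}):c\to c^{\vee\vee}=\overline{\overline c}$ (forgetting the evaluations and coevaluations). Two bi-involutive structures $(\overline{\,\cdot\,}^i,\nu^i,\varphi^i)$, $i=1,2$, are unitarily equivalent if there is a unitary natural isomorphism $\chi_c:\overline c^1\to\overline c^2$ with $\chi_{b\otimes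 a}\circ\nu^1_{a,b}=\nu^2_{a,b}\circ(\chi_a\otimes\chi_b)$ and $\overline{\chi_a}^2\circ\chi_{\overline a^1}\circ\varphi^1_a=\varphi^2_a$ for all $a,b$. Such $\chi$ need not be unique; "canonically" refers to the unique $\chi$ such that for each simple $c$, $\chi_c$ is a strictly positive real multiple of the unique isomorphism of duals $c^{\vee_1}\to c^{\vee_2}$ compatible with the (co)evaluations, namely $(\mathrm{ev}^1_c\otimes\mathrm{id}_{c^{\vee_2}})\circ(\mathrm{id}_{c^{\vee_1}}\otimes\mathrm{coev}^2_c)$. *)

theory Defs
  imports Complex_Main
begin

section \<open>Data of a linear dagger monoidal category\<close>

text \<open>
  Composition is written in the usual order: \<open>g \<cdot> f\<close> is \<open>f\<close> followed by \<open>g\<close>; the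
  identity of \<open>a\<close> is \<open>\<iota> a\<close>.  On objects the
  tensor product is \<open>\<otimes>\<close>, on morphisms it is \<open>\<boxtimes>\<close>.  No strictness is assumed: the
  associators \<open>\<a> a b c : (a \<otimes> b) \<otimes> c \<rightarrow> a \<otimes> (b \<otimes> c)\<close> and the unitors
  \<open>\<l> a : \<one> \<otimes> a \<rightarrow> a\<close>, \<open>\<r> a : a \<otimes> \<one> \<rightarrow> a\<close> are part of the data.
\<close>

record ('o, 'm) moncat =
  Obj :: "'o set"
  Hom :: "'o \<Rightarrow> 'o \<Rightarrow> 'm set"
  ident :: "'o \<Rightarrow> 'm"  ("\<iota>\<index>")
  cmp :: "'m \<Rightarrow> 'm \<Rightarrow> 'm"  (infixr "\<cdot>\<index>" 60)
  zero_mor :: "'o \<Rightarrow> 'o \<Rightarrow> 'm"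
  add_mor :: "'m \<Rightarrow> 'm \<Rightarrow> 'm"
  scale_mor :: "complex \<Rightarrow> 'm \<Rightarrow> 'm"
  tens :: "'o \<Rightarrow> 'o \<Rightarrow> 'o"  (infixr "\<otimes>\<index>" 75)
  tensm :: "'m \<Rightarrow> 'm \<Rightarrow> 'm"  (infixr "\<boxtimes>\<index>" 75)
  unit_ob :: "'o"  ("\<one>\<index>")
  asso :: "'o \<Rightarrow> 'o \<Rightarrow> 'o \<Rightarrow> 'm"  ("\<a>\<index>")
  lunit :: "'o \<Rightarrow> 'm"  ("\<l>\<index>")
  runit :: "'o \<Rightarrow> 'm"  ("\<r>\<index>")
  dag :: "'m \<Rightarrow> 'm"  ("_\<dagger>\<index>" [1000] 999)

record ('o, 'm) dual_data =
  dob :: "'o \<Rightarrow> 'o"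
  ev :: "'o \<Rightarrow> 'm"
  coev :: "'o \<Rightarrow> 'm"

text \<open>\<open>bmor B a b f\<close> is the image of \<open>f : a \<rightarrow> b\<close>; \<open>bten B a b\<close> is
  the tensorator from the tensor product of the conjugates of \<open>a\<close> and \<open>b\<close> to the conjugate of
  \<open>b \<otimes> a\<close>.\<close>

record ('o, 'm) bar_data =
  bob :: "'o \<Rightarrow> 'o"
  bmor :: "'o \<Rightarrow> 'o \<Rightarrow> 'm \<Rightarrow> 'm"
  bten :: "'o \<Rightarrow> 'o \<Rightarrow> 'm"
  binv :: "'o \<Rightarrow> 'm"

context
  fixes C :: "('o, 'm) moncat" (structure)
begin

section \<open>Notions from category theory\<close>

definition isomorphism :: "'o \<Rightarrow> 'o \<Rightarrow> 'm \<Rightarrow> bool" where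
  "isomorphism a b f \<longleftrightarrow>
     f \<in> Hom C a b \<and> (\<exists>g \<in> Hom C b a. g \<cdot> f = \<iota> a \<and> f \<cdot> g = \<iota> b)"

definition monic :: "'o \<Rightarrow> 'o \<Rightarrow> 'm \<Rightarrow> bool" where
  "monic a b f \<longleftrightarrow> f \<in> Hom C a b \<and>
     (\<forall>x \<in> Obj C. \<forall>g \<in> Hom C x a. \<forall>h \<in> Hom C x a. f \<cdot> g = f \<cdot> h \<longrightarrow> g = h)"

definition epic :: "'o \<Rightarrow> 'o \<Rightarrow> 'm \<Rightarrow> bool" where
  "epic a b f \<longleftrightarrow> f \<in> Hom C a b \<and>
     (\<forall>x \<in> Obj C. \<forall>g \<in> Hom C b x. \<forall>h \<in> Hom C b x. g \<cdot> f = h \<cdot> f \<longrightarrow> g = h)"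

definition zero_object :: "'o \<Rightarrow> bool" where
  "zero_object z \<longleftrightarrow> z \<in> Obj C \<and>
     (\<forall>x \<in> Obj C. (\<exists>!f. f \<in> Hom C x z) \<and> (\<exists>!f. f \<in> Hom C z x))"

definition is_kernel :: "'o \<Rightarrow> 'o \<Rightarrow> 'm \<Rightarrow> 'o \<Rightarrow> 'm \<Rightarrow> bool" where
  "is_kernel a b f k i \<longleftrightarrow> k \<in> Obj C \<and> i \<in> Hom C k a \<and> f \<cdot> i = zero_mor C k b \<and>
     (\<forall>x \<in> Obj C. \<forall>g \<in> Hom C x a. f \<cdot> g = zero_mor C x b \<longrightarrow>
        (\<exists>!h. h \<in> Hom C x k \<and> i \<cdot> h = g))"

definition is_cokernel :: "'o \<Rightarrow> 'o \<Rightarrow> 'm \<Rightarrow> 'o \<Rightarrow> 'm \<Rightarrow> bool" where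
  "is_cokernel a b f q p \<longleftrightarrow> q \<in> Obj C \<and> p \<in> Hom C b q \<and> p \<cdot> f = zero_mor C a q \<and>
     (\<forall>x \<in> Obj C. \<forall>g \<in> Hom C b x. g \<cdot> f = zero_mor C a x \<longrightarrow>
        (\<exists>!h. h \<in> Hom C q x \<and> h \<cdot> p = g))"

definition direct_sum :: "'o \<Rightarrow> 'o \<Rightarrow> 'o \<Rightarrow> 'm \<Rightarrow> 'm \<Rightarrow> 'm \<Rightarrow> 'm \<Rightarrow> bool" where
  "direct_sum a b s i j p q \<longleftrightarrow> s \<in> Obj C \<and>
     i \<in> Hom C a s \<and> j \<in> Hom C b s \<and> p \<in> Hom C s a \<and> q \<in> Hom C s b \<and>
     p \<cdot> i = \<iota> a \<and> q \<cdot> j = \<iota> b \<and> p \<cdot> j = zero_mor C b a \<and> q \<cdot> i = zero_mor C a b \<and>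
     add_mor C (i \<cdot> p) (j \<cdot> q) = \<iota> s"

definition simple_object :: "'o \<Rightarrow> bool" where
  "simple_object x \<longleftrightarrow> x \<in> Obj C \<and> \<not> zero_object x \<and>
     (\<forall>y \<in> Obj C. \<forall>i. monic y x i \<longrightarrow> zero_object y \<or> isomorphism y x i)"

text \<open>Finite (possibly empty) direct sums of simple objects, built up one summand at a time.\<close>

inductive semisimple_object :: "'o \<Rightarrow> bool" where
  "zero_object z \<Longrightarrow> semisimple_object z"
| "semisimple_object x \<Longrightarrow> simple_object t \<Longrightarrow> direct_sum x t y i j p q \<Longrightarrow> semisimple_object y"

text \<open>Objects with a finite filtration whose successive quotients are simple.\<close>

inductive finite_length :: "'o \<Rightarrow> bool" where
  "zero_object z \<Longrightarrow> finite_length z"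
| "finite_length x \<Longrightarrow> y \<in> Obj C \<Longrightarrow> monic x y i \<Longrightarrow> is_cokernel x y i q p \<Longrightarrow> simple_object q
    \<Longrightarrow> finite_length y"

inductive_set lin_span :: "'o \<Rightarrow> 'o \<Rightarrow> 'm set \<Rightarrow> 'm set" for a b S where
  "zero_mor C a b \<in> lin_span a b S"
| "f \<in> lin_span a b S \<Longrightarrow> g \<in> S \<Longrightarrow> add_mor C f (scale_mor C z g) \<in> lin_span a b S"

definition finite_dim_hom :: "'o \<Rightarrow> 'o \<Rightarrow> bool" where
  "finite_dim_hom a b \<longleftrightarrow> (\<exists>S. finite S \<and> S \<subseteq> Hom C a b \<and> Hom C a b \<subseteq> lin_span a b S)"

definition unitary :: "'o \<Rightarrow> 'o \<Rightarrow> 'm \<Rightarrow> bool" where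
  "unitary a b u \<longleftrightarrow> u \<in> Hom C a b \<and> u\<dagger> \<cdot> u = \<iota> a \<and> u \<cdot> u\<dagger> = \<iota> b"

text \<open>The algebra \<open>Hom C c c\<close> with involution \<open>\<dagger>\<close> carries a complete C*-norm \<open>N\<close>.\<close>

definition Cstar_norm :: "'o \<Rightarrow> ('m \<Rightarrow> real) \<Rightarrow> bool" where
  "Cstar_norm c N \<longleftrightarrow>
     (\<forall>f \<in> Hom C c c. N f \<ge> 0 \<and> (N f = 0 \<longleftrightarrow> f = zero_mor C c c)) \<and>
     (\<forall>f \<in> Hom C c c. \<forall>g \<in> Hom C c c. N (add_mor C f g) \<le> N f + N g) \<and>
     (\<forall>f \<in> Hom C c c. \<forall>z. N (scale_mor C z f) = cmod z * N f) \<and>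
     (\<forall>f \<in> Hom C c c. \<forall>g \<in> Hom C c c. N (f \<cdot> g) \<le> N f * N g) \<and>
     (\<forall>f \<in> Hom C c c. N (f\<dagger> \<cdot> f) = (N f)\<^sup>2) \<and>
     (\<forall>s :: nat \<Rightarrow> 'm. (\<forall>n. s n \<in> Hom C c c) \<longrightarrow>
        (\<forall>e > 0. \<exists>n0. \<forall>m \<ge> n0. \<forall>n \<ge> n0. N (add_mor C (s m) (scale_mor C (-1) (s n))) < e) \<longrightarrow>
        (\<exists>l \<in> Hom C c c. (\<lambda>n. N (add_mor C (s n) (scale_mor C (-1) l))) \<longlonglongrightarrow> 0))"

text \<open>
  \<open>d\<close> is a left dual of \<open>c\<close> with evaluation \<open>e : d \<otimes> c \<rightarrow> \<one>\<close> and coevaluation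
  \<open>k : \<one> \<rightarrow> c \<otimes> d\<close>.  Here and below, the inverses of the (unitary) associators and
  unitors are written as their daggers.
\<close>

definition is_dual :: "'o \<Rightarrow> 'o \<Rightarrow> 'm \<Rightarrow> 'm \<Rightarrow> bool" where
  "is_dual c d e k \<longleftrightarrow> d \<in> Obj C \<and> e \<in> Hom C (d \<otimes> c) \<one> \<and> k \<in> Hom C \<one> (c \<otimes> d) \<and>
     \<r> c \<cdot> (\<iota> c \<boxtimes> e) \<cdot> \<a> c d c \<cdot> (k \<boxtimes> \<iota> c) \<cdot> (\<l> c)\<dagger> = \<iota> c \<and>
     \<l> d \<cdot> (e \<boxtimes> \<iota> d) \<cdot> (\<a> d c d)\<dagger> \<cdot> (\<iota> d \<boxtimes> k) \<cdot> (\<r> d)\<dagger> = \<iota> d"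

end

section \<open>Unitary multitensor categories\<close>

locale linear_category =
  fixes C :: "('o, 'm) moncat" (structure)
  assumes hom_disjoint: "\<lbrakk>a \<in> Obj C; b \<in> Obj C; a' \<in> Obj C; b' \<in> Obj C;
      f \<in> Hom C a b; f \<in> Hom C a' b'\<rbrakk> \<Longrightarrow> a = a' \<and> b = b'"
    and ident_in: "a \<in> Obj C \<Longrightarrow> \<iota> a \<in> Hom C a a"
    and cmp_in: "\<lbrakk>a \<in> Obj C; b \<in> Obj C; c \<in> Obj C; f \<in> Hom C a b; g \<in> Hom C b c\<rbrakk>
      \<Longrightarrow> g \<cdot> f \<in> Hom C a c"
    and ident_left: "\<lbrakk>a \<in> Obj C; b \<in> Obj C; f \<in> Hom C a b\<rbrakk> \<Longrightarrow> \<iota> b \<cdot> f = f"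
    and ident_right: "\<lbrakk>a \<in> Obj C; b \<in> Obj C; f \<in> Hom C a b\<rbrakk> \<Longrightarrow> f \<cdot> \<iota> a = f"
    and cmp_assoc: "\<lbrakk>a \<in> Obj C; b \<in> Obj C; c \<in> Obj C; d \<in> Obj C;
      f \<in> Hom C a b; g \<in> Hom C b c; h \<in> Hom C c d\<rbrakk> \<Longrightarrow> (h \<cdot> g) \<cdot> f = h \<cdot> (g \<cdot> f)"
    and zero_in: "\<lbrakk>a \<in> Obj C; b \<in> Obj C\<rbrakk> \<Longrightarrow> zero_mor C a b \<in> Hom C a b"
    and add_in: "\<lbrakk>a \<in> Obj C; b \<in> Obj C; f \<in> Hom C a b; g \<in> Hom C a b\<rbrakk>
      \<Longrightarrow> add_mor C f g \<in> Hom C a b"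
    and scale_in: "\<lbrakk>a \<in> Obj C; b \<in> Obj C; f \<in> Hom C a b\<rbrakk> \<Longrightarrow> scale_mor C z f \<in> Hom C a b"
    and add_assoc: "\<lbrakk>a \<in> Obj C; b \<in> Obj C; f \<in> Hom C a b; g \<in> Hom C a b; h \<in> Hom C a b\<rbrakk>
      \<Longrightarrow> add_mor C (add_mor C f g) h = add_mor C f (add_mor C g h)"
    and add_comm: "\<lbrakk>a \<in> Obj C; b \<in> Obj C; f \<in> Hom C a b; g \<in> Hom C a b\<rbrakk>
      \<Longrightarrow> add_mor C f g = add_mor C g f"
    and add_zero: "\<lbrakk>a \<in> Obj C; b \<in> Obj C; f \<in> Hom C a b\<rbrakk> \<Longrightarrow> add_mor C f (zero_mor C a b) = f"
    and add_neg: "\<lbrakk>a \<in> Obj C; b \<in> Obj C; f \<in> Hom C a b\<rbrakk>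
      \<Longrightarrow> add_mor C f (scale_mor C (-1) f) = zero_mor C a b"
    and scale_one: "\<lbrakk>a \<in> Obj C; b \<in> Obj C; f \<in> Hom C a b\<rbrakk> \<Longrightarrow> scale_mor C 1 f = f"
    and scale_scale: "\<lbrakk>a \<in> Obj C; b \<in> Obj C; f \<in> Hom C a b\<rbrakk>
      \<Longrightarrow> scale_mor C z (scale_mor C w f) = scale_mor C (z * w) f"
    and scale_add_left: "\<lbrakk>a \<in> Obj C; b \<in> Obj C; f \<in> Hom C a b\<rbrakk>
      \<Longrightarrow> scale_mor C (z + w) f = add_mor C (scale_mor C z f) (scale_mor C w f)"
    and scale_add_right: "\<lbrakk>a \<in> Obj C; b \<in> Obj C; f \<in> Hom C a b; g \<in> Hom C a b\<rbrakk>
      \<Longrightarrow> scale_mor C z (add_mor C f g) = add_mor C (scale_mor C z f) (scale_mor C z g)"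
    and cmp_add_left: "\<lbrakk>a \<in> Obj C; b \<in> Obj C; c \<in> Obj C;
      f \<in> Hom C a b; g \<in> Hom C b c; h \<in> Hom C b c\<rbrakk>
      \<Longrightarrow> add_mor C g h \<cdot> f = add_mor C (g \<cdot> f) (h \<cdot> f)"
    and cmp_add_right: "\<lbrakk>a \<in> Obj C; b \<in> Obj C; c \<in> Obj C;
      f \<in> Hom C a b; g \<in> Hom C a b; h \<in> Hom C b c\<rbrakk>
      \<Longrightarrow> h \<cdot> add_mor C f g = add_mor C (h \<cdot> f) (h \<cdot> g)"
    and cmp_scale_left: "\<lbrakk>a \<in> Obj C; b \<in> Obj C; c \<in> Obj C; f \<in> Hom C a b; g \<in> Hom C b c\<rbrakk>
      \<Longrightarrow> scale_mor C z g \<cdot> f = scale_mor C z (g \<cdot> f)"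
    and cmp_scale_right: "\<lbrakk>a \<in> Obj C; b \<in> Obj C; c \<in> Obj C; f \<in> Hom C a b; g \<in> Hom C b c\<rbrakk>
      \<Longrightarrow> g \<cdot> scale_mor C z f = scale_mor C z (g \<cdot> f)"

locale abelian_linear_category = linear_category +
  assumes zero_object_exists: "\<exists>z. zero_object C z"
    and direct_sum_exists: "\<lbrakk>a \<in> Obj C; b \<in> Obj C\<rbrakk> \<Longrightarrow> \<exists>s i j p q. direct_sum C a b s i j p q"
    and kernel_exists: "\<lbrakk>a \<in> Obj C; b \<in> Obj C; f \<in> Hom C a b\<rbrakk> \<Longrightarrow> \<exists>k i. is_kernel C a b f k i"
    and cokernel_exists: "\<lbrakk>a \<in> Obj C; b \<in> Obj C; f \<in> Hom C a b\<rbrakk> \<Longrightarrow> \<exists>q p. is_cokernel C a b f q p"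
    and monic_is_kernel: "\<lbrakk>k \<in> Obj C; a \<in> Obj C; monic C k a i\<rbrakk>
      \<Longrightarrow> \<exists>b \<in> Obj C. \<exists>f \<in> Hom C a b. is_kernel C a b f k i"
    and epic_is_cokernel: "\<lbrakk>b \<in> Obj C; q \<in> Obj C; epic C b q p\<rbrakk>
      \<Longrightarrow> \<exists>a \<in> Obj C. \<exists>f \<in> Hom C a b. is_cokernel C a b f q p"

locale linear_monoidal_category = linear_category +
  assumes unit_in: "\<one> \<in> Obj C"
    and tens_in: "\<lbrakk>a \<in> Obj C; b \<in> Obj C\<rbrakk> \<Longrightarrow> a \<otimes> b \<in> Obj C"
    and tensm_in: "\<lbrakk>a \<in> Obj C; b \<in> Obj C; a' \<in> Obj C; b' \<in> Obj C; f \<in> Hom C a b; g \<in> Hom C a' b'\<rbrakk>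
      \<Longrightarrow> f \<boxtimes> g \<in> Hom C (a \<otimes> a') (b \<otimes> b')"
    and tensm_ident: "\<lbrakk>a \<in> Obj C; b \<in> Obj C\<rbrakk> \<Longrightarrow> \<iota> a \<boxtimes> \<iota> b = \<iota> (a \<otimes> b)"
    and tensm_cmp: "\<lbrakk>a \<in> Obj C; b \<in> Obj C; c \<in> Obj C; a' \<in> Obj C; b' \<in> Obj C; c' \<in> Obj C;
      f \<in> Hom C a b; g \<in> Hom C b c; f' \<in> Hom C a' b'; g' \<in> Hom C b' c'\<rbrakk>
      \<Longrightarrow> (g \<cdot> f) \<boxtimes> (g' \<cdot> f') = (g \<boxtimes> g') \<cdot> (f \<boxtimes> f')"
    and tensm_add_left: "\<lbrakk>a \<in> Obj C; b \<in> Obj C; a' \<in> Obj C; b' \<in> Obj C;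
      f \<in> Hom C a b; g \<in> Hom C a b; h \<in> Hom C a' b'\<rbrakk>
      \<Longrightarrow> add_mor C f g \<boxtimes> h = add_mor C (f \<boxtimes> h) (g \<boxtimes> h)"
    and tensm_add_right: "\<lbrakk>a \<in> Obj C; b \<in> Obj C; a' \<in> Obj C; b' \<in> Obj C;
      f \<in> Hom C a b; g \<in> Hom C a b; h \<in> Hom C a' b'\<rbrakk>
      \<Longrightarrow> h \<boxtimes> add_mor C f g = add_mor C (h \<boxtimes> f) (h \<boxtimes> g)"
    and tensm_scale_left: "\<lbrakk>a \<in> Obj C; b \<in> Obj C; a' \<in> Obj C; b' \<in> Obj C;
      f \<in> Hom C a b; h \<in> Hom C a' b'\<rbrakk> \<Longrightarrow> scale_mor C z f \<boxtimes> h = scale_mor C z (f \<boxtimes> h)"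
    and tensm_scale_right: "\<lbrakk>a \<in> Obj C; b \<in> Obj C; a' \<in> Obj C; b' \<in> Obj C;
      f \<in> Hom C a b; h \<in> Hom C a' b'\<rbrakk> \<Longrightarrow> h \<boxtimes> scale_mor C z f = scale_mor C z (h \<boxtimes> f)"
    and asso_iso: "\<lbrakk>a \<in> Obj C; b \<in> Obj C; c \<in> Obj C\<rbrakk>
      \<Longrightarrow> isomorphism C ((a \<otimes> b) \<otimes> c) (a \<otimes> (b \<otimes> c)) (\<a> a b c)"
    and lunit_iso: "a \<in> Obj C \<Longrightarrow> isomorphism C (\<one> \<otimes> a) a (\<l> a)"
    and runit_iso: "a \<in> Obj C \<Longrightarrow> isomorphism C (a \<otimes> \<one>) a (\<r> a)"
    and asso_natural: "\<lbrakk>a \<in> Obj C; b \<in> Obj C; c \<in> Obj C; a' \<in> Obj C; b' \<in> Obj C; c' \<in> Obj C;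
      f \<in> Hom C a a'; g \<in> Hom C b b'; h \<in> Hom C c c'\<rbrakk>
      \<Longrightarrow> \<a> a' b' c' \<cdot> ((f \<boxtimes> g) \<boxtimes> h) = (f \<boxtimes> (g \<boxtimes> h)) \<cdot> \<a> a b c"
    and lunit_natural: "\<lbrakk>a \<in> Obj C; b \<in> Obj C; f \<in> Hom C a b\<rbrakk> \<Longrightarrow> \<l> b \<cdot> (\<iota> \<one> \<boxtimes> f) = f \<cdot> \<l> a"
    and runit_natural: "\<lbrakk>a \<in> Obj C; b \<in> Obj C; f \<in> Hom C a b\<rbrakk> \<Longrightarrow> \<r> b \<cdot> (f \<boxtimes> \<iota> \<one>) = f \<cdot> \<r> a"
    and pentagon: "\<lbrakk>a \<in> Obj C; b \<in> Obj C; c \<in> Obj C; d \<in> Obj C\<rbrakk>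
      \<Longrightarrow> \<a> a b (c \<otimes> d) \<cdot> \<a> (a \<otimes> b) c d
        = (\<iota> a \<boxtimes> \<a> b c d) \<cdot> \<a> a (b \<otimes> c) d \<cdot> (\<a> a b c \<boxtimes> \<iota> d)"
    and triangle: "\<lbrakk>a \<in> Obj C; b \<in> Obj C\<rbrakk>
      \<Longrightarrow> (\<iota> a \<boxtimes> \<l> b) \<cdot> \<a> a \<one> b = \<r> a \<boxtimes> \<iota> b"

locale unitary_multitensor_category = abelian_linear_category + linear_monoidal_category +
  assumes semisimple: "a \<in> Obj C \<Longrightarrow> semisimple_object C a"
    and locally_finite_hom: "\<lbrakk>a \<in> Obj C; b \<in> Obj C\<rbrakk> \<Longrightarrow> finite_dim_hom C a b"
    and locally_finite_length: "a \<in> Obj C \<Longrightarrow> finite_length C a"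
    and rigid_left: "c \<in> Obj C \<Longrightarrow> \<exists>d e k. is_dual C c d e k"
    and rigid_right: "c \<in> Obj C \<Longrightarrow> \<exists>d \<in> Obj C. \<exists>e k. is_dual C d c e k"
    and dag_in: "\<lbrakk>a \<in> Obj C; b \<in> Obj C; f \<in> Hom C a b\<rbrakk> \<Longrightarrow> f\<dagger> \<in> Hom C b a"
    and dag_dag: "\<lbrakk>a \<in> Obj C; b \<in> Obj C; f \<in> Hom C a b\<rbrakk> \<Longrightarrow> (f\<dagger>)\<dagger> = f"
    and dag_add: "\<lbrakk>a \<in> Obj C; b \<in> Obj C; f \<in> Hom C a b; g \<in> Hom C a b\<rbrakk>
      \<Longrightarrow> (add_mor C f g)\<dagger> = add_mor C (f\<dagger>) (g\<dagger>)"
    and dag_scale: "\<lbrakk>a \<in> Obj C; b \<in> Obj C; f \<in> Hom C a b\<rbrakk>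
      \<Longrightarrow> (scale_mor C z f)\<dagger> = scale_mor C (cnj z) (f\<dagger>)"
    and dag_cmp: "\<lbrakk>a \<in> Obj C; b \<in> Obj C; c \<in> Obj C; f \<in> Hom C a b; g \<in> Hom C b c\<rbrakk>
      \<Longrightarrow> (g \<cdot> f)\<dagger> = f\<dagger> \<cdot> g\<dagger>"
    and dag_tensm: "\<lbrakk>a \<in> Obj C; b \<in> Obj C; a' \<in> Obj C; b' \<in> Obj C; f \<in> Hom C a b; g \<in> Hom C a' b'\<rbrakk>
      \<Longrightarrow> (f \<boxtimes> g)\<dagger> = f\<dagger> \<boxtimes> g\<dagger>"
    and asso_unitary: "\<lbrakk>a \<in> Obj C; b \<in> Obj C; c \<in> Obj C\<rbrakk>
      \<Longrightarrow> unitary C ((a \<otimes> b) \<otimes> c) (a \<otimes> (b \<otimes> c)) (\<a> a b c)"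
    and lunit_unitary: "a \<in> Obj C \<Longrightarrow> unitary C (\<one> \<otimes> a) a (\<l> a)"
    and runit_unitary: "a \<in> Obj C \<Longrightarrow> unitary C (a \<otimes> \<one>) a (\<r> a)"
    and end_Cstar: "c \<in> Obj C \<Longrightarrow> \<exists>N. Cstar_norm C c N"
    and orthogonal_direct_sum: "\<lbrakk>a \<in> Obj C; b \<in> Obj C\<rbrakk>
      \<Longrightarrow> \<exists>s i j. direct_sum C a b s i j (i\<dagger>) (j\<dagger>)"
    and idempotent_complete: "\<lbrakk>a \<in> Obj C; e \<in> Hom C a a; e \<cdot> e = e\<rbrakk>
      \<Longrightarrow> \<exists>b \<in> Obj C. \<exists>r \<in> Hom C a b. \<exists>s \<in> Hom C b a. r \<cdot> s = \<iota> b \<and> s \<cdot> r = e"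

context
  fixes C :: "('o, 'm) moncat" (structure)
begin

section \<open>Unitary dual functors\<close>

definition dual_map :: "('o, 'm) dual_data \<Rightarrow> 'o \<Rightarrow> 'o \<Rightarrow> 'm \<Rightarrow> 'm" where
  "dual_map D a b f = \<l> (dob D a) \<cdot> (ev D b \<boxtimes> \<iota> (dob D a))
     \<cdot> ((\<iota> (dob D b) \<boxtimes> f) \<boxtimes> \<iota> (dob D a)) \<cdot> (\<a> (dob D b) a (dob D a))\<dagger>
     \<cdot> (\<iota> (dob D b) \<boxtimes> coev D a) \<cdot> (\<r> (dob D b))\<dagger>"

text \<open>\<open>nested_ev D a b\<close> is the morphism from the tensor product of \<open>dob D b \<otimes> dob D a\<close> with
  \<open>a \<otimes> b\<close> to the unit that first evaluates \<open>a\<close> and then \<open>b\<close>.\<close>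

definition nested_ev :: "('o, 'm) dual_data \<Rightarrow> 'o \<Rightarrow> 'o \<Rightarrow> 'm" where
  "nested_ev D a b = ev D b \<cdot> (\<iota> (dob D b) \<boxtimes> \<l> b)
     \<cdot> (\<iota> (dob D b) \<boxtimes> (ev D a \<boxtimes> \<iota> b)) \<cdot> (\<iota> (dob D b) \<boxtimes> (\<a> (dob D a) a b)\<dagger>)
     \<cdot> \<a> (dob D b) (dob D a) (a \<otimes> b)"

definition dual_tensorator :: "('o, 'm) dual_data \<Rightarrow> 'o \<Rightarrow> 'o \<Rightarrow> 'm" where
  "dual_tensorator D a b = \<l> (dob D (a \<otimes> b)) \<cdot> (nested_ev D a b \<boxtimes> \<iota> (dob D (a \<otimes> b)))
     \<cdot> (\<a> (dob D b \<otimes> dob D a) (a \<otimes> b) (dob D (a \<otimes> b)))\<dagger>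
     \<cdot> (\<iota> (dob D b \<otimes> dob D a) \<boxtimes> coev D (a \<otimes> b)) \<cdot> (\<r> (dob D b \<otimes> dob D a))\<dagger>"

definition dual_functor :: "('o, 'm) dual_data \<Rightarrow> bool" where
  "dual_functor D \<longleftrightarrow> (\<forall>c \<in> Obj C. is_dual C c (dob D c) (ev D c) (coev D c))"

definition unitary_dual_functor :: "('o, 'm) dual_data \<Rightarrow> bool" where
  "unitary_dual_functor D \<longleftrightarrow> dual_functor D \<and>
     (\<forall>a \<in> Obj C. \<forall>b \<in> Obj C. \<forall>f \<in> Hom C a b. (dual_map D a b f)\<dagger> = dual_map D b a (f\<dagger>)) \<and>
     (\<forall>a \<in> Obj C. \<forall>b \<in> Obj C.
        unitary C (dob D b \<otimes> dob D a) (dob D (a \<otimes> b)) (dual_tensorator D a b))"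

definition canonical_phi :: "('o, 'm) dual_data \<Rightarrow> 'o \<Rightarrow> 'm" where
  "canonical_phi D c = \<l> (dob D (dob D c)) \<cdot> ((coev D c)\<dagger> \<boxtimes> \<iota> (dob D (dob D c)))
     \<cdot> (\<a> c (dob D c) (dob D (dob D c)))\<dagger> \<cdot> (\<iota> c \<boxtimes> coev D (dob D c)) \<cdot> (\<r> c)\<dagger>"

text \<open>The unique isomorphism \<open>dob D1 c \<rightarrow> dob D2 c\<close> compatible with the (co)evaluations.\<close>

definition dual_comparison :: "('o, 'm) dual_data \<Rightarrow> ('o, 'm) dual_data \<Rightarrow> 'o \<Rightarrow> 'm" where
  "dual_comparison D1 D2 c = \<l> (dob D2 c) \<cdot> (ev D1 c \<boxtimes> \<iota> (dob D2 c))
     \<cdot> (\<a> (dob D1 c) c (dob D2 c))\<dagger> \<cdot> (\<iota> (dob D1 c) \<boxtimes> coev D2 c) \<cdot> (\<r> (dob D1 c))\<dagger>"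

section \<open>Bi-involutive structures\<close>

definition conjugate_linear_dagger_functor :: "('o, 'm) bar_data \<Rightarrow> bool" where
  "conjugate_linear_dagger_functor B \<longleftrightarrow>
     (\<forall>a \<in> Obj C. bob B a \<in> Obj C) \<and>
     (\<forall>a \<in> Obj C. bmor B a a (\<iota> a) = \<iota> (bob B a)) \<and>
     (\<forall>a \<in> Obj C. \<forall>b \<in> Obj C. \<forall>f \<in> Hom C a b.
        bmor B a b f \<in> Hom C (bob B a) (bob B b) \<and>
        bmor B b a (f\<dagger>) = (bmor B a b f)\<dagger> \<and>
        (\<forall>z. bmor B a b (scale_mor C z f) = scale_mor C (cnj z) (bmor B a b f)) \<and>
        (\<forall>g \<in> Hom C a b. bmor B a b (add_mor C f g) = add_mor C (bmor B a b f) (bmor B a b g)) \<and>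
        (\<forall>c \<in> Obj C. \<forall>g \<in> Hom C b c. bmor B a c (g \<cdot> f) = bmor B b c g \<cdot> bmor B a b f))"

definition anti_monoidal_tensorator :: "('o, 'm) bar_data \<Rightarrow> bool" where
  "anti_monoidal_tensorator B \<longleftrightarrow>
     (\<forall>a \<in> Obj C. \<forall>b \<in> Obj C.
        unitary C (bob B a \<otimes> bob B b) (bob B (b \<otimes> a)) (bten B a b)) \<and>
     (\<forall>a \<in> Obj C. \<forall>a' \<in> Obj C. \<forall>b \<in> Obj C. \<forall>b' \<in> Obj C. \<forall>f \<in> Hom C a a'. \<forall>g \<in> Hom C b b'.
        bmor B (b \<otimes> a) (b' \<otimes> a') (g \<boxtimes> f) \<cdot> bten B a b
          = bten B a' b' \<cdot> (bmor B a a' f \<boxtimes> bmor B b b' g)) \<and>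
     (\<forall>a \<in> Obj C. \<forall>b \<in> Obj C. \<forall>c \<in> Obj C.
        bten B (b \<otimes> a) c \<cdot> (bten B a b \<boxtimes> \<iota> (bob B c))
          = bmor B ((c \<otimes> b) \<otimes> a) (c \<otimes> (b \<otimes> a)) (\<a> c b a) \<cdot> bten B a (c \<otimes> b)
              \<cdot> (\<iota> (bob B a) \<boxtimes> bten B b c) \<cdot> \<a> (bob B a) (bob B b) (bob B c))"

text \<open>\<open>r\<close> is the unit constraint of the anti-monoidal functor.  It is determined by the
  tensorator, hence not recorded as a separate component of \<open>B\<close>.\<close>

definition unit_constraint :: "('o, 'm) bar_data \<Rightarrow> 'm \<Rightarrow> bool" where
  "unit_constraint B r \<longleftrightarrow> unitary C \<one> (bob B \<one>) r \<and>
     (\<forall>a \<in> Obj C.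
        bmor B (a \<otimes> \<one>) a (\<r> a) \<cdot> bten B \<one> a \<cdot> (r \<boxtimes> \<iota> (bob B a)) = \<l> (bob B a) \<and>
        bmor B (\<one> \<otimes> a) a (\<l> a) \<cdot> bten B a \<one> \<cdot> (\<iota> (bob B a) \<boxtimes> r) = \<r> (bob B a))"

definition bi_involutive_structure :: "('o, 'm) bar_data \<Rightarrow> bool" where
  "bi_involutive_structure B \<longleftrightarrow>
     conjugate_linear_dagger_functor B \<and> anti_monoidal_tensorator B \<and>
     (\<exists>r. unit_constraint B r \<and> binv B \<one> = bmor B \<one> (bob B \<one>) r \<cdot> r) \<and>
     (\<forall>a \<in> Obj C. unitary C a (bob B (bob B a)) (binv B a)) \<and>
     (\<forall>a \<in> Obj C. \<forall>b \<in> Obj C. \<forall>f \<in> Hom C a b.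
        binv B b \<cdot> f = bmor B (bob B a) (bob B b) (bmor B a b f) \<cdot> binv B a) \<and>
     (\<forall>a \<in> Obj C. \<forall>b \<in> Obj C.
        binv B (a \<otimes> b) = bmor B (bob B b \<otimes> bob B a) (bob B (a \<otimes> b)) (bten B b a)
          \<cdot> bten B (bob B a) (bob B b) \<cdot> (binv B a \<boxtimes> binv B b))"

text \<open>The tensorator of the dual functor is a morphism
  \<open>dob D b \<otimes> dob D a \<rightarrow> dob D (a \<otimes> b)\<close>, hence the exchange of \<open>a\<close> and \<open>b\<close>.\<close>

definition induced_bar :: "('o, 'm) dual_data \<Rightarrow> ('o, 'm) bar_data" where
  "induced_bar D = \<lparr> bob = dob D,
     bmor = (\<lambda>a b f. (dual_map D a b f)\<dagger>),
     bten = (\<lambda>a b. dual_tensorator D b a),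
     binv = canonical_phi D \<rparr>"

definition unitary_natural_iso ::
    "('o, 'm) bar_data \<Rightarrow> ('o, 'm) bar_data \<Rightarrow> ('o \<Rightarrow> 'm) \<Rightarrow> bool" where
  "unitary_natural_iso B1 B2 \<chi> \<longleftrightarrow>
     (\<forall>c \<in> Obj C. unitary C (bob B1 c) (bob B2 c) (\<chi> c)) \<and>
     (\<forall>a \<in> Obj C. \<forall>b \<in> Obj C. \<forall>f \<in> Hom C a b. \<chi> b \<cdot> bmor B1 a b f = bmor B2 a b f \<cdot> \<chi> a)"

definition unitary_equivalence ::
    "('o, 'm) bar_data \<Rightarrow> ('o, 'm) bar_data \<Rightarrow> ('o \<Rightarrow> 'm) \<Rightarrow> bool" where
  "unitary_equivalence B1 B2 \<chi> \<longleftrightarrow> unitary_natural_iso B1 B2 \<chi> \<and>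
     (\<forall>a \<in> Obj C. \<forall>b \<in> Obj C. \<chi> (b \<otimes> a) \<cdot> bten B1 a b = bten B2 a b \<cdot> (\<chi> a \<boxtimes> \<chi> b)) \<and>
     (\<forall>a \<in> Obj C.
        bmor B2 (bob B1 a) (bob B2 a) (\<chi> a) \<cdot> \<chi> (bob B1 a) \<cdot> binv B1 a = binv B2 a)"

definition positive_on_simples ::
    "('o, 'm) dual_data \<Rightarrow> ('o, 'm) dual_data \<Rightarrow> ('o \<Rightarrow> 'm) \<Rightarrow> bool" where
  "positive_on_simples D1 D2 \<chi> \<longleftrightarrow>
     (\<forall>c. simple_object C c \<longrightarrow>
        (\<exists>t :: real. t > 0 \<and> \<chi> c = scale_mor C (complex_of_real t) (dual_comparison D1 D2 c)))"

end

end

theory Submission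
  imports Defs "HOL-Computational_Algebra.Fundamental_Theorem_Algebra"
begin

text \<open>
  Tensoring with an arbitrary object \<open>Y\<close> turns the evaluation and coevaluation of a dual \<open>d\<close> of
  \<open>c\<close> into natural families \<open>E Y : d \<otimes> (c \<otimes> Y) \<rightarrow> Y\<close> and \<open>K Y : Y \<rightarrow> c \<otimes> (d \<otimes> Y)\<close>, and a morphism
  \<open>x\<close> into \<open>d\<close> is determined by the composites \<open>E Y \<cdot> (x \<boxtimes> \<iota> (c \<otimes> Y))\<close>.  Dual maps, tensorators,
  \<open>phi\<close> and the comparison \<open>zeta\<close> of two duals all have simple characterizations of this kind, and
  with these the coherence identities reduce to naturality.  That \<open>phi\<close> is unitary follows from
  unitarity of the tensorator: the dual of the coevaluation of \<open>c\<close>, composed with the tensorator, is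
  the evaluation of the dual of \<open>c\<close>, and the dagger of this identity exhibits the inverse of \<open>phi\<close> as
  its dagger.

  The comparison \<open>zeta\<close> satisfies every condition on an equivalence except unitarity.  On a simple
  object \<open>s\<close>, \<open>zeta\<dagger> \<cdot> zeta\<close> is a positive scalar \<open>weight s\<close> by Schur's lemma.  Unitarity of the
  tensorators makes \<open>weight\<close> multiplicative on the simple summands of tensor products, and unitarity
  of \<open>phi\<close> inverts it under conjugation.  Hence the scalars \<open>1 / sqrt (weight s)\<close> define a monoidal
  natural automorphism \<open>T\<close> of the identity functor, and composing \<open>zeta\<close> with the conjugate of \<open>T\<close>
  gives \<open>chi\<close>.  By semisimplicity natural families are equal once they agree on simple objects,
  which gives unitarity of \<open>chi\<close> as well as its uniqueness.
\<close>

text \<open>The category is not strict, and an identity between dual maps or tensorators, written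
  out, is a chain of associators. The families indexed by \<open>Y\<close> carry the associators and
  unitors inside them; choosing \<open>Y\<close> as a tensor product then plays the role of adding
  strands to a string diagram. The obstacle to unitarity is that the evaluations of the two functors
  may be scaled differently on different simple objects. What \<open>zeta\<close> lacks is measured
  by \<open>(zeta c)\<dagger> \<cdot> zeta c\<close>, and \<open>chi\<close> is the unitary part of
  the polar decomposition of \<open>zeta\<close>. No fusion rules are needed to control it: a weight
  is transported along any nonzero morphism out of a simple object, so a scalar modulus on a product
  of simples fixes the weights of all its simple summands at once. In effect the weight is a
  positive character of the grading by simple objects, and its inverse square root is again such a
  character; this is why the rescaling stays monoidal. That the scalars are positive rests on the
  C*-norms. These exist on endomorphism algebras only, hence the detour through orthogonal direct
  sums.\<close>

text \<open>Gaussian elimination, by induction on the set of coordinates. Applied to the powers of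
  an endomorphism it yields an annihilating polynomial.\<close>

lemma linear_dependence:
  fixes v :: "'a \<Rightarrow> 'b \<Rightarrow> complex"
  assumes "finite S" "finite T" "card S < card T"
  shows "\<exists>c. (\<exists>k \<in> T. c k \<noteq> 0) \<and> (\<forall>x \<in> S. (\<Sum>k \<in> T. c k * v k x) = 0)"
  using assms
proof (induction S arbitrary: T v rule: finite_induct)
  case empty
  then obtain k where "k \<in> T"
    by fastforce
  thus ?case
    by (intro exI[of _ "\<lambda>_. 1"]) auto
next
  case (insert x S)
  show ?case
  proof (cases "\<forall>k \<in> T. v k x = 0")
    case True
    obtain c where "\<exists>k \<in> T. c k \<noteq> 0" "\<forall>x \<in> S. (\<Sum>k \<in> T. c k * v k x) = 0"
      using insert.IH[of T v] insert.prems insert.hyps by auto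
    thus ?thesis
      using True by (intro exI[of _ c]) auto
  next
    case False
    then obtain j where j: "j \<in> T" "v j x \<noteq> 0"
      by auto
    \<comment> \<open>The pivot \<open>j\<close> clears coordinate \<open>x\<close> from all
      vectors; \<open>?w j\<close> itself vanishes and is dropped.\<close>
    let ?w = "\<lambda>k y. v k y - v k x / v j x * v j y"
    have "card S < card (T - {j})"
      using insert.prems insert.hyps j by auto
    then obtain c where c: "\<exists>k \<in> T - {j}. c k \<noteq> 0" "\<forall>y \<in> S. (\<Sum>k \<in> T - {j}. c k * ?w k y) = 0"
      using insert.IH[of "T - {j}" ?w] insert.prems by auto
    \<comment> \<open>The coefficient at \<open>j\<close> collects the multiples of the pivot that
      were subtracted in \<open>?w\<close>.\<close>
    define d where "d = (\<lambda>k. if k = j then - (\<Sum>k \<in> T - {j}. c k * (v k x / v j x)) else c k)"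
    have "(\<Sum>k \<in> T. d k * v k y) = (\<Sum>k \<in> T - {j}. c k * ?w k y)" for y
    proof -
      have "(\<Sum>k \<in> T. d k * v k y) = d j * v j y + (\<Sum>k \<in> T - {j}. d k * v k y)"
        using j insert.prems by (simp add: sum.remove)
      also have "(\<Sum>k \<in> T - {j}. d k * v k y) = (\<Sum>k \<in> T - {j}. c k * v k y)"
        unfolding d_def by (intro sum.cong) auto
      also have "d j * v j y = - (\<Sum>k \<in> T - {j}. c k * (v k x / v j x * v j y))"
        unfolding d_def by (simp add: sum_distrib_right mult.assoc)
      finally show ?thesis
        by (simp add: right_diff_distrib sum_subtractf)
    qed
    moreover have "?w k x = 0" for k
      using j by simp
    ultimately have "\<forall>y \<in> insert x S. (\<Sum>k \<in> T. d k * v k y) = 0"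
      using c(2) by simp
    moreover have "\<exists>k \<in> T. d k \<noteq> 0"
      using c(1) unfolding d_def by auto
    ultimately show ?thesis
      by blast
  qed
qed

section \<open>Duals in a dagger monoidal category\<close>

context unitary_multitensor_category
begin

section \<open>Typing of morphisms by source and target\<close>

text \<open>Hom-sets between objects are disjoint, so a morphism determines its source and target.
  Rewriting membership into \<open>arr\<close>, \<open>src\<close> and \<open>tgt\<close> turns the
  typing premises into conditions that the simplifier discharges by computing with
  equations.\<close>

definition arr where
  "arr f \<longleftrightarrow> (\<exists>a \<in> Obj C. \<exists>b \<in> Obj C. f \<in> Hom C a b)"

definition src where
  "src f = (THE a. a \<in> Obj C \<and> (\<exists>b \<in> Obj C. f \<in> Hom C a b))"

definition tgt where
  "tgt f = (THE b. b \<in> Obj C \<and> (\<exists>a \<in> Obj C. f \<in> Hom C a b))"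

lemma src_eq: "\<lbrakk>a \<in> Obj C; b \<in> Obj C; f \<in> Hom C a b\<rbrakk> \<Longrightarrow> src f = a"
  unfolding src_def by (rule the_equality) (use hom_disjoint in blast)+

lemma tgt_eq: "\<lbrakk>a \<in> Obj C; b \<in> Obj C; f \<in> Hom C a b\<rbrakk> \<Longrightarrow> tgt f = b"
  unfolding tgt_def by (rule the_equality) (use hom_disjoint in blast)+

lemma hom_iff [simp]:
  "\<lbrakk>a \<in> Obj C; b \<in> Obj C\<rbrakk> \<Longrightarrow> f \<in> Hom C a b \<longleftrightarrow> arr f \<and> src f = a \<and> tgt f = b"
  using src_eq tgt_eq unfolding arr_def by blast

lemma src_Obj [simp]: "arr f \<Longrightarrow> src f \<in> Obj C"
  unfolding arr_def using src_eq by blast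

lemma tgt_Obj [simp]: "arr f \<Longrightarrow> tgt f \<in> Obj C"
  unfolding arr_def using tgt_eq by blast

declare unit_in [simp] tens_in [simp]

lemma ident_type [simp]:
  assumes "a \<in> Obj C"
  shows "arr (\<iota> a)" "src (\<iota> a) = a" "tgt (\<iota> a) = a"
  using ident_in[OF assms] assms by simp_all

lemma cmp_type [simp]:
  assumes "arr f" "arr g" "src g = tgt f"
  shows "arr (g \<cdot> f)" "src (g \<cdot> f) = src f" "tgt (g \<cdot> f) = tgt g"
  using cmp_in[of "src f" "tgt f" "tgt g" f g] assms by simp_all

lemma zero_type [simp]:
  assumes "a \<in> Obj C" "b \<in> Obj C"
  shows "arr (zero_mor C a b)" "src (zero_mor C a b) = a" "tgt (zero_mor C a b) = b"
  using zero_in[of a b] assms by simp_all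

lemma add_type [simp]:
  assumes "arr f" "arr g" "src g = src f" "tgt g = tgt f"
  shows "arr (add_mor C f g)" "src (add_mor C f g) = src f" "tgt (add_mor C f g) = tgt f"
  using add_in[of "src f" "tgt f" f g] assms by simp_all

lemma scale_type [simp]:
  assumes "arr f"
  shows "arr (scale_mor C z f)" "src (scale_mor C z f) = src f" "tgt (scale_mor C z f) = tgt f"
  using scale_in[of "src f" "tgt f" f z] assms by simp_all

lemma tensm_type [simp]:
  assumes "arr f" "arr g"
  shows "arr (f \<boxtimes> g)" "src (f \<boxtimes> g) = src f \<otimes> src g" "tgt (f \<boxtimes> g) = tgt f \<otimes> tgt g"
  using tensm_in[of "src f" "tgt f" "src g" "tgt g" f g] assms by simp_all

lemma dag_type [simp]:
  assumes "arr f"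
  shows "arr (f\<dagger>)" "src (f\<dagger>) = tgt f" "tgt (f\<dagger>) = src f"
  using dag_in[of "src f" "tgt f" f] assms by simp_all

lemma asso_type [simp]:
  assumes "a \<in> Obj C" "b \<in> Obj C" "c \<in> Obj C"
  shows "arr (\<a> a b c)" "src (\<a> a b c) = (a \<otimes> b) \<otimes> c" "tgt (\<a> a b c) = a \<otimes> (b \<otimes> c)"
  using asso_unitary[of a b c] assms unfolding unitary_def by simp_all

lemma lunit_type [simp]:
  assumes "a \<in> Obj C"
  shows "arr (\<l> a)" "src (\<l> a) = \<one> \<otimes> a" "tgt (\<l> a) = a"
  using lunit_unitary[of a] assms unfolding unitary_def by simp_all

lemma runit_type [simp]:
  assumes "a \<in> Obj C"
  shows "arr (\<r> a)" "src (\<r> a) = a \<otimes> \<one>" "tgt (\<r> a) = a"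
  using runit_unitary[of a] assms unfolding unitary_def by simp_all

lemma assoc [simp]:
  "\<lbrakk>arr f; arr g; arr h; src g = tgt f; src h = tgt g\<rbrakk> \<Longrightarrow> (h \<cdot> g) \<cdot> f = h \<cdot> (g \<cdot> f)"
  using cmp_assoc[of "src f" "tgt f" "tgt g" "tgt h" f g h] by simp

lemma id_left [simp]: "\<lbrakk>arr f; tgt f = a\<rbrakk> \<Longrightarrow> \<iota> a \<cdot> f = f"
  using ident_left[of "src f" a f] by auto

lemma id_right [simp]: "\<lbrakk>arr f; src f = a\<rbrakk> \<Longrightarrow> f \<cdot> \<iota> a = f"
  using ident_right[of a "tgt f" f] by auto

declare tensm_ident [simp]

lemma tensm_comp:
  "\<lbrakk>arr f; arr g; arr f'; arr g'; src g = tgt f; src g' = tgt f'\<rbrakk>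
    \<Longrightarrow> (g \<boxtimes> g') \<cdot> (f \<boxtimes> f') = (g \<cdot> f) \<boxtimes> (g' \<cdot> f')"
  using tensm_cmp[of "src f" "tgt f" "tgt g" "src f'" "tgt f'" "tgt g'" f g f' g'] by simp

lemma tensm_comp2:
  "\<lbrakk>arr f; arr g; arr f'; arr g'; src g = tgt f; src g' = tgt f';
    arr x; tgt x = src f \<otimes> src f'\<rbrakk>
    \<Longrightarrow> (g \<boxtimes> g') \<cdot> ((f \<boxtimes> f') \<cdot> x) = ((g \<cdot> f) \<boxtimes> (g' \<cdot> f')) \<cdot> x"
  by (simp add: tensm_comp flip: assoc)

lemma whisk_left:
  "\<lbrakk>arr f; arr g; src g = tgt f; a \<in> Obj C\<rbrakk> \<Longrightarrow> \<iota> a \<boxtimes> (g \<cdot> f) = (\<iota> a \<boxtimes> g) \<cdot> (\<iota> a \<boxtimes> f)"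
  by (simp add: tensm_comp)

lemma whisk_right:
  "\<lbrakk>arr f; arr g; src g = tgt f; a \<in> Obj C\<rbrakk> \<Longrightarrow> (g \<cdot> f) \<boxtimes> \<iota> a = (g \<boxtimes> \<iota> a) \<cdot> (f \<boxtimes> \<iota> a)"
  by (simp add: tensm_comp)

text \<open>Composites are normalized to the right, so the left side of an equation
  \<open>g \<cdot> f = h\<close> no longer occurs literally once something stands behind
  \<open>f\<close>. This lemma, and the variants whose names end in \<open>2\<close>, apply such an
  equation in front of a tail \<open>x\<close>.\<close>

lemma reassoc:
  assumes "g \<cdot> f = h" "arr f" "arr g" "src g = tgt f" "arr x" "tgt x = src f"
  shows "g \<cdot> (f \<cdot> x) = h \<cdot> x"
  using assms by (metis assoc)

lemma asso_nat:
  "\<lbrakk>arr f; arr g; arr h; a = tgt f; b = tgt g; c = tgt h\<rbrakk>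
    \<Longrightarrow> \<a> a b c \<cdot> ((f \<boxtimes> g) \<boxtimes> h) = (f \<boxtimes> (g \<boxtimes> h)) \<cdot> \<a> (src f) (src g) (src h)"
  using asso_natural[of "src f" "src g" "src h" "tgt f" "tgt g" "tgt h" f g h] by simp

lemma lunit_nat: "\<lbrakk>arr f; b = tgt f\<rbrakk> \<Longrightarrow> \<l> b \<cdot> (\<iota> \<one> \<boxtimes> f) = f \<cdot> \<l> (src f)"
  using lunit_natural[of "src f" "tgt f" f] by simp

lemma runit_nat: "\<lbrakk>arr f; b = tgt f\<rbrakk> \<Longrightarrow> \<r> b \<cdot> (f \<boxtimes> \<iota> \<one>) = f \<cdot> \<r> (src f)"
  using runit_natural[of "src f" "tgt f" f] by simp

lemma dagger_dagger [simp]: "arr f \<Longrightarrow> (f\<dagger>)\<dagger> = f"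
  using dag_dag[of "src f" "tgt f" f] by simp

lemma dagger_comp [simp]: "\<lbrakk>arr f; arr g; src g = tgt f\<rbrakk> \<Longrightarrow> (g \<cdot> f)\<dagger> = f\<dagger> \<cdot> g\<dagger>"
  using dag_cmp[of "src f" "tgt f" "tgt g" f g] by simp

lemma dagger_tensm [simp]: "\<lbrakk>arr f; arr g\<rbrakk> \<Longrightarrow> (f \<boxtimes> g)\<dagger> = f\<dagger> \<boxtimes> g\<dagger>"
  using dag_tensm[of "src f" "tgt f" "src g" "tgt g" f g] by simp

lemma dagger_ident [simp]:
  assumes "a \<in> Obj C"
  shows "(\<iota> a)\<dagger> = \<iota> a"
proof -
  have "(\<iota> a)\<dagger> = ((\<iota> a)\<dagger> \<cdot> \<iota> a)"
    using assms by simp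
  hence "((\<iota> a)\<dagger>)\<dagger> = (\<iota> a)\<dagger> \<cdot> ((\<iota> a)\<dagger>)\<dagger>"
    using assms by (metis dagger_comp dag_type(1,2) dagger_dagger ident_type)
  thus ?thesis
    using assms by simp
qed

lemma dagger_inj: "\<lbrakk>f\<dagger> = g\<dagger>; arr f; arr g\<rbrakk> \<Longrightarrow> f = g"
  by (metis dagger_dagger)

lemma unitary_iff:
  "\<lbrakk>a \<in> Obj C; b \<in> Obj C\<rbrakk> \<Longrightarrow> unitary C a b u \<longleftrightarrow>
    arr u \<and> src u = a \<and> tgt u = b \<and> u\<dagger> \<cdot> u = \<iota> a \<and> u \<cdot> u\<dagger> = \<iota> b"
  unfolding unitary_def by auto

lemma asso_cancel [simp]:
  assumes "a \<in> Obj C" "b \<in> Obj C" "c \<in> Obj C"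
  shows "(\<a> a b c)\<dagger> \<cdot> \<a> a b c = \<iota> ((a \<otimes> b) \<otimes> c)"
    "\<a> a b c \<cdot> (\<a> a b c)\<dagger> = \<iota> (a \<otimes> (b \<otimes> c))"
    "\<lbrakk>arr x; tgt x = (a \<otimes> b) \<otimes> c\<rbrakk> \<Longrightarrow> (\<a> a b c)\<dagger> \<cdot> (\<a> a b c \<cdot> x) = x"
    "\<lbrakk>arr x; tgt x = a \<otimes> (b \<otimes> c)\<rbrakk> \<Longrightarrow> \<a> a b c \<cdot> ((\<a> a b c)\<dagger> \<cdot> x) = x"
proof -
  show *: "(\<a> a b c)\<dagger> \<cdot> \<a> a b c = \<iota> ((a \<otimes> b) \<otimes> c)" "\<a> a b c \<cdot> (\<a> a b c)\<dagger> = \<iota> (a \<otimes> (b \<otimes> c))"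
    using asso_unitary[of a b c] assms unfolding unitary_def by simp_all
  show "\<lbrakk>arr x; tgt x = (a \<otimes> b) \<otimes> c\<rbrakk> \<Longrightarrow> (\<a> a b c)\<dagger> \<cdot> (\<a> a b c \<cdot> x) = x"
    using assms by (simp add: reassoc[OF *(1)])
  show "\<lbrakk>arr x; tgt x = a \<otimes> (b \<otimes> c)\<rbrakk> \<Longrightarrow> \<a> a b c \<cdot> ((\<a> a b c)\<dagger> \<cdot> x) = x"
    using assms by (simp add: reassoc[OF *(2)])
qed

lemma lunit_cancel [simp]:
  assumes "a \<in> Obj C"
  shows "(\<l> a)\<dagger> \<cdot> \<l> a = \<iota> (\<one> \<otimes> a)" "\<l> a \<cdot> (\<l> a)\<dagger> = \<iota> a"
    "\<lbrakk>arr x; tgt x = \<one> \<otimes> a\<rbrakk> \<Longrightarrow> (\<l> a)\<dagger> \<cdot> (\<l> a \<cdot> x) = x"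
    "\<lbrakk>arr x; tgt x = a\<rbrakk> \<Longrightarrow> \<l> a \<cdot> ((\<l> a)\<dagger> \<cdot> x) = x"
proof -
  show *: "(\<l> a)\<dagger> \<cdot> \<l> a = \<iota> (\<one> \<otimes> a)" "\<l> a \<cdot> (\<l> a)\<dagger> = \<iota> a"
    using lunit_unitary[of a] assms unfolding unitary_def by simp_all
  show "\<lbrakk>arr x; tgt x = \<one> \<otimes> a\<rbrakk> \<Longrightarrow> (\<l> a)\<dagger> \<cdot> (\<l> a \<cdot> x) = x"
    using assms by (simp add: reassoc[OF *(1)])
  show "\<lbrakk>arr x; tgt x = a\<rbrakk> \<Longrightarrow> \<l> a \<cdot> ((\<l> a)\<dagger> \<cdot> x) = x"
    using assms by (simp add: reassoc[OF *(2)])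
qed

lemma runit_cancel [simp]:
  assumes "a \<in> Obj C"
  shows "(\<r> a)\<dagger> \<cdot> \<r> a = \<iota> (a \<otimes> \<one>)" "\<r> a \<cdot> (\<r> a)\<dagger> = \<iota> a"
    "\<lbrakk>arr x; tgt x = a \<otimes> \<one>\<rbrakk> \<Longrightarrow> (\<r> a)\<dagger> \<cdot> (\<r> a \<cdot> x) = x"
    "\<lbrakk>arr x; tgt x = a\<rbrakk> \<Longrightarrow> \<r> a \<cdot> ((\<r> a)\<dagger> \<cdot> x) = x"
proof -
  show *: "(\<r> a)\<dagger> \<cdot> \<r> a = \<iota> (a \<otimes> \<one>)" "\<r> a \<cdot> (\<r> a)\<dagger> = \<iota> a"
    using runit_unitary[of a] assms unfolding unitary_def by simp_all
  show "\<lbrakk>arr x; tgt x = a \<otimes> \<one>\<rbrakk> \<Longrightarrow> (\<r> a)\<dagger> \<cdot> (\<r> a \<cdot> x) = x"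
    using assms by (simp add: reassoc[OF *(1)])
  show "\<lbrakk>arr x; tgt x = a\<rbrakk> \<Longrightarrow> \<r> a \<cdot> ((\<r> a)\<dagger> \<cdot> x) = x"
    using assms by (simp add: reassoc[OF *(2)])
qed

lemma epi_cancel:
  assumes "f \<cdot> x = g \<cdot> x" "x \<cdot> y = \<iota> (tgt x)" "arr x" "arr y" "arr f" "arr g"
    "src f = tgt x" "src g = tgt x" "tgt y = src x" "src y = tgt x"
  shows "f = g"
proof -
  have "(f \<cdot> x) \<cdot> y = (g \<cdot> x) \<cdot> y"
    using assms(1) by simp
  thus ?thesis
    using assms(2-) by simp
qed

text \<open>By naturality of the right unitor, tensoring with the unit is conjugation by
  isomorphisms. This turns identities of families back into identities of morphisms, by taking
  \<open>Y\<close> to be the unit.\<close>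

lemma whisk_right_inj:
  assumes "f \<boxtimes> \<iota> \<one> = g \<boxtimes> \<iota> \<one>" "arr f" "arr g" "src f = src g" "tgt f = tgt g"
  shows "f = g"
proof (rule epi_cancel[where x = "\<r> (src f)" and y = "(\<r> (src f))\<dagger>"])
  show "f \<cdot> \<r> (src f) = g \<cdot> \<r> (src f)"
    using runit_nat[of f "tgt f"] runit_nat[of g "tgt f"] assms by simp
qed (use assms in simp_all)

lemma whisk_left_inj:
  assumes "\<iota> \<one> \<boxtimes> f = \<iota> \<one> \<boxtimes> g" "arr f" "arr g" "src f = src g" "tgt f = tgt g"
  shows "f = g"
proof (rule epi_cancel[where x = "\<l> (src f)" and y = "(\<l> (src f))\<dagger>"])
  show "f \<cdot> \<l> (src f) = g \<cdot> \<l> (src f)"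
    using lunit_nat[of f "tgt f"] lunit_nat[of g "tgt f"] assms by simp
qed (use assms in simp_all)

section \<open>Coherence of unitors and associators\<close>

lemma triangle2:
  assumes "a \<in> Obj C" "b \<in> Obj C" "arr x" "tgt x = (a \<otimes> \<one>) \<otimes> b"
  shows "(\<iota> a \<boxtimes> \<l> b) \<cdot> (\<a> a \<one> b \<cdot> x) = (\<r> a \<boxtimes> \<iota> b) \<cdot> x"
  using assms by (intro reassoc triangle) simp_all

lemma asso_nat2:
  "\<lbrakk>arr f; arr g; arr h; a = tgt f; b = tgt g; c = tgt h; arr x; tgt x = (src f \<otimes> src g) \<otimes> src h\<rbrakk>
    \<Longrightarrow> \<a> a b c \<cdot> (((f \<boxtimes> g) \<boxtimes> h) \<cdot> x) = (f \<boxtimes> (g \<boxtimes> h)) \<cdot> (\<a> (src f) (src g) (src h) \<cdot> x)"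
  by (subst reassoc[OF asso_nat]) simp_all

lemma lunit_nat2:
  "\<lbrakk>arr f; b = tgt f; arr x; tgt x = \<one> \<otimes> src f\<rbrakk> \<Longrightarrow> \<l> b \<cdot> ((\<iota> \<one> \<boxtimes> f) \<cdot> x) = f \<cdot> (\<l> (src f) \<cdot> x)"
  by (subst reassoc[OF lunit_nat]) simp_all

lemma pentagon2:
  assumes "a \<in> Obj C" "b \<in> Obj C" "c \<in> Obj C" "d \<in> Obj C" "arr x" "tgt x = ((a \<otimes> b) \<otimes> c) \<otimes> d"
  shows "\<a> a b (c \<otimes> d) \<cdot> (\<a> (a \<otimes> b) c d \<cdot> x)
    = (\<iota> a \<boxtimes> \<a> b c d) \<cdot> (\<a> a (b \<otimes> c) d \<cdot> ((\<a> a b c \<boxtimes> \<iota> d) \<cdot> x))"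
  using assms by (subst reassoc[OF pentagon]) simp_all

text \<open>Kelly's lemma: tensoring with \<open>\<one>\<close> on the left is faithful, and after doing so the
  identity follows from the pentagon and two triangles.\<close>

lemma lunit_tens:
  assumes "a \<in> Obj C" "b \<in> Obj C"
  shows "\<l> (a \<otimes> b) \<cdot> \<a> \<one> a b = \<l> a \<boxtimes> \<iota> b"
proof (rule whisk_left_inj)
  have "(\<iota> \<one> \<boxtimes> (\<l> (a \<otimes> b) \<cdot> \<a> \<one> a b)) \<cdot> (\<a> \<one> (\<one> \<otimes> a) b \<cdot> (\<a> \<one> \<one> a \<boxtimes> \<iota> b))
    = (\<iota> \<one> \<boxtimes> \<l> (a \<otimes> b)) \<cdot> (\<a> \<one> \<one> (a \<otimes> b) \<cdot> \<a> (\<one> \<otimes> \<one>) a b)"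
    using assms by (simp add: whisk_left pentagon)
  also have "\<dots> = \<a> \<one> a b \<cdot> ((\<r> \<one> \<boxtimes> \<iota> a) \<boxtimes> \<iota> b)"
    using assms by (simp add: triangle2 asso_nat)
  also have "\<dots> = \<a> \<one> a b \<cdot> (((\<iota> \<one> \<boxtimes> \<l> a) \<boxtimes> \<iota> b) \<cdot> (\<a> \<one> \<one> a \<boxtimes> \<iota> b))"
    using assms by (simp add: triangle flip: whisk_right)
  also have "\<dots> = (\<iota> \<one> \<boxtimes> (\<l> a \<boxtimes> \<iota> b)) \<cdot> (\<a> \<one> (\<one> \<otimes> a) b \<cdot> (\<a> \<one> \<one> a \<boxtimes> \<iota> b))"
    using assms by (simp add: asso_nat2)
  finally have eq: "(\<iota> \<one> \<boxtimes> (\<l> (a \<otimes> b) \<cdot> \<a> \<one> a b)) \<cdot> (\<a> \<one> (\<one> \<otimes> a) b \<cdot> (\<a> \<one> \<one> a \<boxtimes> \<iota> b))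
    = (\<iota> \<one> \<boxtimes> (\<l> a \<boxtimes> \<iota> b)) \<cdot> (\<a> \<one> (\<one> \<otimes> a) b \<cdot> (\<a> \<one> \<one> a \<boxtimes> \<iota> b))" .
  show "\<iota> \<one> \<boxtimes> (\<l> (a \<otimes> b) \<cdot> \<a> \<one> a b) = \<iota> \<one> \<boxtimes> (\<l> a \<boxtimes> \<iota> b)"
  proof (rule epi_cancel[OF eq, where y = "((\<a> \<one> \<one> a)\<dagger> \<boxtimes> \<iota> b) \<cdot> (\<a> \<one> (\<one> \<otimes> a) b)\<dagger>"])
  qed (use assms in \<open>simp_all add: tensm_comp2\<close>)
qed (use assms in simp_all)

lemma lunit_tens2:
  assumes "a \<in> Obj C" "b \<in> Obj C" "arr x" "tgt x = (\<one> \<otimes> a) \<otimes> b"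
  shows "\<l> (a \<otimes> b) \<cdot> (\<a> \<one> a b \<cdot> x) = (\<l> a \<boxtimes> \<iota> b) \<cdot> x"
  using assms by (intro reassoc lunit_tens) simp_all

text \<open>The component at \<open>Y\<close> of the natural transformation from \<open>X \<otimes> (c \<otimes> _)\<close> to the identity functor
  that \<open>w : X \<otimes> c \<rightarrow> \<one>\<close> induces; \<open>coev_op\<close> is the same for \<open>k : \<one> \<rightarrow> c \<otimes> d\<close>.\<close>

definition ev_op where
  "ev_op X c w Y = \<l> Y \<cdot> (w \<boxtimes> \<iota> Y) \<cdot> (\<a> X c Y)\<dagger>"

definition coev_op where
  "coev_op c d k Y = \<a> c d Y \<cdot> (k \<boxtimes> \<iota> Y) \<cdot> (\<l> Y)\<dagger>"

text \<open>The morphism \<open>X \<rightarrow> d\<close> that corresponds to a pairing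
  \<open>w\<close> of \<open>X\<close> with \<open>c\<close>. Dual maps, tensorators,
  \<open>phi\<close>, the unit constraint and the comparison of two duals are all mates, for
  different pairings \<open>w\<close>.\<close>

definition mate where
  "mate X c d k w = \<l> d \<cdot> (w \<boxtimes> \<iota> d) \<cdot> (\<a> X c d)\<dagger> \<cdot> (\<iota> X \<boxtimes> k) \<cdot> (\<r> X)\<dagger>"

lemma ev_op_type [simp]:
  assumes "X \<in> Obj C" "c \<in> Obj C" "Y \<in> Obj C" "arr w" "src w = X \<otimes> c" "tgt w = \<one>"
  shows "arr (ev_op X c w Y)" "src (ev_op X c w Y) = X \<otimes> (c \<otimes> Y)" "tgt (ev_op X c w Y) = Y"
  using assms unfolding ev_op_def by simp_all

lemma coev_op_type [simp]:
  assumes "c \<in> Obj C" "d \<in> Obj C" "Y \<in> Obj C" "arr k" "src k = \<one>" "tgt k = c \<otimes> d"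
  shows "arr (coev_op c d k Y)" "src (coev_op c d k Y) = Y" "tgt (coev_op c d k Y) = c \<otimes> (d \<otimes> Y)"
  using assms unfolding coev_op_def by simp_all

lemma mate_type [simp]:
  assumes "X \<in> Obj C" "c \<in> Obj C" "d \<in> Obj C" "arr k" "src k = \<one>" "tgt k = c \<otimes> d"
    "arr w" "src w = X \<otimes> c" "tgt w = \<one>"
  shows "arr (mate X c d k w)" "src (mate X c d k w) = X" "tgt (mate X c d k w) = d"
  using assms unfolding mate_def by simp_all

lemma dagger_coev_op:
  assumes "c \<in> Obj C" "d \<in> Obj C" "Y \<in> Obj C" "arr k" "src k = \<one>" "tgt k = c \<otimes> d"
  shows "(coev_op c d k Y)\<dagger> = ev_op c d (k\<dagger>) Y"
  using assms unfolding coev_op_def ev_op_def by simp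

lemma asso_nat_dag:
  assumes "arr f" "arr g" "arr h" "a = src f" "b = src g" "c = src h"
  shows "((f \<boxtimes> g) \<boxtimes> h) \<cdot> (\<a> a b c)\<dagger> = (\<a> (tgt f) (tgt g) (tgt h))\<dagger> \<cdot> (f \<boxtimes> (g \<boxtimes> h))"
  using asso_nat[of "f\<dagger>" "g\<dagger>" "h\<dagger>" a b c] assms
  by - (rule dagger_inj, simp_all)

lemma asso_nat_dag2:
  assumes "arr f" "arr g" "arr h" "a = src f" "b = src g" "c = src h"
    "arr x" "tgt x = a \<otimes> (b \<otimes> c)"
  shows "((f \<boxtimes> g) \<boxtimes> h) \<cdot> ((\<a> a b c)\<dagger> \<cdot> x) = (\<a> (tgt f) (tgt g) (tgt h))\<dagger> \<cdot> ((f \<boxtimes> (g \<boxtimes> h)) \<cdot> x)"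
  using assms by (subst reassoc[OF asso_nat_dag]) simp_all

lemma lunit_nat_dag:
  assumes "arr f" "a = src f"
  shows "(\<iota> \<one> \<boxtimes> f) \<cdot> (\<l> a)\<dagger> = (\<l> (tgt f))\<dagger> \<cdot> f"
  using lunit_nat[of "f\<dagger>" a] assms by - (rule dagger_inj, simp_all)

lemma whisk_comm2:
  assumes "arr f" "arr g" "a = src f" "b = tgt f" "a' = src g" "b' = tgt g" "arr x" "tgt x = a \<otimes> a'"
  shows "(f \<boxtimes> \<iota> b') \<cdot> ((\<iota> a \<boxtimes> g) \<cdot> x) = (\<iota> b \<boxtimes> g) \<cdot> ((f \<boxtimes> \<iota> a') \<cdot> x)"
  using assms by (simp add: tensm_comp2)

lemma ev_op_nat:
  assumes "X \<in> Obj C" "c \<in> Obj C" "arr w" "src w = X \<otimes> c" "tgt w = \<one>" "arr f" "Y = tgt f"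
  shows "ev_op X c w Y \<cdot> (\<iota> X \<boxtimes> (\<iota> c \<boxtimes> f)) = f \<cdot> ev_op X c w (src f)"
proof -
  have "ev_op X c w Y \<cdot> (\<iota> X \<boxtimes> (\<iota> c \<boxtimes> f)) = \<l> Y \<cdot> (w \<boxtimes> \<iota> Y) \<cdot> ((\<iota> X \<boxtimes> \<iota> c) \<boxtimes> f) \<cdot> (\<a> X c (src f))\<dagger>"
    using assms unfolding ev_op_def by (simp add: asso_nat_dag del: tensm_ident)
  also have "\<dots> = \<l> Y \<cdot> (\<iota> \<one> \<boxtimes> f) \<cdot> (w \<boxtimes> \<iota> (src f)) \<cdot> (\<a> X c (src f))\<dagger>"
    using assms by (simp add: whisk_comm2)
  also have "\<dots> = f \<cdot> ev_op X c w (src f)"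
    using assms unfolding ev_op_def by (simp add: lunit_nat2)
  finally show ?thesis .
qed

lemma ev_op_nat2:
  assumes "X \<in> Obj C" "c \<in> Obj C" "arr w" "src w = X \<otimes> c" "tgt w = \<one>" "arr f" "Y = tgt f"
    "arr x" "tgt x = X \<otimes> (c \<otimes> src f)"
  shows "ev_op X c w Y \<cdot> ((\<iota> X \<boxtimes> (\<iota> c \<boxtimes> f)) \<cdot> x) = f \<cdot> (ev_op X c w (src f) \<cdot> x)"
  using assms by (subst reassoc[OF ev_op_nat]) simp_all

lemma coev_op_nat:
  assumes "c \<in> Obj C" "d \<in> Obj C" "arr k" "src k = \<one>" "tgt k = c \<otimes> d" "arr f" "Y = tgt f"
  shows "coev_op c d k Y \<cdot> f = (\<iota> c \<boxtimes> (\<iota> d \<boxtimes> f)) \<cdot> coev_op c d k (src f)"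
  using ev_op_nat[of c d "k\<dagger>" "f\<dagger>" "src f"] assms
  by - (rule dagger_inj, simp_all add: dagger_coev_op)

lemma ev_op_cmp_right:
  assumes "X \<in> Obj C" "c \<in> Obj C" "Y \<in> Obj C" "arr w" "src w = X \<otimes> c" "tgt w = \<one>" "arr f" "tgt f = c"
  shows "ev_op X (src f) (w \<cdot> (\<iota> X \<boxtimes> f)) Y = ev_op X c w Y \<cdot> (\<iota> X \<boxtimes> (f \<boxtimes> \<iota> Y))"
  using assms asso_nat_dag[of "\<iota> X" f "\<iota> Y"]
  unfolding ev_op_def by (simp add: whisk_right)

lemma pentagon_mixed:
  assumes "a \<in> Obj C" "b \<in> Obj C" "c \<in> Obj C" "d \<in> Obj C"
  shows "\<a> (a \<otimes> b) c d \<cdot> ((\<a> a b c)\<dagger> \<boxtimes> \<iota> d)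
    = (\<a> a b (c \<otimes> d))\<dagger> \<cdot> ((\<iota> a \<boxtimes> \<a> b c d) \<cdot> \<a> a (b \<otimes> c) d)"
proof -
  have "\<a> (a \<otimes> b) c d \<cdot> ((\<a> a b c)\<dagger> \<boxtimes> \<iota> d)
    = (\<a> a b (c \<otimes> d))\<dagger> \<cdot> (\<a> a b (c \<otimes> d) \<cdot> (\<a> (a \<otimes> b) c d \<cdot> ((\<a> a b c)\<dagger> \<boxtimes> \<iota> d)))"
    using assms by simp
  also have "\<dots> = (\<a> a b (c \<otimes> d))\<dagger> \<cdot> ((\<iota> a \<boxtimes> \<a> b c d) \<cdot> \<a> a (b \<otimes> c) d)"
    using assms by (simp only: pentagon2 dag_type asso_type tensm_type ident_type tens_in)
      (simp add: tensm_comp)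
  finally show ?thesis .
qed

text \<open>The pentagon and the two unit triangles push every associator into \<open>ev_op\<close>
  and \<open>coev_op\<close>, so that \<open>mate_ev_op\<close> needs naturality and a zigzag
  identity only.\<close>

lemma mate_whisk:
  assumes [simp]: "X \<in> Obj C" "c \<in> Obj C" "d \<in> Obj C" "Y \<in> Obj C"
    "arr k" "src k = \<one>" "tgt k = c \<otimes> d" "arr w" "src w = X \<otimes> c" "tgt w = \<one>"
  shows "mate X c d k w \<boxtimes> \<iota> Y = ev_op X c w (d \<otimes> Y) \<cdot> (\<iota> X \<boxtimes> coev_op c d k Y)"
proof -
  have "mate X c d k w \<boxtimes> \<iota> Y = \<l> (d \<otimes> Y) \<cdot> (\<a> \<one> d Y \<cdot> (((w \<boxtimes> \<iota> d) \<boxtimes> \<iota> Y) \<cdot> (((\<a> X c d)\<dagger> \<boxtimes> \<iota> Y)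
      \<cdot> (((\<iota> X \<boxtimes> k) \<boxtimes> \<iota> Y) \<cdot> ((\<r> X)\<dagger> \<boxtimes> \<iota> Y)))))"
    unfolding mate_def by (simp add: whisk_right lunit_tens2)
  also have "\<dots> = \<l> (d \<otimes> Y) \<cdot> ((w \<boxtimes> \<iota> (d \<otimes> Y)) \<cdot> (\<a> (X \<otimes> c) d Y \<cdot> (((\<a> X c d)\<dagger> \<boxtimes> \<iota> Y)
      \<cdot> (((\<iota> X \<boxtimes> k) \<boxtimes> \<iota> Y) \<cdot> ((\<r> X)\<dagger> \<boxtimes> \<iota> Y)))))"
    by (simp add: asso_nat2)
  also have "\<dots> = \<l> (d \<otimes> Y) \<cdot> ((w \<boxtimes> \<iota> (d \<otimes> Y)) \<cdot> ((\<a> X c (d \<otimes> Y))\<dagger> \<cdot> ((\<iota> X \<boxtimes> \<a> c d Y) \<cdot> (\<a> X (c \<otimes> d) Y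
      \<cdot> (((\<iota> X \<boxtimes> k) \<boxtimes> \<iota> Y) \<cdot> ((\<r> X)\<dagger> \<boxtimes> \<iota> Y))))))"
    by (subst reassoc[OF pentagon_mixed]) simp_all
  also have "\<dots> = \<l> (d \<otimes> Y) \<cdot> ((w \<boxtimes> \<iota> (d \<otimes> Y)) \<cdot> ((\<a> X c (d \<otimes> Y))\<dagger> \<cdot> ((\<iota> X \<boxtimes> \<a> c d Y) \<cdot> 
      ((\<iota> X \<boxtimes> (k \<boxtimes> \<iota> Y)) \<cdot> (\<a> X \<one> Y \<cdot> ((\<r> X)\<dagger> \<boxtimes> \<iota> Y))))))"
    by (simp add: asso_nat2)
  also have "\<a> X \<one> Y \<cdot> ((\<r> X)\<dagger> \<boxtimes> \<iota> Y) = \<iota> X \<boxtimes> (\<l> Y)\<dagger>"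
    using arg_cong[OF triangle[of X Y], of "\<lambda>t. \<a> X \<one> Y \<cdot> t\<dagger>"] by simp
  finally show ?thesis
    unfolding ev_op_def coev_op_def by (simp add: whisk_left)
qed

text \<open>\<open>is_dual\<close> with the zigzag identities tensored with an arbitrary \<open>Y\<close>: no associators
  are left.\<close>

definition dual_pair where
  "dual_pair c d e k \<longleftrightarrow> c \<in> Obj C \<and> d \<in> Obj C \<and>
    arr e \<and> src e = d \<otimes> c \<and> tgt e = \<one> \<and> arr k \<and> src k = \<one> \<and> tgt k = c \<otimes> d \<and>
    (\<forall>Y \<in> Obj C. (\<iota> c \<boxtimes> ev_op d c e Y) \<cdot> coev_op c d k (c \<otimes> Y) = \<iota> (c \<otimes> Y) \<and>
      ev_op d c e (d \<otimes> Y) \<cdot> (\<iota> d \<boxtimes> coev_op c d k Y) = \<iota> (d \<otimes> Y))"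

text \<open>Needed for the first zigzag identity only: the left side of the second one is the mate
  of the evaluation itself and is covered by \<open>mate_whisk\<close>.\<close>

lemma zigzag_whisk:
  assumes [simp]: "c \<in> Obj C" "d \<in> Obj C" "Y \<in> Obj C"
    "arr k" "src k = \<one>" "tgt k = c \<otimes> d" "arr e" "src e = d \<otimes> c" "tgt e = \<one>"
  shows "(\<r> c \<cdot> (\<iota> c \<boxtimes> e) \<cdot> \<a> c d c \<cdot> (k \<boxtimes> \<iota> c) \<cdot> (\<l> c)\<dagger>) \<boxtimes> \<iota> Y
    = (\<iota> c \<boxtimes> ev_op d c e Y) \<cdot> coev_op c d k (c \<otimes> Y)"
proof -
  have pent: "\<a> c (d \<otimes> c) Y \<cdot> (\<a> c d c \<boxtimes> \<iota> Y) = (\<iota> c \<boxtimes> (\<a> d c Y)\<dagger>) \<cdot> (\<a> c d (c \<otimes> Y) \<cdot> \<a> (c \<otimes> d) c Y)"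
    by (simp add: pentagon tensm_comp2)
  have l: "\<a> \<one> c Y \<cdot> ((\<l> c)\<dagger> \<boxtimes> \<iota> Y) = (\<l> (c \<otimes> Y))\<dagger>"
    using arg_cong[OF lunit_tens[of c Y], of "\<lambda>t. \<a> \<one> c Y \<cdot> t\<dagger>"] by simp
  have "(\<r> c \<cdot> (\<iota> c \<boxtimes> e) \<cdot> \<a> c d c \<cdot> (k \<boxtimes> \<iota> c) \<cdot> (\<l> c)\<dagger>) \<boxtimes> \<iota> Y
    = (\<iota> c \<boxtimes> \<l> Y) \<cdot> (\<a> c \<one> Y \<cdot> (((\<iota> c \<boxtimes> e) \<boxtimes> \<iota> Y) \<cdot> ((\<a> c d c \<boxtimes> \<iota> Y) \<cdot>
        (((k \<boxtimes> \<iota> c) \<boxtimes> \<iota> Y) \<cdot> ((\<l> c)\<dagger> \<boxtimes> \<iota> Y)))))"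
    by (simp add: whisk_right triangle2)
  also have "\<dots> = (\<iota> c \<boxtimes> \<l> Y) \<cdot> ((\<iota> c \<boxtimes> (e \<boxtimes> \<iota> Y)) \<cdot> (\<a> c (d \<otimes> c) Y \<cdot> ((\<a> c d c \<boxtimes> \<iota> Y) \<cdot>
        (((k \<boxtimes> \<iota> c) \<boxtimes> \<iota> Y) \<cdot> ((\<l> c)\<dagger> \<boxtimes> \<iota> Y)))))"
    by (simp add: asso_nat2)
  also have "\<dots> = (\<iota> c \<boxtimes> \<l> Y) \<cdot> ((\<iota> c \<boxtimes> (e \<boxtimes> \<iota> Y)) \<cdot> ((\<iota> c \<boxtimes> (\<a> d c Y)\<dagger>) \<cdot> (\<a> c d (c \<otimes> Y) \<cdot>
        (\<a> (c \<otimes> d) c Y \<cdot> (((k \<boxtimes> \<iota> c) \<boxtimes> \<iota> Y) \<cdot> ((\<l> c)\<dagger> \<boxtimes> \<iota> Y))))))"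
    by (subst reassoc[OF pent]) simp_all
  also have "\<dots> = (\<iota> c \<boxtimes> \<l> Y) \<cdot> ((\<iota> c \<boxtimes> (e \<boxtimes> \<iota> Y)) \<cdot> ((\<iota> c \<boxtimes> (\<a> d c Y)\<dagger>) \<cdot> (\<a> c d (c \<otimes> Y) \<cdot>
        ((k \<boxtimes> \<iota> (c \<otimes> Y)) \<cdot> (\<l> (c \<otimes> Y))\<dagger>))))"
    by (simp add: asso_nat2 l)
  finally show ?thesis
    unfolding ev_op_def coev_op_def by (simp add: whisk_left)
qed

lemma is_dual_dual_pair:
  assumes "is_dual C c d e k" "c \<in> Obj C"
  shows "dual_pair c d e k"
proof -
  have [simp]: "c \<in> Obj C" "d \<in> Obj C"
    "arr k" "src k = \<one>" "tgt k = c \<otimes> d" "arr e" "src e = d \<otimes> c" "tgt e = \<one>"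
    using assms unfolding is_dual_def by auto
  have z1: "\<r> c \<cdot> (\<iota> c \<boxtimes> e) \<cdot> \<a> c d c \<cdot> (k \<boxtimes> \<iota> c) \<cdot> (\<l> c)\<dagger> = \<iota> c"
    and z2: "mate d c d k e = \<iota> d"
    using assms unfolding is_dual_def mate_def by auto
  show ?thesis
    using zigzag_whisk[of c d _ k e] mate_whisk[of d c d _ k e]
    unfolding dual_pair_def z1 z2 by simp
qed

section \<open>Dual pairs and the universal property of mates\<close>

lemmas interchange = tensm_comp tensm_comp2

lemma dual_pair_type:
  assumes "dual_pair c d e k"
  shows "c \<in> Obj C" "d \<in> Obj C" "arr e" "src e = d \<otimes> c" "tgt e = \<one>"
    "arr k" "src k = \<one>" "tgt k = c \<otimes> d"
  using assms unfolding dual_pair_def by simp_all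

lemma zig1:
  "\<lbrakk>dual_pair c d e k; Y \<in> Obj C\<rbrakk> \<Longrightarrow> (\<iota> c \<boxtimes> ev_op d c e Y) \<cdot> coev_op c d k (c \<otimes> Y) = \<iota> (c \<otimes> Y)"
  unfolding dual_pair_def by simp

lemma zig2:
  "\<lbrakk>dual_pair c d e k; Y \<in> Obj C\<rbrakk> \<Longrightarrow> ev_op d c e (d \<otimes> Y) \<cdot> (\<iota> d \<boxtimes> coev_op c d k Y) = \<iota> (d \<otimes> Y)"
  unfolding dual_pair_def by simp

text \<open>The dagger exchanges evaluation with coevaluation and the two zigzag identities with
  each other. It makes \<open>c\<close> a dual of its own dual, which later provides an inverse of
  \<open>phi\<close>.\<close>

lemma dual_pair_dagger:
  assumes "dual_pair c d e k"
  shows "dual_pair d c (k\<dagger>) (e\<dagger>)"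
proof -
  note [simp] = dual_pair_type[OF assms]
  have "ev_op c d (k\<dagger>) Y = (coev_op c d k Y)\<dagger>" "coev_op d c (e\<dagger>) Y = (ev_op d c e Y)\<dagger>"
    if "Y \<in> Obj C" for Y
    using that dagger_coev_op[of d c Y "e\<dagger>"] dagger_dagger[of "coev_op d c (e\<dagger>) Y"]
    by (simp_all add: dagger_coev_op)
  thus ?thesis
    using arg_cong[OF zig1[OF assms], of _ "dag C"] arg_cong[OF zig2[OF assms], of _ "dag C"]
    unfolding dual_pair_def by simp
qed

text \<open>Naturality of \<open>ev_op\<close> in its last argument moves the evaluation next to the
  coevaluation inside the mate, where the first zigzag identity cancels both. Together with
  \<open>dual_ext\<close> this characterizes the mate.\<close>

lemma mate_ev_op:
  assumes "dual_pair c d e k" and [simp]: "X \<in> Obj C" "Y \<in> Obj C" "arr w" "src w = X \<otimes> c" "tgt w = \<one>"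
  shows "ev_op d c e Y \<cdot> (mate X c d k w \<boxtimes> \<iota> (c \<otimes> Y)) = ev_op X c w Y"
proof -
  note [simp] = dual_pair_type[OF assms(1)]
  have "ev_op d c e Y \<cdot> (mate X c d k w \<boxtimes> \<iota> (c \<otimes> Y))
    = ev_op X c w Y \<cdot> ((\<iota> X \<boxtimes> (\<iota> c \<boxtimes> ev_op d c e Y)) \<cdot> (\<iota> X \<boxtimes> coev_op c d k (c \<otimes> Y)))"
    by (simp add: mate_whisk ev_op_nat2)
  also have "\<dots> = ev_op X c w Y"
    by (simp add: zig1[OF assms(1)] flip: whisk_left)
  finally show ?thesis .
qed

text \<open>The second zigzag identity recovers \<open>y \<boxtimes> \<iota> \<one>\<close> from the
  composite of \<open>y\<close> with the evaluation family at \<open>Y = d \<otimes> \<one>\<close>,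
  so that one instance of the hypothesis already determines the morphism.\<close>

lemma dual_ext:
  assumes "dual_pair c d e k"
    "\<And>Y. Y \<in> Obj C \<Longrightarrow> ev_op d c e Y \<cdot> (x \<boxtimes> \<iota> (c \<otimes> Y)) = ev_op d c e Y \<cdot> (x' \<boxtimes> \<iota> (c \<otimes> Y))"
    and [simp]: "arr x" "arr x'" "src x' = src x" "tgt x = d" "tgt x' = d"
  shows "x = x'"
proof (rule whisk_right_inj)
  note [simp] = dual_pair_type[OF assms(1)]
  have eq: "y \<boxtimes> \<iota> \<one> = ev_op d c e (d \<otimes> \<one>) \<cdot> ((y \<boxtimes> \<iota> (c \<otimes> (d \<otimes> \<one>))) \<cdot> (\<iota> (src y) \<boxtimes> coev_op c d k \<one>))"
    if [simp]: "arr y" "tgt y = d" for y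
  proof -
    have "y \<boxtimes> \<iota> \<one> = (ev_op d c e (d \<otimes> \<one>) \<cdot> (\<iota> d \<boxtimes> coev_op c d k \<one>)) \<cdot> (y \<boxtimes> \<iota> \<one>)"
      by (simp only: zig2[OF assms(1)] unit_in) simp
    thus ?thesis
      by (simp add: interchange)
  qed
  have "ev_op d c e (d \<otimes> \<one>) \<cdot> ((x \<boxtimes> \<iota> (c \<otimes> (d \<otimes> \<one>))) \<cdot> (\<iota> (src x) \<boxtimes> coev_op c d k \<one>))
    = ev_op d c e (d \<otimes> \<one>) \<cdot> ((x' \<boxtimes> \<iota> (c \<otimes> (d \<otimes> \<one>))) \<cdot> (\<iota> (src x) \<boxtimes> coev_op c d k \<one>))"
    by (subst reassoc[OF assms(2)]) simp_all
  thus "x \<boxtimes> \<iota> \<one> = x' \<boxtimes> \<iota> \<one>"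
    unfolding eq[OF assms(3,6)] eq[OF assms(4,7)] assms(5) .
qed simp_all

lemma ev_op_asso:
  assumes [simp]: "X \<in> Obj C" "X' \<in> Obj C" "c \<in> Obj C" "Y \<in> Obj C"
    "arr w" "src w = X \<otimes> (X' \<otimes> c)" "tgt w = \<one>"
  shows "ev_op (X \<otimes> X') c (w \<cdot> \<a> X X' c) Y
    = ev_op X (X' \<otimes> c) w Y \<cdot> (\<iota> X \<boxtimes> (\<a> X' c Y)\<dagger>) \<cdot> \<a> X X' (c \<otimes> Y)"
proof -
  have "(\<a> X X' c \<boxtimes> \<iota> Y) = (\<a> X (X' \<otimes> c) Y)\<dagger> \<cdot> (\<iota> X \<boxtimes> (\<a> X' c Y)\<dagger>) \<cdot> \<a> X X' (c \<otimes> Y) \<cdot> \<a> (X \<otimes> X') c Y"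
    by (simp add: pentagon interchange)
  thus ?thesis
    unfolding ev_op_def by (simp add: whisk_right)
qed

lemma ev_op_whisk:
  assumes [simp]: "X \<in> Obj C" "c \<in> Obj C" "b \<in> Obj C" "Y \<in> Obj C"
    "arr w" "src w = X \<otimes> c" "tgt w = \<one>"
  shows "ev_op X c w b \<boxtimes> \<iota> Y = ev_op X c w (b \<otimes> Y) \<cdot> (\<iota> X \<boxtimes> \<a> c b Y) \<cdot> \<a> X (c \<otimes> b) Y"
proof -
  have "ev_op X c w b \<boxtimes> \<iota> Y
    = \<l> (b \<otimes> Y) \<cdot> (w \<boxtimes> \<iota> (b \<otimes> Y)) \<cdot> \<a> (X \<otimes> c) b Y \<cdot> ((\<a> X c b)\<dagger> \<boxtimes> \<iota> Y)"
    using lunit_tens2[of b Y] asso_nat2[of w "\<iota> b" "\<iota> Y" \<one> b Y]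
    unfolding ev_op_def by (simp add: whisk_right flip: lunit_tens2)
  thus ?thesis
    unfolding ev_op_def by (simp add: pentagon_mixed)
qed

section \<open>Bilinearity of composition and tensor product\<close>

lemma comp_add_left:
  "\<lbrakk>arr f; arr g; arr h; src g = tgt f; src h = src g; tgt h = tgt g\<rbrakk>
    \<Longrightarrow> add_mor C g h \<cdot> f = add_mor C (g \<cdot> f) (h \<cdot> f)"
  using cmp_add_left[of "src f" "tgt f" "tgt g" f g h] by simp

lemma comp_add_right:
  "\<lbrakk>arr f; arr g; arr h; src h = tgt f; src g = src f; tgt g = tgt f\<rbrakk>
    \<Longrightarrow> h \<cdot> add_mor C f g = add_mor C (h \<cdot> f) (h \<cdot> g)"
  using cmp_add_right[of "src f" "tgt f" "tgt h" f g h] by simp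

lemma comp_scale_left:
  "\<lbrakk>arr f; arr g; src g = tgt f\<rbrakk> \<Longrightarrow> scale_mor C z g \<cdot> f = scale_mor C z (g \<cdot> f)"
  using cmp_scale_left[of "src f" "tgt f" "tgt g" f g] by simp

lemma comp_scale_right:
  "\<lbrakk>arr f; arr g; src g = tgt f\<rbrakk> \<Longrightarrow> g \<cdot> scale_mor C z f = scale_mor C z (g \<cdot> f)"
  using cmp_scale_right[of "src f" "tgt f" "tgt g" f g] by simp

lemma tens_add_left:
  "\<lbrakk>arr f; arr g; arr h; src g = src f; tgt g = tgt f\<rbrakk>
    \<Longrightarrow> add_mor C f g \<boxtimes> h = add_mor C (f \<boxtimes> h) (g \<boxtimes> h)"
  using tensm_add_left[of "src f" "tgt f" "src h" "tgt h" f g h] by simp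

lemma tens_add_right:
  "\<lbrakk>arr f; arr g; arr h; src g = src f; tgt g = tgt f\<rbrakk>
    \<Longrightarrow> h \<boxtimes> add_mor C f g = add_mor C (h \<boxtimes> f) (h \<boxtimes> g)"
  using tensm_add_right[of "src f" "tgt f" "src h" "tgt h" f g h] by simp

lemma tens_scale_left:
  "\<lbrakk>arr f; arr h\<rbrakk> \<Longrightarrow> scale_mor C z f \<boxtimes> h = scale_mor C z (f \<boxtimes> h)"
  using tensm_scale_left[of "src f" "tgt f" "src h" "tgt h" f h] by simp

lemma tens_scale_right:
  "\<lbrakk>arr f; arr h\<rbrakk> \<Longrightarrow> h \<boxtimes> scale_mor C z f = scale_mor C z (h \<boxtimes> f)"
  using tensm_scale_right[of "src f" "tgt f" "src h" "tgt h" f h] by simp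

lemma dagger_add:
  "\<lbrakk>arr f; arr g; src g = src f; tgt g = tgt f\<rbrakk> \<Longrightarrow> (add_mor C f g)\<dagger> = add_mor C (f\<dagger>) (g\<dagger>)"
  using dag_add[of "src f" "tgt f" f g] by simp

lemma dagger_scale: "arr f \<Longrightarrow> (scale_mor C z f)\<dagger> = scale_mor C (cnj z) (f\<dagger>)"
  using dag_scale[of "src f" "tgt f" f] by simp

lemmas bilinear = comp_add_left comp_add_right comp_scale_left comp_scale_right
  tens_add_left tens_add_right tens_scale_left tens_scale_right

text \<open>Uniqueness of duals. Tested against the evaluation family, each mate trades one
  evaluation for the other, and the round trip is the identity. It supplies inverses for the unit
  constraint, for \<open>phi\<close> and for \<open>zeta\<close>.\<close>

lemma mates_inverse:
  assumes 1: "dual_pair c d e k" and 2: "dual_pair c d' e' k'"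
  shows "mate d' c d k e' \<cdot> mate d c d' k' e = \<iota> d"
proof (rule dual_ext[OF 1])
  note [simp] = dual_pair_type[OF 1] dual_pair_type[OF 2]
  fix Y assume [simp]: "Y \<in> Obj C"
  show "ev_op d c e Y \<cdot> ((mate d' c d k e' \<cdot> mate d c d' k' e) \<boxtimes> \<iota> (c \<otimes> Y))
    = ev_op d c e Y \<cdot> (\<iota> d \<boxtimes> \<iota> (c \<otimes> Y))"
    by (simp add: whisk_right reassoc[OF mate_ev_op[OF 1]] mate_ev_op[OF 2])
qed (use dual_pair_type[OF 1] dual_pair_type[OF 2] in simp_all)

lemma lunit_nat_dag2:
  assumes "arr f" "a = src f" "arr x" "tgt x = a"
  shows "(\<iota> \<one> \<boxtimes> f) \<cdot> ((\<l> a)\<dagger> \<cdot> x) = (\<l> (tgt f))\<dagger> \<cdot> (f \<cdot> x)"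
  using assms by (subst reassoc[OF lunit_nat_dag]) simp_all

subsection \<open>Simple objects\<close>

abbreviation zero where "zero \<equiv> zero_mor C"

lemma add_zero_right [simp]: "\<lbrakk>arr f; a = src f; b = tgt f\<rbrakk> \<Longrightarrow> add_mor C f (zero a b) = f"
  using add_zero[of "src f" "tgt f" f] by simp

lemma add_zero_left [simp]: "\<lbrakk>arr f; a = src f; b = tgt f\<rbrakk> \<Longrightarrow> add_mor C (zero a b) f = f"
  using add_comm[of "src f" "tgt f" f "zero a b"] by simp

lemma add_minus: "\<lbrakk>arr f; a = src f; b = tgt f\<rbrakk> \<Longrightarrow> add_mor C f (scale_mor C (-1) f) = zero a b"
  using add_neg[of "src f" "tgt f" f] by simp

lemma scale_1 [simp]: "arr f \<Longrightarrow> scale_mor C 1 f = f"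
  using scale_one[of "src f" "tgt f" f] by simp

lemma scale_twice [simp]: "arr f \<Longrightarrow> scale_mor C z (scale_mor C w f) = scale_mor C (z * w) f"
  using scale_scale[of "src f" "tgt f" f] by simp

lemma add_scale: "arr f \<Longrightarrow> add_mor C (scale_mor C z f) (scale_mor C w f) = scale_mor C (z + w) f"
  using scale_add_left[of "src f" "tgt f" f z w] by simp

lemma scale_add:
  "\<lbrakk>arr f; arr g; src g = src f; tgt g = tgt f\<rbrakk>
    \<Longrightarrow> scale_mor C z (add_mor C f g) = add_mor C (scale_mor C z f) (scale_mor C z g)"
  using scale_add_right[of "src f" "tgt f" f g z] by simp

lemma add_asso:
  "\<lbrakk>arr f; arr g; arr h; src g = src f; tgt g = tgt f; src h = src f; tgt h = tgt f\<rbrakk>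
    \<Longrightarrow> add_mor C (add_mor C f g) h = add_mor C f (add_mor C g h)"
  using add_assoc[of "src f" "tgt f" f g h] by simp

lemma add_commute:
  "\<lbrakk>arr f; arr g; src g = src f; tgt g = tgt f\<rbrakk> \<Longrightarrow> add_mor C f g = add_mor C g f"
  using add_comm[of "src f" "tgt f" f g] by simp

text \<open>Compare \<open>1 - 1 = 0\<close> with \<open>add_minus\<close>. The rules for zero
  morphisms under composition, tensor product and dagger then follow from the rules for scalars at
  \<open>0\<close>.\<close>

lemma scale_0:
  assumes "arr f"
  shows "scale_mor C 0 f = zero (src f) (tgt f)"
  using add_minus[OF assms refl refl] add_scale[OF assms, of 1 "-1"] assms by simp

lemma scale_zero [simp]:
  assumes "a \<in> Obj C" "b \<in> Obj C"
  shows "scale_mor C z (zero a b) = zero a b"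
  using scale_0[of "zero a b"] scale_twice[of "zero a b" z 0] assms by simp

lemma zero_comp_left [simp]: "\<lbrakk>arr f; b = tgt f; c \<in> Obj C\<rbrakk> \<Longrightarrow> zero b c \<cdot> f = zero (src f) c"
  using scale_0[of "zero b c"] scale_0[of "zero b c
    \<cdot> f"] comp_scale_left[of f "zero b c" 0, symmetric] by simp

lemma zero_comp_right [simp]:
  assumes "arr f" "b = src f" "a \<in> Obj C"
  shows "f \<cdot> zero a b = zero a (tgt f)"
proof -
  have "scale_mor C 0 (f \<cdot> zero a b) = f \<cdot> zero a b"
    by (subst comp_scale_right[symmetric]) (use assms in simp_all)
  moreover have "scale_mor C 0 (f \<cdot> zero a b) = zero a (tgt f)"
    using assms by (subst scale_0) simp_all
  ultimately show ?thesis
    by simp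
qed

lemma zero_tens_left [simp]:
  "\<lbrakk>arr f; a \<in> Obj C; b \<in> Obj C\<rbrakk> \<Longrightarrow> zero a b \<boxtimes> f = zero (a \<otimes> src f) (b \<otimes> tgt f)"
  using scale_0[of "zero a b"] scale_0[of "zero a b \<boxtimes> f"] tens_scale_left[of "zero a b" f 0, symmetric] by simp

lemma zero_tens_right [simp]:
  "\<lbrakk>arr f; a \<in> Obj C; b \<in> Obj C\<rbrakk> \<Longrightarrow> f \<boxtimes> zero a b = zero (src f \<otimes> a) (tgt f \<otimes> b)"
  using scale_0[of "zero a b"] scale_0[of "f \<boxtimes> zero a b"] tens_scale_right[of "zero a b" f 0, symmetric] by simp

lemma dagger_zero [simp]: "\<lbrakk>a \<in> Obj C; b \<in> Obj C\<rbrakk> \<Longrightarrow> (zero a b)\<dagger> = zero b a"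
  using scale_0[of "zero a b"] scale_0[of "(zero a b)\<dagger>"] dagger_scale[of "zero a b" 0] by simp

lemma add_minus_cancel:
  assumes "add_mor C f (scale_mor C (-1) g) = zero (src f) (tgt f)"
    and [simp]: "arr f" "arr g" "src g = src f" "tgt g = tgt f"
  shows "f = g"
proof -
  have "f = add_mor C f (add_mor C (scale_mor C (-1) g) g)"
    using add_scale[of g "-1" 1] scale_0[of g] by simp
  also have "\<dots> = add_mor C (add_mor C f (scale_mor C (-1) g)) g"
    by (simp add: add_asso)
  also have "\<dots> = g"
    unfolding assms(1) by simp
  finally show ?thesis .
qed

lemma scale_eq_zero:
  assumes "scale_mor C z f = zero (src f) (tgt f)" "arr f"
  shows "z = 0 \<or> f = zero (src f) (tgt f)"
  using arg_cong[OF assms(1), of "scale_mor C (inverse z)"] assms(2) by (cases "z = 0") simp_all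

lemma scale_cancel:
  assumes "scale_mor C z f = scale_mor C w f" "arr f" "f \<noteq> zero (src f) (tgt f)"
  shows "z = w"
proof -
  have "scale_mor C (z - w) f = zero (src f) (tgt f)"
    using assms(1,2) add_scale[of f z "- w"] add_scale[of f w "- w"] scale_0[of f] by simp
  thus ?thesis
    using scale_eq_zero[of "z - w" f] assms(2,3) by simp
qed

lemma zero_object_from: "\<lbrakk>zero_object C z; arr f; src f = z\<rbrakk> \<Longrightarrow> f = zero z (tgt f)"
  unfolding zero_object_def by (metis hom_iff tgt_Obj zero_type)

lemma zero_object_iff:
  assumes "a \<in> Obj C"
  shows "zero_object C a \<longleftrightarrow> \<iota> a = zero a a"
proof
  assume "zero_object C a"
  thus "\<iota> a = zero a a"
    using zero_object_from[of a "\<iota> a"] assms by simp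
next
  assume z: "\<iota> a = zero a a"
  have l: "f = zero (src f) a" if "arr f" "tgt f = a" for f
    using id_left[OF that] that assms unfolding z by simp
  have r: "f = zero a (tgt f)" if "arr f" "src f = a" for f
    using id_right[OF that] that assms unfolding z by simp
  have "\<exists>!f. f \<in> Hom C x a" if "x \<in> Obj C" for x
    by (rule ex1I[of _ "zero x a"]) (use that assms l in auto)
  moreover have "\<exists>!f. f \<in> Hom C a x" if "x \<in> Obj C" for x
    by (rule ex1I[of _ "zero a x"]) (use that assms r in auto)
  ultimately show "zero_object C a"
    unfolding zero_object_def using assms by blast
qed

section \<open>Simple objects and Schur's lemma\<close>

lemma simple_Obj [simp]: "simple_object C s \<Longrightarrow> s \<in> Obj C"
  unfolding simple_object_def by blast

lemma simple_nonzero: "simple_object C s \<Longrightarrow> \<iota> s \<noteq> zero s s"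
  using zero_object_iff unfolding simple_object_def by blast

lemma isomorphism_iff:
  "\<lbrakk>a \<in> Obj C; b \<in> Obj C\<rbrakk> \<Longrightarrow> isomorphism C a b f \<longleftrightarrow> arr f \<and> src f = a \<and> tgt f = b \<and>
    (\<exists>g. arr g \<and> src g = b \<and> tgt g = a \<and> g \<cdot> f = \<iota> a \<and> f \<cdot> g = \<iota> b)"
  unfolding isomorphism_def by auto

text \<open>The kernel of \<open>f\<close> is a monomorphism into \<open>s\<close>, hence zero or an
  isomorphism. An isomorphism would force \<open>f\<close> to vanish; with a zero kernel, the
  difference of two morphisms equalized by \<open>f\<close> factors through a zero object.\<close>

lemma simple_monic:
  assumes "simple_object C s" "arr f" "src f = s" "f \<noteq> zero s (tgt f)"
  shows "monic C s (tgt f) f"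
proof -
  obtain k i where ker: "is_kernel C s (tgt f) f k i"
    using kernel_exists[of s "tgt f" f] assms by auto
  have k [simp]: "k \<in> Obj C" "arr i" "src i = k" "tgt i = s" "s \<in> Obj C"
    and fi: "f \<cdot> i = zero k (tgt f)"
    using ker assms unfolding is_kernel_def by auto
  have lift: "\<exists>!h. h \<in> Hom C x k \<and> i \<cdot> h = g"
    if "x \<in> Obj C" "arr g" "src g = x" "tgt g = s" "f \<cdot> g = zero x (tgt f)" for x g
    using ker that assms unfolding is_kernel_def by auto
  have "monic C k s i"
    unfolding monic_def
  proof (intro conjI ballI impI)
    fix x g h assume x: "x \<in> Obj C" "g \<in> Hom C x k" "h \<in> Hom C x k" "i \<cdot> g = i \<cdot> h"
    have "f \<cdot> (i \<cdot> g) = (f \<cdot> i) \<cdot> g"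
      using x assms by simp
    hence "f \<cdot> (i \<cdot> g) = zero x (tgt f)"
      unfolding fi using x assms by simp
    thus "g = h"
      using lift[of x "i \<cdot> g"] x by auto
  qed simp_all
  then consider "zero_object C k" | "isomorphism C k s i"
    using assms(1) k unfolding simple_object_def by blast
  thus ?thesis
  proof cases
    case 1
    show ?thesis
      unfolding monic_def
    proof (intro conjI ballI impI)
      fix x g h assume x: "x \<in> Obj C" "g \<in> Hom C x s" "h \<in> Hom C x s" "f \<cdot> g = f \<cdot> h"
      have "f \<cdot> add_mor C g (scale_mor C (-1) h) = zero x (tgt f)"
        using x assms by (simp add: bilinear add_minus)
      then obtain u where u: "arr u" "src u = x" "tgt u = k" "i \<cdot> u = add_mor C g (scale_mor C (-1) h)"
        using lift[of x "add_mor C g (scale_mor C (-1) h)"] x by auto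
      have "i = zero k s"
        using zero_object_from[OF 1, of i] by simp
      hence *: "add_mor C g (scale_mor C (-1) h) = zero x s"
        using u by simp
      show "g = h"
        by (rule add_minus_cancel) (use x * in simp_all)
    qed (use assms in simp_all)
  next
    case 2
    then obtain g where "arr g" "src g = s" "tgt g = k" "i \<cdot> g = \<iota> s"
      using isomorphism_iff[of k s i] by auto
    hence "f = (f \<cdot> i) \<cdot> g"
      using assms by simp
    hence "f = zero s (tgt f)"
      unfolding fi using \<open>arr g\<close> \<open>src g = s\<close> \<open>tgt g = k\<close> assms by simp
    thus ?thesis
      using assms by simp
  qed
qed

text \<open>By \<open>simple_monic\<close> the nonzero \<open>f\<close> is a monomorphism; its
  source is not a zero object, so simplicity of the target makes it an isomorphism.\<close>

lemma schur:
  assumes "simple_object C s" "simple_object C s'" "arr f" "src f = s" "tgt f = s'" "f \<noteq> zero s s'"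
  obtains g where "arr g" "src g = s'" "tgt g = s" "g \<cdot> f = \<iota> s" "f \<cdot> g = \<iota> s'"
proof -
  have "monic C s s' f"
    using simple_monic[of s f] assms by auto
  hence "isomorphism C s s' f"
    using assms unfolding simple_object_def by blast
  thus ?thesis
    using that assms isomorphism_iff[of s s' f] by auto
qed

text \<open>Every identity is a sum of morphisms that factor through simple objects.\<close>

lemma ident_induct:
  assumes a [simp]: "a \<in> Obj C"
    and zero: "P (zero a a)"
    and add: "\<And>f g. \<lbrakk>arr f; src f = a; tgt f = a; arr g; src g = a; tgt g
      = a; P f; P g\<rbrakk> \<Longrightarrow> P (add_mor C f g)"
    and simple: "\<And>s i p. \<lbrakk>simple_object C s; arr i; src i = s; tgt i = a; arr p; src p = a; tgt p
      = s\<rbrakk> \<Longrightarrow> P (i \<cdot> p)"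
  shows "P (\<iota> a)"
proof -
  \<comment> \<open>The induction varies the semisimple object \<open>x\<close> while
    \<open>a\<close> stays fixed, so the claim is stated for all composites through
    \<open>x\<close>; at the end \<open>x\<close> is \<open>a\<close> and both factors are
    identities.\<close>
  have "\<forall>f g. arr f \<and> src f = x \<and> tgt f = a \<and> arr g \<and> src g = a \<and> tgt g = x \<longrightarrow> P (f \<cdot> g)"
    if "semisimple_object C x" for x
    using that
  proof (induction rule: semisimple_object.induct)
    case (1 z)
    show ?case
    proof (intro allI impI, elim conjE)
      fix f g assume fg: "arr f" "src f = z" "tgt f = a" "arr g" "src g = a" "tgt g = z"
      show "P (f \<cdot> g)"
        using zero_object_from[OF 1 fg(1,2)] fg zero by simp
    qed
  next
    case (2 x t y i j p q)
    have [simp]: "y \<in> Obj C" "t \<in> Obj C" "x \<in> Obj C"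
      using 2(1-3) unfolding direct_sum_def
      by (auto elim: semisimple_object.cases simp: zero_object_def direct_sum_def)
    have [simp]: "arr i" "src i = x" "tgt i = y" "arr j" "src j = t" "tgt j = y"
      "arr p" "src p = y" "tgt p = x" "arr q" "src q = y" "tgt q = t"
      and id: "add_mor C (i \<cdot> p) (j \<cdot> q) = \<iota> y"
      using 2(3) unfolding direct_sum_def by simp_all
    show ?case
    proof (intro allI impI, elim conjE)
      fix f g assume [simp]: "arr f" "src f = y" "tgt f = a" "arr g" "src g = a" "tgt g = y"
      have "f \<cdot> g = f \<cdot> (add_mor C (i \<cdot> p) (j \<cdot> q) \<cdot> g)"
        unfolding id by simp
      also have "\<dots> = add_mor C ((f \<cdot> i) \<cdot> (p \<cdot> g)) ((f \<cdot> j) \<cdot> (q \<cdot> g))"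
        by (simp add: bilinear)
      finally have fg: "f \<cdot> g = add_mor C ((f \<cdot> i) \<cdot> (p \<cdot> g)) ((f \<cdot> j) \<cdot> (q \<cdot> g))" .
      have "P ((f \<cdot> i) \<cdot> (p \<cdot> g))"
        using 2(4)[rule_format, of "f \<cdot> i" "p \<cdot> g"] by simp
      moreover have "P ((f \<cdot> j) \<cdot> (q \<cdot> g))"
        using 2(2) by (intro simple[of t]) simp_all
      ultimately show "P (f \<cdot> g)"
        unfolding fg by (intro add) simp_all
    qed
  qed
  from this[OF semisimple[OF a], rule_format, of "\<iota> a" "\<iota> a"] have "P (\<iota> a \<cdot> \<iota> a)"
    by simp
  thus ?thesis
    by simp
qed

lemma simple_ext:
  assumes "arr f" "arr g" "src f = a" "src g = a" "tgt g = tgt f"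
    and eq: "\<And>s i. \<lbrakk>simple_object C s; arr i; src i = s; tgt i = a\<rbrakk> \<Longrightarrow> f \<cdot> i = g \<cdot> i"
  shows "f = g"
proof -
  have "a \<in> Obj C"
    using assms by auto
  hence "f \<cdot> \<iota> a = g \<cdot> \<iota> a"
  proof (rule ident_induct)
    fix s i p assume "simple_object C s" "arr i" "src i = s" "tgt i = a" "arr p" "src p = a" "tgt p = s"
    thus "f \<cdot> (i \<cdot> p) = g \<cdot> (i \<cdot> p)"
      using reassoc[OF eq, of s i p] assms by simp
  qed (use assms in \<open>auto simp: bilinear\<close>)
  thus ?thesis
    using assms by simp
qed

section \<open>Endomorphisms of simple objects are scalars\<close>

text \<open>The value of the polynomial \<open>p\<close> at \<open>f\<close>, by Horner's scheme.
  Addition and composition are meaningful only for morphisms of matching type, so the type of all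
  morphisms is no ring in which \<open>poly\<close> could be evaluated.\<close>

definition poly_mor where
  "poly_mor a f p = fold_coeffs (\<lambda>c h. add_mor C (scale_mor C c (\<iota> a)) (f \<cdot> h)) p (zero a a)"

context
  fixes a f
  assumes f [simp]: "arr f" "src f = a" "tgt f = a" "a \<in> Obj C"
begin

lemma poly_mor_0 [simp]: "poly_mor a f 0 = zero a a"
  unfolding poly_mor_def by simp

lemma poly_mor_pCons [simp]:
  "poly_mor a f (pCons c p) = add_mor C (scale_mor C c (\<iota> a)) (f \<cdot> poly_mor a f p)"
proof (cases "c = 0 \<and> p = 0")
  case True
  thus ?thesis
    by (simp add: scale_0)
next
  case False
  thus ?thesis
    unfolding poly_mor_def by (auto simp: fold_coeffs_pCons_not_0_0_eq fold_coeffs_pCons_coeff_not_0_eq)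
qed

lemma poly_mor_type [simp]: "arr (poly_mor a f p)" "src (poly_mor a f p) = a" "tgt (poly_mor a f p) = a"
  by (induction p) simp_all

lemma poly_mor_add: "poly_mor a f (p + q) = add_mor C (poly_mor a f p) (poly_mor a f q)"
proof (induction p q rule: poly_induct2)
  case (pCons c p d q)
  let ?c = "scale_mor C c (\<iota> a)" and ?d = "scale_mor C d (\<iota> a)"
    and ?p = "f \<cdot> poly_mor a f p" and ?q = "f \<cdot> poly_mor a f q"
  have "add_mor C (add_mor C ?c ?d) (add_mor C ?p ?q) = add_mor C ?c (add_mor C (add_mor C ?d ?p) ?q)"
    by (simp add: add_asso)
  also have "\<dots> = add_mor C (add_mor C ?c ?p) (add_mor C ?d ?q)"
    by (subst add_commute[of ?d ?p]) (simp_all add: add_asso)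
  finally show ?case
    using pCons by (simp add: comp_add_right flip: add_scale)
qed simp

lemma poly_mor_smult: "poly_mor a f (smult c p) = scale_mor C c (poly_mor a f p)"
  by (induction p) (simp_all add: scale_add comp_scale_right)

lemma poly_mor_root:
  "poly_mor a f ([:- z, 1:] * q) = add_mor C f (scale_mor C (- z) (\<iota> a)) \<cdot> poly_mor a f q"
proof -
  have "[:- z, 1:] * q = smult (- z) q + pCons 0 q"
    by simp
  also have "poly_mor a f \<dots> = add_mor C (scale_mor C (- z) (poly_mor a f q)) (f \<cdot> poly_mor a f q)"
    unfolding poly_mor_add poly_mor_smult by (simp add: scale_0)
  finally show ?thesis
    by (simp add: comp_add_left comp_scale_left add_commute)
qed

end

text \<open>A list fixes the order of summation, so no sum over a set is needed for an addition that
  is commutative only within a hom-space. Coefficients are attached to the morphisms themselves,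
  which is why \<open>lin_comb_single\<close> asks for a distinct list.\<close>

fun lin_comb where
  "lin_comb a c [] = zero a a"
| "lin_comb a c (g # gs) = add_mor C (scale_mor C (c g) g) (lin_comb a c gs)"

lemma lin_comb_type [simp]:
  assumes "a \<in> Obj C" "set gs \<subseteq> Hom C a a"
  shows "arr (lin_comb a c gs)" "src (lin_comb a c gs) = a" "tgt (lin_comb a c gs) = a"
proof -
  have "arr (lin_comb a c gs) \<and> src (lin_comb a c gs) = a \<and> tgt (lin_comb a c gs) = a"
    using assms by (induction gs) auto
  thus "arr (lin_comb a c gs)" "src (lin_comb a c gs) = a" "tgt (lin_comb a c gs) = a"
    by auto
qed

lemma lin_comb_cong: "(\<And>g. g \<in> set gs \<Longrightarrow> c g = d g) \<Longrightarrow> lin_comb a c gs = lin_comb a d gs"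
  by (induction gs) auto

lemma lin_comb_0: "\<lbrakk>a \<in> Obj C; set gs \<subseteq> Hom C a a\<rbrakk> \<Longrightarrow> lin_comb a (\<lambda>_. 0) gs = zero a a"
  by (induction gs) (auto simp: scale_0)

lemma lin_comb_add_scale:
  assumes [simp]: "a \<in> Obj C" and "set gs \<subseteq> Hom C a a"
  shows "lin_comb a (\<lambda>g. c g + z * d g) gs
    = add_mor C (lin_comb a c gs) (scale_mor C z (lin_comb a d gs))"
  using assms(2)
proof (induction gs)
  case (Cons g gs)
  hence [simp]: "arr g" "src g = a" "tgt g = a" "set gs \<subseteq> Hom C a a"
    by auto
  let ?c = "scale_mor C (c g) g" and ?d = "scale_mor C (z * d g) g"
    and ?C = "lin_comb a c gs" and ?D = "scale_mor C z (lin_comb a d gs)"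
  have "add_mor C (add_mor C ?c ?d) (add_mor C ?C ?D) = add_mor C ?c (add_mor C (add_mor C ?d ?C) ?D)"
    by (simp add: add_asso)
  also have "\<dots> = add_mor C (add_mor C ?c ?C) (add_mor C ?d ?D)"
    by (subst add_commute[of ?d ?C]) (simp_all add: add_asso)
  finally show ?case
    using Cons by (simp add: scale_add flip: add_scale)
qed simp

lemma lin_comb_single:
  assumes [simp]: "a \<in> Obj C" and "set gs \<subseteq> Hom C a a" "h \<in> set gs" "distinct gs"
  shows "lin_comb a (\<lambda>g. if g = h then 1 else 0) gs = h"
  using assms(2-)
proof (induction gs)
  case (Cons g gs)
  hence [simp]: "arr g" "src g = a" "tgt g = a" "set gs \<subseteq> Hom C a a"
    by auto
  show ?case
  proof (cases "g = h")
    case True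
    hence "lin_comb a (\<lambda>g. if g = h then 1 else 0) gs = lin_comb a (\<lambda>_. 0) gs"
      using Cons.prems by (intro lin_comb_cong) auto
    thus ?thesis
      using True[symmetric] by (simp add: lin_comb_0)
  next
    case False
    moreover have "h \<in> Hom C a a"
      using Cons.prems(1,2) by blast
    hence "arr h" "src h = a" "tgt h = a"
      by simp_all
    ultimately show ?thesis
      using Cons by (simp add: scale_0)
  qed
qed simp

lemma lin_span_lin_comb:
  assumes "f \<in> lin_span C a a (set gs)" and a: "a \<in> Obj C" "set gs \<subseteq> Hom C a a" "distinct gs"
  shows "\<exists>c. f = lin_comb a c gs"
  using assms(1)
proof induction
  case 1
  show ?case
    using lin_comb_0[OF a(1,2)] by metis
next
  case (2 f g z)
  then obtain c where "f = lin_comb a c gs"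
    by auto
  hence "add_mor C f (scale_mor C z g) = lin_comb a (\<lambda>h. c h + z * (if h = g then 1 else 0)) gs"
    using 2 a by (simp only: lin_comb_add_scale lin_comb_single)
  thus ?case
    by blast
qed

text \<open>If the finite set \<open>S\<close> spans the endomorphisms of \<open>a\<close>, then
  \<open>card S + 1\<close> powers of \<open>f\<close>, starting with the zeroth, have linearly
  dependent coordinate vectors.\<close>

lemma annihilating_poly:
  assumes f [simp]: "arr f" "src f = a" "tgt f = a"
  shows "\<exists>p. p \<noteq> 0 \<and> poly_mor a f p = zero a a"
proof -
  have a [simp]: "a \<in> Obj C"
    using src_Obj[OF f(1)] by simp
  note fa = f a
  obtain S where S: "finite S" "S \<subseteq> Hom C a a" "Hom C a a \<subseteq> lin_span C a a S"
    using locally_finite_hom[OF a a] unfolding finite_dim_hom_def by blast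
  obtain gs where gs: "set gs = S" "distinct gs"
    using finite_distinct_list[OF S(1)] by blast
  have gsH: "set gs \<subseteq> Hom C a a"
    using gs S by simp
  have "\<exists>c. poly_mor a f (monom 1 k) = lin_comb a c gs" for k :: nat
    using S gs lin_span_lin_comb[OF _ a gsH gs(2)] by (metis hom_iff a poly_mor_type[OF fa] subsetD)
  then obtain v where v: "\<And>k. poly_mor a f (monom 1 k) = lin_comb a (v k) gs"
    by metis
  have comb: "poly_mor a f (\<Sum>k<n. monom (c k) k)
    = lin_comb a (\<lambda>g. \<Sum>k<n. c k * v k g) gs" for c and n :: nat
  proof (induction n)
    case 0
    show ?case
      using lin_comb_0[OF a gsH] f by simp
  next
    case (Suc n)
    have "monom (c n) n = smult (c n) (monom 1 n)"
      by (simp add: smult_monom)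
    hence "poly_mor a f (monom (c n) n) = scale_mor C (c n) (lin_comb a (v n) gs)"
      using v by (simp only: poly_mor_smult[OF fa])
    thus ?case
      using Suc f by (simp add: poly_mor_add lin_comb_add_scale[OF a gsH])
  qed
  obtain c where c: "\<exists>k<Suc (card S). c k \<noteq> 0" "\<forall>g \<in> S. (\<Sum>k<Suc (card S). c k * v k g) = 0"
    using linear_dependence[of S "{..<Suc (card S)}" v] S by auto
  let ?p = "\<Sum>k<Suc (card S). monom (c k) k"
  have "poly_mor a f ?p = lin_comb a (\<lambda>_. 0) gs"
    unfolding comb using c gs by (intro lin_comb_cong) auto
  moreover have "coeff ?p k = (if k < Suc (card S) then c k else 0)" for k
    by (simp only: coeff_sum coeff_monom) (simp add: sum.delta)
  hence "?p \<noteq> 0"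
    using c(1) by (metis coeff_0)
  ultimately show ?thesis
    using lin_comb_0[OF a gsH] by metis
qed

text \<open>Take a root \<open>z\<close> of an annihilating polynomial. Either \<open>f - z\<close>
  vanishes, or it is invertible by Schur's lemma and can be cancelled, which leaves an annihilating
  polynomial of smaller degree. A nonzero constant cannot annihilate because the identity of
  \<open>s\<close> is nonzero.\<close>

lemma End_simple:
  assumes s: "simple_object C s" and f: "arr f" "src f = s" "tgt f = s"
  shows "\<exists>z. f = scale_mor C z (\<iota> s)"
proof -
  have [simp]: "s \<in> Obj C" "arr f" "src f = s" "tgt f = s"
    using assms by simp_all
  have "\<exists>z. f = scale_mor C z (\<iota> s)" if "p \<noteq> 0" "poly_mor s f p = zero s s" for p
    using that
  proof (induction "degree p" arbitrary: p rule: less_induct)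
    case less
    show ?case
    proof (cases "degree p = 0")
      case True
      then obtain c where "p = [:c:]" "c \<noteq> 0"
        using less.prems degree_eq_zeroE by (metis pCons_0_0)
      hence "scale_mor C c (\<iota> s) = zero s s"
        using less.prems f by simp
      thus ?thesis
        using scale_eq_zero[of c "\<iota> s"] simple_nonzero[OF s] \<open>c \<noteq> 0\<close> by simp
    next
      case False
      then obtain z where "poly p z = 0"
        using fundamental_theorem_of_algebra[of p] constant_degree[of p] by auto
      then obtain q where q: "p = [:- z, 1:] * q"
        using poly_eq_0_iff_dvd by (metis dvdE)
      have q0: "q \<noteq> 0"
        using q less.prems by auto
      let ?g = "add_mor C f (scale_mor C (- z) (\<iota> s))"
      show ?thesis
      proof (cases "?g = zero s s")
        case True
        have "f = scale_mor C z (\<iota> s)"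
          by (rule add_minus_cancel) (use True in simp_all)
        thus ?thesis ..
      next
        case False
        then obtain h where h: "arr h" "src h = s" "tgt h = s" "h \<cdot> ?g = \<iota> s"
          using schur[OF s s, of ?g] by auto
        have "?g \<cdot> poly_mor s f q = zero s s"
          using less.prems unfolding q poly_mor_root[OF f \<open>s \<in> Obj C\<close>] by simp
        hence "h \<cdot> (?g \<cdot> poly_mor s f q) = zero s s"
          using h by simp
        hence "poly_mor s f q = zero s s"
          using f h by (simp add: reassoc[OF h(4)])
        moreover have "degree q < degree p"
          using q0 degree_mult_eq[of "[:- z, 1:]" q] unfolding q by simp
        ultimately show ?thesis
          using less.hyps q0 by blast
      qed
    qed
  qed
  thus ?thesis
    using annihilating_poly[of f s] by auto
qed

section \<open>Positivity from the C*-norms\<close>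

text \<open>The C*-identity applies to endomorphisms only. The isometries of an orthogonal direct
  sum turn \<open>u\<close> into a corner of an endomorphism \<open>?x\<close> of \<open>s\<close>
  with \<open>?x\<dagger> \<cdot> ?x = 0\<close>; hence \<open>?x\<close> has norm 0, and
  \<open>u\<close> is recovered from it.\<close>

lemma dagger_comp_zero:
  assumes u [simp]: "arr u" "src u = a" "tgt u = b" and z: "u\<dagger> \<cdot> u = zero a a"
  shows "u = zero a b"
proof -
  have [simp]: "a \<in> Obj C" "b \<in> Obj C"
    using src_Obj[OF u(1)] tgt_Obj[OF u(1)] by simp_all
  obtain s i j where "direct_sum C a b s i j (i\<dagger>) (j\<dagger>)"
    using orthogonal_direct_sum[of a b] by auto
  hence [simp]: "s \<in> Obj C" "arr i" "src i = a" "tgt i = s" "arr j" "src j = b" "tgt j = s"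
    and ii: "i\<dagger> \<cdot> i = \<iota> a" and jj: "j\<dagger> \<cdot> j = \<iota> b"
    unfolding direct_sum_def by auto
  let ?x = "j \<cdot> u \<cdot> i\<dagger>"
  have "?x\<dagger> \<cdot> ?x = zero s s"
    by (simp add: reassoc[OF jj] reassoc[OF z])
  moreover obtain N where "Cstar_norm C s N"
    using end_Cstar[of s] by auto
  moreover have "?x \<in> Hom C s s"
    by simp
  ultimately have "(N ?x)\<^sup>2 = 0" and N: "N ?x = 0 \<longleftrightarrow> ?x = zero s s"
    unfolding Cstar_norm_def by (metis zero_in \<open>s \<in> Obj C\<close>)+
  hence "?x = zero s s"
    by simp
  hence "j\<dagger> \<cdot> (?x \<cdot> i) = zero a b"
    by simp
  thus ?thesis
    by (simp add: ii reassoc[OF jj])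
qed

text \<open>If \<open>u\<dagger> \<cdot> u = - r \<iota>\<close> with \<open>r > 0\<close>, then the column with entries \<open>\<iota>\<close> and \<open>u / sqrt r\<close> is
  a nonzero morphism \<open>y\<close> into the orthogonal direct sum with \<open>y\<dagger> \<cdot> y = 0\<close>.\<close>

lemma dagger_comp_pos:
  assumes u [simp]: "arr u" "src u = a" "tgt u = b" and z: "u\<dagger> \<cdot> u = scale_mor C z (\<iota> a)"
    and "u \<noteq> zero a b"
  obtains r where "r > 0" "z = complex_of_real r"
proof -
  have [simp]: "a \<in> Obj C" "b \<in> Obj C"
    using src_Obj[OF u(1)] tgt_Obj[OF u(1)] by simp_all
  have a0: "\<iota> a \<noteq> zero a a"
  proof
    assume "\<iota> a = zero a a"
    hence "u \<cdot> \<iota> a = zero a b"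
      by simp
    thus False
      using assms(5) by simp
  qed
  have "z \<noteq> 0"
    using dagger_comp_zero[OF u] z assms(5) by (auto simp: scale_0)
  have "u\<dagger> \<cdot> u = scale_mor C (cnj z) (\<iota> a)"
    using arg_cong[OF z, of "dag C"] by (simp add: dagger_scale)
  hence "scale_mor C (cnj z) (\<iota> a) = scale_mor C z (\<iota> a)"
    unfolding z ..
  hence "cnj z = z"
    using scale_cancel[of "cnj z" "\<iota> a" z] a0 by simp
  then obtain r where r: "z = complex_of_real r"
    by (metis Reals_cases Reals_cnj_iff)
  have "\<not> r < 0"
  proof
    assume "r < 0"
    \<comment> \<open>Here \<open>r\<close> is negative, so \<open>- r\<close> is the positive
      number of the description above; \<open>x\<close> is chosen such that
      \<open>x * x * z = - 1\<close>.\<close>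
    define x where "x = complex_of_real (1 / sqrt (- r))"
    have x: "cnj x = x" "x * x * z = - 1"
      using \<open>r < 0\<close> unfolding x_def r by (simp_all flip: of_real_mult)
    obtain s i j where ds: "direct_sum C a b s i j (i\<dagger>) (j\<dagger>)"
      using orthogonal_direct_sum[of a b] by auto
    hence [simp]: "s \<in> Obj C" "arr i" "src i = a" "tgt i = s" "arr j" "src j = b" "tgt j = s"
      and ii: "i\<dagger> \<cdot> i = \<iota> a" and jj: "j\<dagger> \<cdot> j = \<iota> b"
      and ij: "i\<dagger> \<cdot> j = zero b a" and ji: "j\<dagger> \<cdot> i = zero a b"
      unfolding direct_sum_def by auto
    let ?y = "add_mor C i (scale_mor C x (j \<cdot> u))"
    have "?y\<dagger> \<cdot> ?y = add_mor C (\<iota> a) (scale_mor C (x * x) (u\<dagger> \<cdot> u))"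
      by (simp add: dagger_add dagger_scale bilinear x ii ji reassoc[OF jj] reassoc[OF ij])
    also have "\<dots> = zero a a"
      unfolding z by (simp add: x add_minus)
    finally have y: "?y\<dagger> \<cdot> ?y = zero a a" .
    have "?y = zero a s"
      by (rule dagger_comp_zero[OF _ _ _ y]) simp_all
    hence "i\<dagger> \<cdot> ?y = zero a a"
      by simp
    thus False
      using a0 by (simp add: bilinear ii reassoc[OF ij])
  qed
  moreover have "r \<noteq> 0"
    using \<open>z \<noteq> 0\<close> r by auto
  ultimately show ?thesis
    using that r by (metis linorder_neqE_linordered_idom)
qed

text \<open>By Schur's lemma the hypothesis says that \<open>t\<close> is constant on isomorphism
  classes of simple objects. The endomorphism is built along a decomposition, but described only by
  its action on morphisms out of simple objects; by \<open>simple_ext\<close> it is therefore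
  independent of that decomposition.\<close>

lemma central_exists:
  assumes t: "\<And>s s' f. \<lbrakk>simple_object C s; simple_object C s'; arr f; src f = s; tgt f
    = s'; f \<noteq> zero s s'\<rbrakk>
    \<Longrightarrow> t s = t s'"
    and c: "c \<in> Obj C"
  shows "\<exists>T. arr T \<and> src T = c \<and> tgt T = c \<and>
    (\<forall>s g. simple_object C s \<and> arr g \<and> src g = s \<and> tgt g = c \<longrightarrow> T \<cdot> g = scale_mor C (t s) g)"
  using semisimple[OF c]
proof induction
  case (1 z)
  have z [simp]: "z \<in> Obj C"
    using 1 unfolding zero_object_def by blast
  have iz: "\<iota> z = zero z z"
    using 1 zero_object_iff[OF z] by simp
  have "g = zero (src g) z" if "arr g" "tgt g = z" for g
    using id_left[OF that] that unfolding iz by simp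
  hence "\<iota> z \<cdot> g = scale_mor C (t s) g" if "arr g" "tgt g = z" for s g
    using that scale_zero[of "src g" z "t s"] by (metis id_left src_Obj z)
  thus ?case
    by (intro exI[of _ "\<iota> z"]) simp
next
  case (2 x r y i j p q)
  obtain T where T: "arr T" "src T = x" "tgt T = x"
    and Tg: "\<And>s g. \<lbrakk>simple_object C s; arr g; src g = s; tgt g = x\<rbrakk> \<Longrightarrow> T \<cdot> g = scale_mor C (t s) g"
    using 2(4) by blast
  have [simp]: "y \<in> Obj C" "r \<in> Obj C" "x \<in> Obj C" "arr T" "src T = x" "tgt T = x"
    using 2(2,3) T unfolding direct_sum_def by auto
  have [simp]: "arr i" "src i = x" "tgt i = y" "arr j" "src j = r" "tgt j = y"
    "arr p" "src p = y" "tgt p = x" "arr q" "src q = y" "tgt q = r"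
    and id: "add_mor C (i \<cdot> p) (j \<cdot> q) = \<iota> y"
    using 2(3) unfolding direct_sum_def by simp_all
  let ?T = "add_mor C (i \<cdot> T \<cdot> p) (scale_mor C (t r) (j \<cdot> q))"
  have "?T \<cdot> g = scale_mor C (t s) g" if s: "simple_object C s" and [simp]: "arr g" "src g
    = s" "tgt g = y" for s g
  proof -
    \<comment> \<open>The component of \<open>g\<close> in the simple summand \<open>r\<close> is
      zero unless \<open>t s = t r\<close>.\<close>
    have "scale_mor C (t r) (q \<cdot> g) = scale_mor C (t s) (q \<cdot> g)"
      using t[OF s 2(2), of "q \<cdot> g"] s by (cases "q \<cdot> g = zero s r") simp_all
    hence "j \<cdot> scale_mor C (t r) (q \<cdot> g) = j \<cdot> scale_mor C (t s) (q \<cdot> g)"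
      by simp
    moreover have "T \<cdot> (p \<cdot> g) = scale_mor C (t s) (p \<cdot> g)"
      using Tg[OF s] by simp
    ultimately have "?T \<cdot> g = scale_mor C (t s) (add_mor C (i \<cdot> p) (j \<cdot> q) \<cdot> g)"
      using s by (simp add: bilinear scale_add)
    thus ?thesis
      unfolding id by simp
  qed
  thus ?case
    by (intro exI[of _ ?T]) simp
qed

end

section \<open>Unitary dual functors\<close>

locale unitary_dual = unitary_multitensor_category +
  fixes D
  assumes unitary_dual: "unitary_dual_functor C D"
begin

abbreviation V where "V \<equiv> dob D"
abbreviation dm where "dm \<equiv> dual_map C D"
abbreviation ten where "ten \<equiv> dual_tensorator C D"
abbreviation phi where "phi \<equiv> canonical_phi C D"

definition E where "E c Y = ev_op (V c) c (ev D c) Y"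
definition K where "K c Y = coev_op c (V c) (coev D c) Y"

lemma dual_pairV: "c \<in> Obj C \<Longrightarrow> dual_pair c (V c) (ev D c) (coev D c)"
  using unitary_dual is_dual_dual_pair unfolding unitary_dual_functor_def dual_functor_def by blast

lemma V_type [simp]:
  assumes "c \<in> Obj C"
  shows "V c \<in> Obj C" "arr (ev D c)" "src (ev D c) = V c \<otimes> c" "tgt (ev D c) = \<one>"
    "arr (coev D c)" "src (coev D c) = \<one>" "tgt (coev D c) = c \<otimes> V c"
  using dual_pair_type[OF dual_pairV[OF assms]] by simp_all

lemma E_type [simp]:
  assumes "c \<in> Obj C" "Y \<in> Obj C"
  shows "arr (E c Y)" "src (E c Y) = V c \<otimes> (c \<otimes> Y)" "tgt (E c Y) = Y"
  using assms unfolding E_def by simp_all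

lemma K_type [simp]:
  assumes "c \<in> Obj C" "Y \<in> Obj C"
  shows "arr (K c Y)" "src (K c Y) = Y" "tgt (K c Y) = c \<otimes> (V c \<otimes> Y)"
  using assms unfolding K_def by simp_all

lemma E_nat:
  "\<lbrakk>c \<in> Obj C; arr f; Y = tgt f\<rbrakk> \<Longrightarrow> E c Y \<cdot> (\<iota> (V c) \<boxtimes> (\<iota> c \<boxtimes> f)) = f \<cdot> E c (src f)"
  unfolding E_def by (simp add: ev_op_nat)

lemma E_nat2:
  "\<lbrakk>c \<in> Obj C; arr f; Y = tgt f; arr x; tgt x = V c \<otimes> (c \<otimes> src f)\<rbrakk>
    \<Longrightarrow> E c Y \<cdot> ((\<iota> (V c) \<boxtimes> (\<iota> c \<boxtimes> f)) \<cdot> x) = f \<cdot> (E c (src f) \<cdot> x)"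
  by (subst reassoc[OF E_nat]) simp_all

lemma K_nat:
  "\<lbrakk>c \<in> Obj C; arr f; Y = tgt f\<rbrakk> \<Longrightarrow> K c Y \<cdot> f = (\<iota> c \<boxtimes> (\<iota> (V c) \<boxtimes> f)) \<cdot> K c (src f)"
  unfolding K_def by (simp add: coev_op_nat)

lemma EK:
  assumes "c \<in> Obj C" "Y \<in> Obj C"
  shows "(\<iota> c \<boxtimes> E c Y) \<cdot> K c (c \<otimes> Y) = \<iota> (c \<otimes> Y)"
    "E c (V c \<otimes> Y) \<cdot> (\<iota> (V c) \<boxtimes> K c Y) = \<iota> (V c \<otimes> Y)"
    "\<lbrakk>arr x; tgt x = c \<otimes> Y\<rbrakk> \<Longrightarrow> (\<iota> c \<boxtimes> E c Y) \<cdot> (K c (c \<otimes> Y) \<cdot> x) = x"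
    "\<lbrakk>arr x; tgt x = V c \<otimes> Y\<rbrakk> \<Longrightarrow> E c (V c \<otimes> Y) \<cdot> ((\<iota> (V c) \<boxtimes> K c Y) \<cdot> x) = x"
proof -
  show *: "(\<iota> c \<boxtimes> E c Y) \<cdot> K c (c \<otimes> Y) = \<iota> (c \<otimes> Y)"
    "E c (V c \<otimes> Y) \<cdot> (\<iota> (V c) \<boxtimes> K c Y) = \<iota> (V c \<otimes> Y)"
    using assms zig1 zig2 dual_pairV unfolding E_def K_def by simp_all
  show "\<lbrakk>arr x; tgt x = c \<otimes> Y\<rbrakk> \<Longrightarrow> (\<iota> c \<boxtimes> E c Y) \<cdot> (K c (c \<otimes> Y) \<cdot> x) = x"
    using assms by (simp add: reassoc[OF *(1)])
  show "\<lbrakk>arr x; tgt x = V c \<otimes> Y\<rbrakk> \<Longrightarrow> E c (V c \<otimes> Y) \<cdot> ((\<iota> (V c) \<boxtimes> K c Y) \<cdot> x) = x"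
    using assms by (simp add: reassoc[OF *(2)])
qed

lemma E_ext:
  assumes "\<And>Y. Y \<in> Obj C \<Longrightarrow> E c Y \<cdot> (x \<boxtimes> \<iota> (c \<otimes> Y)) = E c Y \<cdot> (x' \<boxtimes> \<iota> (c \<otimes> Y))"
    "arr x" "arr x'" "src x' = src x" "tgt x = V c" "tgt x' = V c" "c \<in> Obj C"
  shows "x = x'"
  using dual_ext[OF dual_pairV] assms unfolding E_def by blast

section \<open>Dual maps, tensorators and \<open>phi\<close> as mates\<close>

lemma dm_mate:
  "\<lbrakk>arr f; a = src f; b = tgt f\<rbrakk> \<Longrightarrow> dm a b f = mate (V b) a (V a) (coev D a) (ev D b \<cdot> (\<iota> (V b) \<boxtimes> f))"
  unfolding dual_map_def mate_def by (simp add: whisk_right)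

lemma dm_type [simp]:
  assumes "arr f" "a = src f" "b = tgt f"
  shows "arr (dm a b f)" "src (dm a b f) = V b" "tgt (dm a b f) = V a"
  using assms by (simp_all add: dm_mate)

lemma dm_E:
  assumes "arr f" "a = src f" "b = tgt f" "Y \<in> Obj C"
  shows "E a Y \<cdot> (dm a b f \<boxtimes> \<iota> (a \<otimes> Y)) = E b Y \<cdot> (\<iota> (V b) \<boxtimes> (f \<boxtimes> \<iota> Y))"
proof -
  have "ev_op (V a) a (ev D a) Y \<cdot> (dm a b f \<boxtimes> \<iota> (a \<otimes> Y))
    = ev_op (V b) (src f) (ev D b \<cdot> (\<iota> (V b) \<boxtimes> f)) Y"
    unfolding dm_mate[OF assms(1-3)] unfolding assms(2,3)
    by (rule mate_ev_op[OF dual_pairV]) (simp_all add: assms)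
  also have "\<dots> = ev_op (V b) b (ev D b) Y \<cdot> (\<iota> (V b) \<boxtimes> (f \<boxtimes> \<iota> Y))"
    by (rule ev_op_cmp_right) (simp_all add: assms)
  finally show ?thesis
    unfolding E_def .
qed

lemma dm_E2:
  assumes "arr f" "a = src f" "b = tgt f" "Y \<in> Obj C" "arr x" "tgt x = V b \<otimes> (a \<otimes> Y)"
  shows "E a Y \<cdot> ((dm a b f \<boxtimes> \<iota> (a \<otimes> Y)) \<cdot> x) = E b Y \<cdot> ((\<iota> (V b) \<boxtimes> (f \<boxtimes> \<iota> Y)) \<cdot> x)"
  using assms by (subst reassoc[OF dm_E]) simp_all

lemma dm_dag:
  "\<lbrakk>arr f; a = src f; b = tgt f\<rbrakk> \<Longrightarrow> (dm a b f)\<dagger> = dm b a (f\<dagger>)"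
  using unitary_dual unfolding unitary_dual_functor_def by simp

lemma nested_ev_type [simp]:
  assumes "a \<in> Obj C" "b \<in> Obj C"
  shows "arr (nested_ev C D a b)" "src (nested_ev C D a b) = (V b \<otimes> V a) \<otimes> (a \<otimes> b)"
    "tgt (nested_ev C D a b) = \<one>"
  using assms unfolding nested_ev_def by simp_all

lemma ten_unitary: "\<lbrakk>a \<in> Obj C; b \<in> Obj C\<rbrakk> \<Longrightarrow> unitary C (V b \<otimes> V a) (V (a \<otimes> b)) (ten a b)"
  using unitary_dual unfolding unitary_dual_functor_def by simp

lemma ten_type [simp]:
  assumes "a \<in> Obj C" "b \<in> Obj C"
  shows "arr (ten a b)" "src (ten a b) = V b \<otimes> V a" "tgt (ten a b) = V (a \<otimes> b)"
  using ten_unitary[OF assms] assms by (simp_all add: unitary_iff)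

lemma ten_cancel [simp]:
  assumes "a \<in> Obj C" "b \<in> Obj C"
  shows "(ten a b)\<dagger> \<cdot> ten a b = \<iota> (V b \<otimes> V a)" "ten a b \<cdot> (ten a b)\<dagger> = \<iota> (V (a \<otimes> b))"
    "\<lbrakk>arr x; tgt x = V b \<otimes> V a\<rbrakk> \<Longrightarrow> (ten a b)\<dagger> \<cdot> (ten a b \<cdot> x) = x"
    "\<lbrakk>arr x; tgt x = V (a \<otimes> b)\<rbrakk> \<Longrightarrow> ten a b \<cdot> ((ten a b)\<dagger> \<cdot> x) = x"
proof -
  show *: "(ten a b)\<dagger> \<cdot> ten a b = \<iota> (V b \<otimes> V a)" "ten a b \<cdot> (ten a b)\<dagger> = \<iota> (V (a \<otimes> b))"
    using ten_unitary[OF assms] assms by (simp_all add: unitary_iff)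
  show "\<lbrakk>arr x; tgt x = V b \<otimes> V a\<rbrakk> \<Longrightarrow> (ten a b)\<dagger> \<cdot> (ten a b \<cdot> x) = x"
    using assms by (simp add: reassoc[OF *(1)])
  show "\<lbrakk>arr x; tgt x = V (a \<otimes> b)\<rbrakk> \<Longrightarrow> ten a b \<cdot> ((ten a b)\<dagger> \<cdot> x) = x"
    using assms by (simp add: reassoc[OF *(2)])
qed

text \<open>Up to an associator, \<open>nested_ev\<close> is \<open>ev D b\<close> after the
  whiskered \<open>E a b\<close>. The lemmas \<open>ev_op_asso\<close>,
  \<open>ev_op_cmp_right\<close> and \<open>ev_op_whisk\<close> handle these constituents one by
  one.\<close>

lemma ev_op_nested:
  assumes [simp]: "a \<in> Obj C" "b \<in> Obj C" "Y \<in> Obj C"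
  shows "ev_op (V b \<otimes> V a) (a \<otimes> b) (nested_ev C D a b) Y
    = E b Y \<cdot> (\<iota> (V b) \<boxtimes> (E a (b \<otimes> Y) \<cdot> (\<iota> (V a) \<boxtimes> \<a> a b Y))) \<cdot> \<a> (V b) (V a) ((a \<otimes> b) \<otimes> Y)"
proof -
  have n: "nested_ev C D a b = (ev D b \<cdot> (\<iota> (V b) \<boxtimes> E a b)) \<cdot> \<a> (V b) (V a) (a \<otimes> b)"
    unfolding nested_ev_def E_def ev_op_def by (simp add: whisk_left)
  have e: "E a b \<boxtimes> \<iota> Y = E a (b \<otimes> Y) \<cdot> (\<iota> (V a) \<boxtimes> \<a> a b Y) \<cdot> \<a> (V a) (a \<otimes> b) Y"
    unfolding E_def by (simp add: ev_op_whisk)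
  have c: "ev_op (V b) (V a \<otimes> (a \<otimes> b)) (ev D b \<cdot> (\<iota> (V b) \<boxtimes> E a b)) Y = E b Y
    \<cdot> (\<iota> (V b) \<boxtimes> (E a b \<boxtimes> \<iota> Y))"
    using ev_op_cmp_right[of "V b" b Y "ev D b" "E a b"] unfolding E_def[of b Y] by simp
  show ?thesis
    unfolding n by (subst ev_op_asso) (simp_all add: c e interchange)
qed

lemma ten_E:
  assumes "a \<in> Obj C" "b \<in> Obj C" "Y \<in> Obj C"
  shows "E (a \<otimes> b) Y \<cdot> (ten a b \<boxtimes> \<iota> ((a \<otimes> b) \<otimes> Y))
    = E b Y \<cdot> (\<iota> (V b) \<boxtimes> (E a (b \<otimes> Y) \<cdot> (\<iota> (V a) \<boxtimes> \<a> a b Y))) \<cdot> \<a> (V b) (V a) ((a \<otimes> b) \<otimes> Y)"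
proof -
  have "ten a b = mate (V b \<otimes> V a) (a \<otimes> b) (V (a \<otimes> b)) (coev D (a \<otimes> b)) (nested_ev C D a b)"
    unfolding dual_tensorator_def mate_def ..
  thus ?thesis
    using assms mate_ev_op[OF dual_pairV, of "a \<otimes> b" "V b \<otimes> V a" Y "nested_ev C D a b"]
      ev_op_nested[OF assms]
    unfolding E_def[of "a \<otimes> b"] by simp
qed

lemma ten_E2:
  assumes "a \<in> Obj C" "b \<in> Obj C" "Y \<in> Obj C" "arr x" "tgt x = (V b \<otimes> V a) \<otimes> ((a \<otimes> b) \<otimes> Y)"
  shows "E (a \<otimes> b) Y \<cdot> ((ten a b \<boxtimes> \<iota> ((a \<otimes> b) \<otimes> Y)) \<cdot> x)
    = E b Y \<cdot> (\<iota> (V b) \<boxtimes> (E a (b \<otimes> Y) \<cdot> (\<iota> (V a) \<boxtimes> \<a> a b Y))) \<cdot> \<a> (V b) (V a) ((a \<otimes> b) \<otimes> Y) \<cdot> x"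
  using assms by (subst reassoc[OF ten_E]) simp_all

lemma phi_mate: "phi c = mate c (V c) (V (V c)) (coev D (V c)) ((coev D c)\<dagger>)"
  unfolding canonical_phi_def mate_def ..

lemma phi_type [simp]:
  assumes "c \<in> Obj C"
  shows "arr (phi c)" "src (phi c) = c" "tgt (phi c) = V (V c)"
  using assms by (simp_all add: phi_mate)

text \<open>As \<open>phi\<close> is the mate of the dagger of the coevaluation, testing it against
  evaluations turns every claim about \<open>phi\<close> into the dagger of a claim about
  \<open>K\<close>.\<close>

lemma phi_E:
  assumes "c \<in> Obj C" "Y \<in> Obj C"
  shows "E (V c) Y \<cdot> (phi c \<boxtimes> \<iota> (V c \<otimes> Y)) = (K c Y)\<dagger>"
  using assms mate_ev_op[OF dual_pairV, of "V c" c Y "(coev D c)\<dagger>"]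
  unfolding E_def K_def by (simp add: phi_mate dagger_coev_op)

lemma phi_E2:
  assumes "c \<in> Obj C" "Y \<in> Obj C" "arr x" "tgt x = c \<otimes> (V c \<otimes> Y)"
  shows "E (V c) Y \<cdot> ((phi c \<boxtimes> \<iota> (V c \<otimes> Y)) \<cdot> x) = (K c Y)\<dagger> \<cdot> x"
  using assms by (subst reassoc[OF phi_E]) simp_all

section \<open>Functoriality of the dual, naturality and associativity of the tensorator\<close>

lemma dm_ident: "a \<in> Obj C \<Longrightarrow> dm a a (\<iota> a) = \<iota> (V a)"
  by (rule E_ext[of a]) (simp_all add: dm_E)

lemma dm_comp:
  assumes "arr f" "arr g" "src g = tgt f" "a = src f" "b = tgt f" "c = tgt g"
  shows "dm a c (g \<cdot> f) = dm a b f \<cdot> dm b c g"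
proof (rule E_ext[of a])
  fix Y assume [simp]: "Y \<in> Obj C"
  have "E a Y \<cdot> ((dm a b f \<cdot> dm b c g) \<boxtimes> \<iota> (a \<otimes> Y)) = E b Y \<cdot> ((\<iota> (V b) \<boxtimes> (f \<boxtimes> \<iota> Y))
    \<cdot> (dm b c g \<boxtimes> \<iota> (a \<otimes> Y)))"
    using assms by (simp add: whisk_right dm_E2)
  also have "\<dots> = E b Y \<cdot> ((dm b c g \<boxtimes> \<iota> (b \<otimes> Y)) \<cdot> (\<iota> (V c) \<boxtimes> (f \<boxtimes> \<iota> Y)))"
    using assms by (simp add: interchange)
  also have "\<dots> = E a Y \<cdot> (dm a c (g \<cdot> f) \<boxtimes> \<iota> (a \<otimes> Y))"
    using assms by (subst dm_E2) (simp_all add: dm_E interchange)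
  finally show "E a Y \<cdot> (dm a c (g \<cdot> f) \<boxtimes> \<iota> (a \<otimes> Y)) = E a Y \<cdot> ((dm a b f \<cdot> dm b c g) \<boxtimes> \<iota> (a \<otimes> Y))" ..
qed (use assms in simp_all)

lemma dm_add:
  "\<lbrakk>arr f; arr g; src g = src f; tgt g = tgt f; a = src f; b = tgt f\<rbrakk>
    \<Longrightarrow> dm a b (add_mor C f g) = add_mor C (dm a b f) (dm a b g)"
  unfolding dual_map_def by (simp add: bilinear)

lemma dm_scale:
  "\<lbrakk>arr f; a = src f; b = tgt f\<rbrakk> \<Longrightarrow> dm a b (scale_mor C z f) = scale_mor C z (dm a b f)"
  unfolding dual_map_def by (simp add: bilinear)

text \<open>Against \<open>E\<close>, both dual maps can be traded for \<open>f\<close> and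
  \<open>g\<close> by \<open>dm_E\<close>. In \<open>step\<close>, naturality first slides
  \<open>g\<close> out of the evaluation of \<open>a\<close>, so that it reaches the evaluation of
  \<open>b\<close>.\<close>

lemma ten_nat:
  assumes f: "arr f" "a = src f" "a' = tgt f" and g: "arr g" "b = src g" "b' = tgt g"
  shows "dm (a \<otimes> b) (a' \<otimes> b') (f \<boxtimes> g) \<cdot> ten a' b' = ten a b \<cdot> (dm b b' g \<boxtimes> dm a a' f)"
proof (rule E_ext[of "a \<otimes> b"])
  have [simp]: "arr f" "src f = a" "tgt f = a'" "arr g" "src g = b" "tgt g = b'"
    "a \<in> Obj C" "a' \<in> Obj C" "b \<in> Obj C" "b' \<in> Obj C"
    using assms by auto
  fix Y assume [simp]: "Y \<in> Obj C"
  have step: "E a' (b' \<otimes> Y) \<cdot> (\<iota> (V a') \<boxtimes> (f \<boxtimes> (g \<boxtimes> \<iota> Y)))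
    = (g \<boxtimes> \<iota> Y) \<cdot> (E a (b \<otimes> Y) \<cdot> (dm a a' f \<boxtimes> \<iota> (a \<otimes> (b \<otimes> Y))))"
  proof -
    have "E a' (b' \<otimes> Y) \<cdot> (\<iota> (V a') \<boxtimes> (f \<boxtimes> (g \<boxtimes> \<iota> Y)))
      = E a' (b' \<otimes> Y) \<cdot> ((\<iota> (V a') \<boxtimes> (\<iota> a' \<boxtimes> (g \<boxtimes> \<iota> Y))) \<cdot> (\<iota> (V a') \<boxtimes> (f \<boxtimes> \<iota> (b \<otimes> Y))))"
      by (simp add: interchange)
    thus ?thesis
      by (simp add: E_nat2 dm_E)
  qed
  have "E (a \<otimes> b) Y \<cdot> ((dm (a \<otimes> b) (a' \<otimes> b') (f \<boxtimes> g) \<cdot> ten a' b') \<boxtimes> \<iota> ((a \<otimes> b) \<otimes> Y))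
    = E (a' \<otimes> b') Y \<cdot> ((\<iota> (V (a' \<otimes> b')) \<boxtimes> ((f \<boxtimes> g) \<boxtimes> \<iota> Y)) \<cdot> (ten a' b' \<boxtimes> \<iota> ((a \<otimes> b) \<otimes> Y)))"
    by (simp add: whisk_right dm_E2)
  also have "\<dots> = E (a' \<otimes> b') Y \<cdot> ((ten a' b' \<boxtimes> \<iota> ((a' \<otimes> b') \<otimes> Y))
    \<cdot> ((\<iota> (V b') \<boxtimes> \<iota> (V a')) \<boxtimes> ((f \<boxtimes> g) \<boxtimes> \<iota> Y)))"
    by (simp add: interchange)
  also have "\<dots> = E b' Y \<cdot> ((\<iota> (V b') \<boxtimes> (E a' (b' \<otimes> Y) \<cdot> (\<iota> (V a') \<boxtimes> (f \<boxtimes> (g \<boxtimes> \<iota> Y)))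
    \<cdot> (\<iota> (V a') \<boxtimes> \<a> a b Y)))
    \<cdot> \<a> (V b') (V a') ((a \<otimes> b) \<otimes> Y))"
    by (subst ten_E2) (simp_all del: tensm_ident add: asso_nat asso_nat2 interchange)
  also have "\<dots> = E b' Y \<cdot> ((\<iota> (V b') \<boxtimes> (g \<boxtimes> \<iota> Y)) \<cdot> ((\<iota> (V b') \<boxtimes> (E a (b \<otimes> Y)
    \<cdot> (dm a a' f \<boxtimes> \<iota> (a \<otimes> (b \<otimes> Y))) \<cdot> (\<iota> (V a') \<boxtimes> \<a> a b Y)))
    \<cdot> \<a> (V b') (V a') ((a \<otimes> b) \<otimes> Y)))"
    by (subst reassoc[OF step]) (simp_all add: tensm_comp2)
  also have "\<dots> = E b Y \<cdot> ((dm b b' g \<boxtimes> \<iota> (b \<otimes> Y)) \<cdot> ((\<iota> (V b') \<boxtimes> (E a (b \<otimes> Y)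
    \<cdot> (dm a a' f \<boxtimes> \<iota> (a \<otimes> (b \<otimes> Y))) \<cdot> (\<iota> (V a') \<boxtimes> \<a> a b Y)))
    \<cdot> \<a> (V b') (V a') ((a \<otimes> b) \<otimes> Y)))"
    by (subst dm_E2) simp_all
  also have "\<dots> = E (a \<otimes> b) Y \<cdot> ((ten a b \<boxtimes> \<iota> ((a \<otimes> b) \<otimes> Y))
    \<cdot> ((dm b b' g \<boxtimes> dm a a' f) \<boxtimes> \<iota> ((a \<otimes> b) \<otimes> Y)))"
    by (subst ten_E2) (simp_all add: asso_nat interchange)
  also have "\<dots> = E (a \<otimes> b) Y \<cdot> ((ten a b \<cdot> (dm b b' g \<boxtimes> dm a a' f)) \<boxtimes> \<iota> ((a \<otimes> b) \<otimes> Y))"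
    by (simp add: whisk_right)
  finally show "E (a \<otimes> b) Y \<cdot> ((dm (a \<otimes> b) (a' \<otimes> b') (f \<boxtimes> g) \<cdot> ten a' b') \<boxtimes> \<iota> ((a \<otimes> b) \<otimes> Y))
    = E (a \<otimes> b) Y \<cdot> ((ten a b \<cdot> (dm b b' g \<boxtimes> dm a a' f)) \<boxtimes> \<iota> ((a \<otimes> b) \<otimes> Y))" .
qed (use assms in simp_all)

text \<open>Against \<open>E\<close>, both sides evaluate \<open>c\<close>, then \<open>b\<close>,
  then \<open>a\<close>. They differ only in how the brackets are moved, which two pentagons settle:
  \<open>pent\<close> on the side of the duals and \<open>pent2\<close> on the side of
  \<open>c\<close>, \<open>b\<close>, \<open>a\<close>.\<close>

lemma ten_asso:
  assumes [simp]: "a \<in> Obj C" "b \<in> Obj C" "c \<in> Obj C"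
  shows "ten c (b \<otimes> a) \<cdot> (ten b a \<boxtimes> \<iota> (V c))
    = dm (c \<otimes> (b \<otimes> a)) ((c \<otimes> b) \<otimes> a) ((\<a> c b a)\<dagger>) \<cdot> ten (c \<otimes> b) a \<cdot> (\<iota> (V a) \<boxtimes> ten c b) \<cdot> \<a> (V a) (V b) (V c)"
    (is "?L = ?R")
proof (rule E_ext[of "c \<otimes> (b \<otimes> a)"])
  fix Y assume [simp]: "Y \<in> Obj C"
  let ?Z = "(c \<otimes> (b \<otimes> a)) \<otimes> Y" and ?W = "((c \<otimes> b) \<otimes> a) \<otimes> Y"
  let ?t = "\<a> (V a) (V b) (V c \<otimes> ?Z) \<cdot> \<a> (V a \<otimes> V b) (V c) ?Z"
  have nat: "\<a> b a Y \<cdot> (E c ((b \<otimes> a) \<otimes> Y) \<cdot> (\<iota> (V c) \<boxtimes> \<a> c (b \<otimes> a) Y))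
    = E c (b \<otimes> (a \<otimes> Y)) \<cdot> (\<iota> (V c) \<boxtimes> ((\<iota> c \<boxtimes> \<a> b a Y) \<cdot> \<a> c (b \<otimes> a) Y))"
    by (simp add: E_nat2 whisk_left)
  have "E (c \<otimes> (b \<otimes> a)) Y \<cdot> (?L \<boxtimes> \<iota> ?Z)
    = E (c \<otimes> (b \<otimes> a)) Y \<cdot> ((ten c (b \<otimes> a) \<boxtimes> \<iota> ?Z) \<cdot> ((ten b a \<boxtimes> \<iota> (V c)) \<boxtimes> \<iota> ?Z))"
    by (simp add: whisk_right)
  also have "\<dots> = E (b \<otimes> a) Y \<cdot> ((ten b a \<boxtimes> \<iota> ((b \<otimes> a) \<otimes> Y)) \<cdot>
     (((\<iota> (V a) \<boxtimes> \<iota> (V b)) \<boxtimes> (E c ((b \<otimes> a) \<otimes> Y) \<cdot> (\<iota> (V c) \<boxtimes> \<a> c (b \<otimes> a) Y))) \<cdot> \<a> (V a \<otimes> V b) (V c) ?Z))"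
    by (subst ten_E2) (simp_all add: asso_nat interchange)
  also have "\<dots> = E a Y \<cdot> ((\<iota> (V a) \<boxtimes> (E b (a \<otimes> Y) \<cdot> (\<iota> (V b) \<boxtimes> (\<a> b a Y \<cdot> (E c ((b \<otimes> a) \<otimes> Y)
    \<cdot> (\<iota> (V c) \<boxtimes> \<a> c (b \<otimes> a) Y)))))) \<cdot> ?t)"
    by (subst ten_E2) (simp_all del: tensm_ident add: asso_nat2 interchange)
  also have "\<dots> = E a Y \<cdot> ((\<iota> (V a) \<boxtimes> (E b (a \<otimes> Y) \<cdot> (\<iota> (V b) \<boxtimes> (E c (b \<otimes> (a \<otimes> Y))
    \<cdot> (\<iota> (V c) \<boxtimes> ((\<iota> c \<boxtimes> \<a> b a Y) \<cdot> \<a> c (b \<otimes> a) Y)))))) \<cdot> ?t)"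
    by (simp only: nat)
  finally have L: "E (c \<otimes> (b \<otimes> a)) Y \<cdot> (?L \<boxtimes> \<iota> ?Z)
    = E a Y \<cdot> ((\<iota> (V a) \<boxtimes> (E b (a \<otimes> Y) \<cdot> (\<iota> (V b) \<boxtimes> (E c (b \<otimes> (a \<otimes> Y)) \<cdot> (\<iota> (V c) \<boxtimes> ((\<iota> c \<boxtimes> \<a> b a Y) \<cdot> \<a> c (b \<otimes> a) Y)))))) \<cdot> ?t)" .
  have inner: "E (c \<otimes> b) (a \<otimes> Y) \<cdot> ((ten c b \<boxtimes> \<iota> ((c \<otimes> b) \<otimes> (a \<otimes> Y))) \<cdot> (\<iota> (V b \<otimes> V c) \<boxtimes> \<a> (c \<otimes> b) a Y))
    = E b (a \<otimes> Y) \<cdot> ((\<iota> (V b) \<boxtimes> (E c (b \<otimes> (a \<otimes> Y)) \<cdot> (\<iota> (V c) \<boxtimes> (\<a> c b (a \<otimes> Y) \<cdot> \<a> (c \<otimes> b) a Y)))) \<cdot> \<a> (V b) (V c) ?W)"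
    using asso_nat[of "\<iota> (V b)" "\<iota> (V c)" "\<a> (c \<otimes> b) a Y"] by (subst ten_E2) (simp_all add: interchange)
  have pent: "(\<iota> (V a) \<boxtimes> \<a> (V b) (V c) ?W) \<cdot> (\<a> (V a) (V b \<otimes> V c) ?W \<cdot> ((\<a> (V a) (V b) (V c) \<boxtimes> \<iota> ?W)
    \<cdot> (\<iota> ((V a \<otimes> V b) \<otimes> V c) \<boxtimes> ((\<a> c b a)\<dagger> \<boxtimes> \<iota> Y))))
    = (\<iota> (V a) \<boxtimes> (\<iota> (V b) \<boxtimes> (\<iota> (V c) \<boxtimes> ((\<a> c b a)\<dagger> \<boxtimes> \<iota> Y)))) \<cdot> ?t"
    using asso_nat[of "\<iota> (V a \<otimes> V b)" "\<iota> (V c)" "(\<a> c b a)\<dagger> \<boxtimes> \<iota> Y"]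
      asso_nat2[of "\<iota> (V a)" "\<iota> (V b)" "\<iota> (V c) \<boxtimes> ((\<a> c b a)\<dagger> \<boxtimes> \<iota> Y)"]
    by (subst pentagon2[symmetric]) simp_all
  have pent2: "\<a> c b (a \<otimes> Y) \<cdot> (\<a> (c \<otimes> b) a Y \<cdot> ((\<a> c b a)\<dagger> \<boxtimes> \<iota> Y)) = (\<iota> c \<boxtimes> \<a> b a Y) \<cdot> \<a> c (b \<otimes> a) Y"
    by (simp add: pentagon2 interchange)
  have "E (c \<otimes> (b \<otimes> a)) Y \<cdot> (?R \<boxtimes> \<iota> ?Z)
    = E ((c \<otimes> b) \<otimes> a) Y \<cdot> ((\<iota> (V ((c \<otimes> b) \<otimes> a)) \<boxtimes> ((\<a> c b a)\<dagger> \<boxtimes> \<iota> Y)) \<cdot> ((ten (c \<otimes> b) a \<cdot> (\<iota> (V a) \<boxtimes> ten c b) \<cdot> \<a> (V a) (V b) (V c)) \<boxtimes> \<iota> ?Z))"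
    by (subst whisk_right) (simp_all add: dm_E2)
  also have "\<dots> = E ((c \<otimes> b) \<otimes> a) Y \<cdot> ((ten (c \<otimes> b) a \<boxtimes> \<iota> ?W) \<cdot> (((\<iota> (V a) \<boxtimes> ten c b) \<boxtimes> \<iota> ?W)
    \<cdot> ((\<a> (V a) (V b) (V c) \<boxtimes> \<iota> ?W) \<cdot> (\<iota> ((V a \<otimes> V b) \<otimes> V c) \<boxtimes> ((\<a> c b a)\<dagger> \<boxtimes> \<iota> Y)))))"
    by (simp add: interchange)
  also have "\<dots> = E a Y \<cdot> ((\<iota> (V a) \<boxtimes> (E (c \<otimes> b) (a \<otimes> Y) \<cdot> ((ten c b \<boxtimes> \<iota> ((c \<otimes> b) \<otimes> (a \<otimes> Y)))
    \<cdot> (\<iota> (V b \<otimes> V c) \<boxtimes> \<a> (c \<otimes> b) a Y)))) \<cdot>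
      (\<a> (V a) (V b \<otimes> V c) ?W \<cdot> ((\<a> (V a) (V b) (V c) \<boxtimes> \<iota> ?W) \<cdot> (\<iota> ((V a \<otimes> V b) \<otimes> V c) \<boxtimes> ((\<a> c b a)\<dagger> \<boxtimes> \<iota> Y)))))"
    by (subst ten_E2) (simp_all add: asso_nat2, simp add: interchange)
  also have "\<dots> = E a Y \<cdot> ((\<iota> (V a) \<boxtimes> (E b (a \<otimes> Y) \<cdot> (\<iota> (V b) \<boxtimes> (E c (b \<otimes> (a \<otimes> Y))
    \<cdot> (\<iota> (V c) \<boxtimes> (\<a> c b (a \<otimes> Y) \<cdot> \<a> (c \<otimes> b) a Y)))))) \<cdot>
      ((\<iota> (V a) \<boxtimes> \<a> (V b) (V c) ?W) \<cdot> (\<a> (V a) (V b \<otimes> V c) ?W \<cdot> ((\<a> (V a) (V b) (V c) \<boxtimes> \<iota> ?W) \<cdot> (\<iota> ((V a \<otimes> V b) \<otimes> V c) \<boxtimes> ((\<a> c b a)\<dagger> \<boxtimes> \<iota> Y))))))"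
    unfolding inner by (simp add: whisk_left)
  also have "\<dots> = E a Y \<cdot> ((\<iota> (V a) \<boxtimes> (E b (a \<otimes> Y) \<cdot> (\<iota> (V b) \<boxtimes> (E c (b \<otimes> (a \<otimes> Y))
    \<cdot> (\<iota> (V c) \<boxtimes> (\<a> c b (a \<otimes> Y) \<cdot> (\<a> (c \<otimes> b) a Y \<cdot> ((\<a> c b a)\<dagger> \<boxtimes> \<iota> Y)))))))) \<cdot> ?t)"
    unfolding pent by (simp add: whisk_left)
  finally show "E (c \<otimes> (b \<otimes> a)) Y \<cdot> (?L \<boxtimes> \<iota> ?Z) = E (c \<otimes> (b \<otimes> a)) Y \<cdot> (?R \<boxtimes> \<iota> ?Z)"
    unfolding L pent2 ..
qed simp_all

section \<open>The unit constraint\<close>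

text \<open>The unit is its own dual with evaluation \<open>\<l> \<one>\<close>; this is the
  comparison of that dual with the chosen one.\<close>

definition unit_mor where "unit_mor = mate \<one> \<one> (V \<one>) (coev D \<one>) (\<l> \<one>)"

lemma unit_mor_type [simp]: "arr unit_mor" "src unit_mor = \<one>" "tgt unit_mor = V \<one>"
  unfolding unit_mor_def by simp_all

lemma ev_op_unit: "Y \<in> Obj C \<Longrightarrow> ev_op \<one> \<one> (\<l> \<one>) Y = \<l> Y \<cdot> \<l> (\<one> \<otimes> Y)"
  unfolding ev_op_def by (simp flip: lunit_tens)

lemma unit_mor_E:
  "Y \<in> Obj C \<Longrightarrow> E \<one> Y \<cdot> (unit_mor \<boxtimes> \<iota> (\<one> \<otimes> Y)) = \<l> Y \<cdot> \<l> (\<one> \<otimes> Y)"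
  unfolding E_def unit_mor_def by (simp add: mate_ev_op dual_pairV ev_op_unit)

lemma unit_mor_E2:
  "\<lbrakk>Y \<in> Obj C; arr x; tgt x = \<one> \<otimes> (\<one> \<otimes> Y)\<rbrakk>
    \<Longrightarrow> E \<one> Y \<cdot> ((unit_mor \<boxtimes> \<iota> (\<one> \<otimes> Y)) \<cdot> x) = \<l> Y \<cdot> (\<l> (\<one> \<otimes> Y) \<cdot> x)"
  by (subst reassoc[OF unit_mor_E]) simp_all

lemma ten_unit_left:
  assumes [simp]: "a \<in> Obj C"
  shows "dm a (a \<otimes> \<one>) ((\<r> a)\<dagger>) \<cdot> ten a \<one> \<cdot> (unit_mor \<boxtimes> \<iota> (V a)) = \<l> (V a)" (is "?L = _")
proof (rule E_ext[of a])
  fix Y assume [simp]: "Y \<in> Obj C"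
  have tri: "\<a> a \<one> Y \<cdot> ((\<r> a)\<dagger> \<boxtimes> \<iota> Y) = \<iota> a \<boxtimes> (\<l> Y)\<dagger>"
    using arg_cong[OF triangle[of a Y], of "\<lambda>t. \<a> a \<one> Y \<cdot> t\<dagger>"] by simp
  have "E a Y \<cdot> (?L \<boxtimes> \<iota> (a \<otimes> Y))
    = E (a \<otimes> \<one>) Y \<cdot> ((\<iota> (V (a \<otimes> \<one>)) \<boxtimes> ((\<r> a)\<dagger> \<boxtimes> \<iota> Y)) \<cdot> ((ten a \<one> \<cdot> (unit_mor \<boxtimes> \<iota> (V a))) \<boxtimes> \<iota> (a \<otimes> Y)))"
    by (subst whisk_right) (simp_all add: dm_E2)
  also have "\<dots> = E (a \<otimes> \<one>) Y \<cdot> ((ten a \<one> \<boxtimes> \<iota> ((a \<otimes> \<one>) \<otimes> Y)) \<cdot> ((unit_mor \<boxtimes> \<iota> (V a)) \<boxtimes> ((\<r> a)\<dagger> \<boxtimes> \<iota> Y)))"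
    by (simp add: interchange)
  also have "\<dots> = E \<one> Y \<cdot> ((unit_mor \<boxtimes> \<iota> (\<one> \<otimes> Y)) \<cdot> ((\<iota> \<one> \<boxtimes> (E a (\<one> \<otimes> Y)
    \<cdot> (\<iota> (V a) \<boxtimes> (\<iota> a \<boxtimes> (\<l> Y)\<dagger>)))) \<cdot> \<a> \<one> (V a) (a \<otimes> Y)))"
    by (subst ten_E2) (simp_all add: asso_nat interchange tri)
  also have "\<dots> = \<l> Y \<cdot> (\<l> (\<one> \<otimes> Y) \<cdot> ((\<iota> \<one> \<boxtimes> ((\<l> Y)\<dagger> \<cdot> E a Y)) \<cdot> \<a> \<one> (V a) (a \<otimes> Y)))"
    by (subst unit_mor_E2) (simp_all add: E_nat)
  also have "\<dots> = E a Y \<cdot> (\<l> (V a) \<boxtimes> \<iota> (a \<otimes> Y))"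
    by (simp add: lunit_nat2 flip: lunit_tens)
  finally show "E a Y \<cdot> (?L \<boxtimes> \<iota> (a \<otimes> Y)) = E a Y \<cdot> (\<l> (V a) \<boxtimes> \<iota> (a \<otimes> Y))" .
qed simp_all

lemma ten_unit_right:
  assumes [simp]: "a \<in> Obj C"
  shows "dm a (\<one> \<otimes> a) ((\<l> a)\<dagger>) \<cdot> ten \<one> a \<cdot> (\<iota> (V a) \<boxtimes> unit_mor) = \<r> (V a)" (is "?L = _")
proof (rule E_ext[of a])
  fix Y assume [simp]: "Y \<in> Obj C"
  have l: "\<a> \<one> a Y \<cdot> ((\<l> a)\<dagger> \<boxtimes> \<iota> Y) = (\<l> (a \<otimes> Y))\<dagger>"
    using arg_cong[OF lunit_tens[of a Y], of "\<lambda>t. \<a> \<one> a Y \<cdot> t\<dagger>"] by simp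
  have "E a Y \<cdot> (?L \<boxtimes> \<iota> (a \<otimes> Y))
    = E (\<one> \<otimes> a) Y \<cdot> ((\<iota> (V (\<one> \<otimes> a)) \<boxtimes> ((\<l> a)\<dagger> \<boxtimes> \<iota> Y)) \<cdot> ((ten \<one> a \<cdot> (\<iota> (V a) \<boxtimes> unit_mor)) \<boxtimes> \<iota> (a \<otimes> Y)))"
    by (subst whisk_right) (simp_all add: dm_E2)
  also have "\<dots> = E (\<one> \<otimes> a) Y \<cdot> ((ten \<one> a \<boxtimes> \<iota> ((\<one> \<otimes> a) \<otimes> Y)) \<cdot> ((\<iota> (V a) \<boxtimes> unit_mor) \<boxtimes> ((\<l> a)\<dagger> \<boxtimes> \<iota> Y)))"
    by (simp add: interchange)
  also have "\<dots> = E a Y \<cdot> ((\<iota> (V a) \<boxtimes> (E \<one> (a \<otimes> Y) \<cdot> ((unit_mor \<boxtimes> \<iota> (\<one> \<otimes> (a \<otimes> Y)))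
    \<cdot> (\<iota> \<one> \<boxtimes> (\<l> (a \<otimes> Y))\<dagger>)))) \<cdot> \<a> (V a) \<one> (a \<otimes> Y))"
    by (subst ten_E2) (simp_all add: asso_nat interchange l)
  also have "\<dots> = E a Y \<cdot> (\<r> (V a) \<boxtimes> \<iota> (a \<otimes> Y))"
    by (subst unit_mor_E2) (simp_all add: lunit_nat triangle)
  finally show "E a Y \<cdot> (?L \<boxtimes> \<iota> (a \<otimes> Y)) = E a Y \<cdot> (\<r> (V a) \<boxtimes> \<iota> (a \<otimes> Y))" .
qed simp_all

lemma dual_pair_unit: "dual_pair \<one> \<one> (\<l> \<one>) ((\<l> \<one>)\<dagger>)"
proof -
  have "coev_op \<one> \<one> ((\<l> \<one>)\<dagger>) Y = (\<l> (\<one> \<otimes> Y))\<dagger> \<cdot> (\<l> Y)\<dagger>" if "Y \<in> Obj C" for Y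
    using that dagger_coev_op[of \<one> \<one> Y "(\<l> \<one>)\<dagger>"] dagger_dagger[of "coev_op \<one> \<one> ((\<l> \<one>)\<dagger>) Y"]
    by (simp add: ev_op_unit)
  thus ?thesis
    unfolding dual_pair_def by (simp add: ev_op_unit lunit_nat_dag2 lunit_nat)
qed

lemma dm_unitary:
  assumes "unitary C a b u" "a \<in> Obj C" "b \<in> Obj C"
  shows "unitary C (V b) (V a) (dm a b u)"
  using assms by (simp add: unitary_iff dm_dag dm_ident flip: dm_comp)

text \<open>The left unit law writes the unitary \<open>\<l> (V \<one>)\<close> as \<open>x\<close>
  after \<open>unit_mor \<boxtimes> \<iota> (V \<one>)\<close>, where \<open>x\<close> is an
  isometry because the tensorator and the dual map of a unitary are unitary. This makes
  \<open>unit_mor\<close> an isometry; it has an inverse \<open>s\<close> by uniqueness of duals, so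
  \<open>s\<close> is its dagger.\<close>

lemma unit_mor_unitary: "unitary C \<one> (V \<one>) unit_mor"
proof -
  define s where "s = mate (V \<one>) \<one> \<one> ((\<l> \<one>)\<dagger>) (ev D \<one>)"
  have s [simp]: "arr s" "src s = V \<one>" "tgt s = \<one>"
    unfolding s_def by simp_all
  have su: "s \<cdot> unit_mor = \<iota> \<one>" and us: "unit_mor \<cdot> s = \<iota> (V \<one>)"
    using mates_inverse[OF dual_pair_unit dual_pairV] mates_inverse[OF dual_pairV dual_pair_unit]
    unfolding s_def unit_mor_def by simp_all
  define x where "x = dm \<one> (\<one> \<otimes> \<one>) ((\<r> \<one>)\<dagger>) \<cdot> ten \<one> \<one>"
  have [simp]: "arr x" "src x = V \<one> \<otimes> V \<one>" "tgt x = V \<one>"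
    unfolding x_def by simp_all
  have xx: "x\<dagger> \<cdot> x = \<iota> (V \<one> \<otimes> V \<one>)"
  proof -
    have "unitary C \<one> (\<one> \<otimes> \<one>) ((\<r> \<one>)\<dagger>)"
      by (simp add: unitary_iff)
    from dm_unitary[OF this]
    have *: "(dm \<one> (\<one> \<otimes> \<one>) ((\<r> \<one>)\<dagger>))\<dagger> \<cdot> dm \<one> (\<one> \<otimes> \<one>) ((\<r> \<one>)\<dagger>) = \<iota> (V (\<one> \<otimes> \<one>))"
      by (simp add: unitary_iff)
    show ?thesis
      unfolding x_def by (simp add: reassoc[OF *])
  qed
  have xu: "x \<cdot> (unit_mor \<boxtimes> \<iota> (V \<one>)) = \<l> (V \<one>)"
    using ten_unit_left[of \<one>] unfolding x_def by simp
  have "(unit_mor\<dagger> \<boxtimes> \<iota> (V \<one>)) \<cdot> (unit_mor \<boxtimes> \<iota> (V \<one>))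
    = (unit_mor\<dagger> \<boxtimes> \<iota> (V \<one>)) \<cdot> ((x\<dagger> \<cdot> x) \<cdot> (unit_mor \<boxtimes> \<iota> (V \<one>)))"
    unfolding xx by simp
  also have "\<dots> = (x \<cdot> (unit_mor \<boxtimes> \<iota> (V \<one>)))\<dagger> \<cdot> (x \<cdot> (unit_mor \<boxtimes> \<iota> (V \<one>)))"
    by simp
  also have "\<dots> = \<iota> (\<one> \<otimes> V \<one>)"
    unfolding xu by simp
  finally have "(unit_mor\<dagger> \<cdot> unit_mor) \<boxtimes> \<iota> (V \<one>) = \<iota> \<one> \<boxtimes> \<iota> (V \<one>)"
    by (simp add: interchange)
  \<comment> \<open>Conjugating the second factor by \<open>unit_mor\<close> replaces
    \<open>V \<one>\<close> by the unit, after which \<open>whisk_right_inj\<close> applies.\<close>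
  hence "(\<iota> \<one> \<boxtimes> s) \<cdot> (((unit_mor\<dagger> \<cdot> unit_mor) \<boxtimes> \<iota> (V \<one>)) \<cdot> (\<iota> \<one> \<boxtimes> unit_mor))
    = (\<iota> \<one> \<boxtimes> s) \<cdot> ((\<iota> \<one> \<boxtimes> \<iota> (V \<one>)) \<cdot> (\<iota> \<one> \<boxtimes> unit_mor))"
    by simp
  hence "(unit_mor\<dagger> \<cdot> unit_mor) \<boxtimes> \<iota> \<one> = \<iota> \<one> \<boxtimes> \<iota> \<one>"
    by (simp add: interchange su)
  hence uu: "unit_mor\<dagger> \<cdot> unit_mor = \<iota> \<one>"
    by (rule whisk_right_inj) simp_all
  have "unit_mor\<dagger> = (unit_mor\<dagger> \<cdot> unit_mor) \<cdot> s"
    by (simp add: us)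
  hence "unit_mor\<dagger> = s"
    by (simp add: uu)
  thus ?thesis
    using us uu by (simp add: unitary_iff)
qed

section \<open>Coevaluation families; \<open>phi\<close> is monoidal and natural\<close>

text \<open>An evaluation determines its coevaluation: insert the second zigzag identity for
  \<open>K\<close> behind \<open>x Y\<close>, slide \<open>K\<close> through \<open>x\<close> by
  naturality, and cancel \<open>x\<close> against \<open>E\<close> by \<open>zig\<close>. This gives
  access to \<open>K\<close> on the unit, on tensor products and under \<open>zeta\<close>.\<close>

lemma K_ext:
  assumes [simp]: "c \<in> Obj C" "Y \<in> Obj C"
    and x [simp]: "\<And>Y. Y \<in> Obj C \<Longrightarrow> arr (x Y)" "\<And>Y. Y \<in> Obj C \<Longrightarrow> src (x Y) = Y"
      "\<And>Y. Y \<in> Obj C \<Longrightarrow> tgt (x Y) = c \<otimes> (V c \<otimes> Y)"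
    and nat: "\<And>f. arr f \<Longrightarrow> x (tgt f) \<cdot> f = (\<iota> c \<boxtimes> (\<iota> (V c) \<boxtimes> f)) \<cdot> x (src f)"
    and zig: "\<And>Y. Y \<in> Obj C \<Longrightarrow> (\<iota> c \<boxtimes> E c Y) \<cdot> x (c \<otimes> Y) = \<iota> (c \<otimes> Y)"
  shows "x Y = K c Y"
proof -
  have "x Y = (\<iota> c \<boxtimes> E c (V c \<otimes> Y)) \<cdot> ((\<iota> c \<boxtimes> (\<iota> (V c) \<boxtimes> K c Y)) \<cdot> x Y)"
    by (simp add: interchange EK)
  also have "(\<iota> c \<boxtimes> (\<iota> (V c) \<boxtimes> K c Y)) \<cdot> x Y = x (c \<otimes> (V c \<otimes> Y)) \<cdot> K c Y"
    using nat[of "K c Y"] by simp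
  also have "(\<iota> c \<boxtimes> E c (V c \<otimes> Y)) \<cdot> (x (c \<otimes> (V c \<otimes> Y)) \<cdot> K c Y) = K c Y"
    by (simp add: reassoc[OF zig])
  finally show ?thesis .
qed

lemma K_unit:
  assumes "Y \<in> Obj C"
  shows "K \<one> Y = (\<iota> \<one> \<boxtimes> (unit_mor \<boxtimes> \<iota> Y)) \<cdot> (\<l> (\<one> \<otimes> Y))\<dagger> \<cdot> (\<l> Y)\<dagger>"
proof (rule K_ext[symmetric])
  fix f assume [simp]: "arr f"
  have l: "(\<l> (\<one> \<otimes> tgt f))\<dagger> \<cdot> ((\<l> (tgt f))\<dagger> \<cdot> f) = (\<iota> \<one> \<boxtimes> (\<iota> \<one> \<boxtimes> f)) \<cdot> ((\<l> (\<one> \<otimes> src f))\<dagger>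
    \<cdot> (\<l> (src f))\<dagger>)"
    by (simp add: lunit_nat_dag2 lunit_nat_dag)
  show "((\<iota> \<one> \<boxtimes> (unit_mor \<boxtimes> \<iota> (tgt f))) \<cdot> (\<l> (\<one> \<otimes> tgt f))\<dagger> \<cdot> (\<l> (tgt f))\<dagger>) \<cdot> f
    = (\<iota> \<one> \<boxtimes> (\<iota> (V \<one>) \<boxtimes> f)) \<cdot> (\<iota> \<one> \<boxtimes> (unit_mor \<boxtimes> \<iota> (src f))) \<cdot> (\<l> (\<one> \<otimes> src f))\<dagger> \<cdot> (\<l> (src f))\<dagger>"
    by (simp add: interchange l)
next
  fix Y assume [simp]: "Y \<in> Obj C"
  show "(\<iota> \<one> \<boxtimes> E \<one> Y) \<cdot> (\<iota> \<one> \<boxtimes> (unit_mor \<boxtimes> \<iota> (\<one> \<otimes> Y))) \<cdot> (\<l> (\<one> \<otimes> (\<one> \<otimes> Y)))\<dagger> \<cdot> (\<l> (\<one> \<otimes> Y))\<dagger> = \<iota> (\<one> \<otimes> Y)"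
    by (simp add: tensm_comp2 unit_mor_E) (simp add: lunit_nat_dag2)
qed (use assms in simp_all)

lemma phi_unit: "phi \<one> = dm (V \<one>) \<one> (unit_mor\<dagger>) \<cdot> unit_mor"
proof (rule E_ext[of "V \<one>"])
  fix Y assume [simp]: "Y \<in> Obj C"
  have "E (V \<one>) Y \<cdot> ((dm (V \<one>) \<one> (unit_mor\<dagger>) \<cdot> unit_mor) \<boxtimes> \<iota> (V \<one> \<otimes> Y))
    = E \<one> Y \<cdot> ((\<iota> (V \<one>) \<boxtimes> (unit_mor\<dagger> \<boxtimes> \<iota> Y)) \<cdot> (unit_mor \<boxtimes> \<iota> (V \<one> \<otimes> Y)))"
    by (simp add: whisk_right dm_E2)
  also have "\<dots> = E \<one> Y \<cdot> ((unit_mor \<boxtimes> \<iota> (\<one> \<otimes> Y)) \<cdot> (\<iota> \<one> \<boxtimes> (unit_mor\<dagger> \<boxtimes> \<iota> Y)))"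
    by (simp add: interchange)
  also have "\<dots> = (K \<one> Y)\<dagger>"
    by (simp add: unit_mor_E2 K_unit)
  finally show "E (V \<one>) Y \<cdot> (phi \<one> \<boxtimes> \<iota> (V \<one> \<otimes> Y))
      = E (V \<one>) Y \<cdot> ((dm (V \<one>) \<one> (unit_mor\<dagger>) \<cdot> unit_mor) \<boxtimes> \<iota> (V \<one> \<otimes> Y))"
    by (simp add: phi_E)
qed simp_all

text \<open>By \<open>K_ext\<close> the nested coevaluation only has to be natural and to satisfy
  the zigzag identity. \<open>ten_E\<close> turns the evaluation of \<open>a \<otimes> b\<close>
  into a nested one; then the evaluation of \<open>b\<close> cancels against its coevaluation, and
  after it that of \<open>a\<close>.\<close>

lemma K_tens:
  assumes [simp]: "a \<in> Obj C" "b \<in> Obj C" "Y \<in> Obj C"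
  shows "K (a \<otimes> b) Y = (\<a> a b (V (a \<otimes> b) \<otimes> Y))\<dagger> \<cdot>
    (\<iota> a \<boxtimes> ((\<iota> b \<boxtimes> ((ten a b \<boxtimes> \<iota> Y) \<cdot> (\<a> (V b) (V a) Y)\<dagger>)) \<cdot> K b (V a \<otimes> Y))) \<cdot> K a Y"
proof (rule K_ext[symmetric])
  fix f assume [simp]: "arr f"
  let ?x = "\<lambda>Y. (ten a b \<boxtimes> \<iota> Y) \<cdot> (\<a> (V b) (V a) Y)\<dagger>"
  have x: "?x (tgt f) \<cdot> (\<iota> (V b) \<boxtimes> (\<iota> (V a) \<boxtimes> f)) = (\<iota> (V (a \<otimes> b)) \<boxtimes> f) \<cdot> ?x (src f)"
    using asso_nat_dag[of "\<iota> (V b)" "\<iota> (V a)" f "V b" "V a" "src f", symmetric] by (simp add: interchange)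
  define M where "M = (\<lambda>Y. (\<iota> b \<boxtimes> ?x Y) \<cdot> K b (V a \<otimes> Y))"
  have M [simp]: "arr (M Y)" "src (M Y) = V a \<otimes> Y" "tgt (M Y)
    = b \<otimes> (V (a \<otimes> b) \<otimes> Y)" if "Y \<in> Obj C" for Y
    using that unfolding M_def by simp_all
  have "M (tgt f) \<cdot> (\<iota> (V a) \<boxtimes> f) = (\<iota> b \<boxtimes> ?x (tgt f)) \<cdot> ((\<iota> b \<boxtimes> (\<iota> (V b) \<boxtimes> (\<iota> (V a) \<boxtimes> f)))
    \<cdot> K b (V a \<otimes> src f))"
    unfolding M_def by (simp add: K_nat)
  also have "\<dots> = (\<iota> b \<boxtimes> (?x (tgt f) \<cdot> (\<iota> (V b) \<boxtimes> (\<iota> (V a) \<boxtimes> f)))) \<cdot> K b (V a \<otimes> src f)"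
    by (simp add: tensm_comp2)
  also have "\<dots> = (\<iota> b \<boxtimes> (\<iota> (V (a \<otimes> b)) \<boxtimes> f)) \<cdot> M (src f)"
    unfolding x M_def by (simp add: tensm_comp2)
  finally have m: "M (tgt f) \<cdot> (\<iota> (V a) \<boxtimes> f) = (\<iota> b \<boxtimes> (\<iota> (V (a \<otimes> b)) \<boxtimes> f)) \<cdot> M (src f)" .
  have "(\<a> a b (V (a \<otimes> b) \<otimes> tgt f))\<dagger> \<cdot> ((\<iota> a \<boxtimes> M (tgt f)) \<cdot> (K a (tgt f) \<cdot> f))
    = (\<a> a b (V (a \<otimes> b) \<otimes> tgt f))\<dagger> \<cdot> ((\<iota> a \<boxtimes> (M (tgt f) \<cdot> (\<iota> (V a) \<boxtimes> f))) \<cdot> K a (src f))"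
    by (simp add: K_nat tensm_comp2)
  also have "\<dots> = (\<a> a b (V (a \<otimes> b) \<otimes> tgt f))\<dagger> \<cdot> ((\<iota> a \<boxtimes> (\<iota> b \<boxtimes> (\<iota> (V (a \<otimes> b)) \<boxtimes> f)))
    \<cdot> ((\<iota> a \<boxtimes> M (src f)) \<cdot> K a (src f)))"
    unfolding m by (simp add: tensm_comp2)
  also have "\<dots> = (\<iota> (a \<otimes> b) \<boxtimes> (\<iota> (V (a \<otimes> b)) \<boxtimes> f)) \<cdot> ((\<a> a b (V (a \<otimes> b) \<otimes> src f))\<dagger>
    \<cdot> ((\<iota> a \<boxtimes> M (src f)) \<cdot> K a (src f)))"
    using asso_nat_dag2[of "\<iota> a" "\<iota> b" "\<iota> (V (a \<otimes> b)) \<boxtimes> f" a b "V (a \<otimes> b) \<otimes> src f" "(\<iota> a \<boxtimes> M (src f)) \<cdot> K a (src f)"] by simp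
  finally show "((\<a> a b (V (a \<otimes> b) \<otimes> tgt f))\<dagger> \<cdot>
      (\<iota> a \<boxtimes> ((\<iota> b \<boxtimes> ?x (tgt f)) \<cdot> K b (V a \<otimes> tgt f))) \<cdot> K a (tgt f)) \<cdot> f
    = (\<iota> (a \<otimes> b) \<boxtimes> (\<iota> (V (a \<otimes> b)) \<boxtimes> f)) \<cdot> (\<a> a b (V (a \<otimes> b) \<otimes> src f))\<dagger> \<cdot>
      (\<iota> a \<boxtimes> ((\<iota> b \<boxtimes> ?x (src f)) \<cdot> K b (V a \<otimes> src f))) \<cdot> K a (src f)"
    unfolding M_def by simp
next
  fix Y assume [simp]: "Y \<in> Obj C"
  let ?Z = "(a \<otimes> b) \<otimes> Y"
  have t: "E (a \<otimes> b) Y \<cdot> ((ten a b \<boxtimes> \<iota> ?Z) \<cdot> (\<a> (V b) (V a) ?Z)\<dagger>)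
    = E b Y \<cdot> (\<iota> (V b) \<boxtimes> (E a (b \<otimes> Y) \<cdot> (\<iota> (V a) \<boxtimes> \<a> a b Y)))"
    by (subst ten_E2) simp_all
  have u: "(\<iota> b \<boxtimes> (E b Y \<cdot> (\<iota> (V b) \<boxtimes> g))) \<cdot> K b (src g) = g"
    if [simp]: "arr g" "tgt g = b \<otimes> Y" for g
  proof -
    have "(\<iota> b \<boxtimes> (E b Y \<cdot> (\<iota> (V b) \<boxtimes> g))) \<cdot> K b (src g) = (\<iota> b \<boxtimes> E b Y) \<cdot> (K b (b \<otimes> Y) \<cdot> g)"
      by (simp add: K_nat whisk_left)
    thus ?thesis
      by (simp add: EK)
  qed
  have "(\<iota> (a \<otimes> b) \<boxtimes> E (a \<otimes> b) Y) \<cdot> (\<a> a b (V (a \<otimes> b) \<otimes> ?Z))\<dagger> \<cdot>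
    (\<iota> a \<boxtimes> ((\<iota> b \<boxtimes> ((ten a b \<boxtimes> \<iota> ?Z) \<cdot> (\<a> (V b) (V a) ?Z)\<dagger>)) \<cdot> K b (V a \<otimes> ?Z))) \<cdot> K a ?Z
    = (\<a> a b Y)\<dagger> \<cdot> ((\<iota> a \<boxtimes> ((\<iota> b \<boxtimes> (E (a \<otimes> b) Y \<cdot> ((ten a b \<boxtimes> \<iota> ?Z) \<cdot> (\<a> (V b) (V a) ?Z)\<dagger>))) \<cdot> K b (V a \<otimes> ?Z))) \<cdot> K a ?Z)"
    using asso_nat_dag2[of "\<iota> a" "\<iota> b" "E (a \<otimes> b) Y" a b "V (a \<otimes> b) \<otimes> ?Z"]
    by (simp add: tensm_comp2)
  also have "\<dots> = (\<a> a b Y)\<dagger> \<cdot> ((\<iota> a \<boxtimes> (E a (b \<otimes> Y) \<cdot> (\<iota> (V a) \<boxtimes> \<a> a b Y))) \<cdot> K a ?Z)"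
    unfolding t using u[of "E a (b \<otimes> Y) \<cdot> (\<iota> (V a) \<boxtimes> \<a> a b Y)"] by simp
  also have "\<dots> = (\<a> a b Y)\<dagger> \<cdot> ((\<iota> a \<boxtimes> E a (b \<otimes> Y)) \<cdot> (K a (a \<otimes> (b \<otimes> Y)) \<cdot> \<a> a b Y))"
    by (simp add: whisk_left K_nat)
  also have "\<dots> = \<iota> ?Z"
    by (simp add: EK)
  finally show "(\<iota> (a \<otimes> b) \<boxtimes> E (a \<otimes> b) Y) \<cdot> (\<a> a b (V (a \<otimes> b) \<otimes> ?Z))\<dagger> \<cdot>
    (\<iota> a \<boxtimes> ((\<iota> b \<boxtimes> ((ten a b \<boxtimes> \<iota> ?Z) \<cdot> (\<a> (V b) (V a) ?Z)\<dagger>)) \<cdot> K b (V a \<otimes> ?Z))) \<cdot> K a ?Z = \<iota> ?Z" .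
qed simp_all

text \<open>Against \<open>E\<close>, each \<open>phi\<close> becomes the dagger of
  \<open>K\<close>, and the claim becomes the dagger of \<open>K_tens\<close>.\<close>

lemma phi_tens:
  assumes [simp]: "a \<in> Obj C" "b \<in> Obj C"
  shows "phi (a \<otimes> b) = dm (V (a \<otimes> b)) (V b \<otimes> V a) ((ten a b)\<dagger>) \<cdot> ten (V b) (V a) \<cdot> (phi a \<boxtimes> phi b)"
    (is "_ = ?R")
proof (rule E_ext[of "V (a \<otimes> b)"])
  fix Y assume [simp]: "Y \<in> Obj C"
  let ?Z = "V (a \<otimes> b) \<otimes> Y" and ?t = "\<a> (V b) (V a) Y \<cdot> ((ten a b)\<dagger> \<boxtimes> \<iota> Y)"
  have "E (V (a \<otimes> b)) Y \<cdot> (?R \<boxtimes> \<iota> ?Z)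
    = E (V b \<otimes> V a) Y \<cdot> ((\<iota> (V (V b \<otimes> V a)) \<boxtimes> ((ten a b)\<dagger> \<boxtimes> \<iota> Y)) \<cdot> ((ten (V b) (V a) \<cdot> (phi a \<boxtimes> phi b)) \<boxtimes> \<iota> ?Z))"
    by (subst whisk_right) (simp_all add: dm_E2)
  also have "\<dots> = E (V b \<otimes> V a) Y \<cdot> ((ten (V b) (V a) \<boxtimes> \<iota> ((V b \<otimes> V a) \<otimes> Y))
    \<cdot> ((phi a \<boxtimes> phi b) \<boxtimes> ((ten a b)\<dagger> \<boxtimes> \<iota> Y)))"
    by (simp add: interchange)
  also have "\<dots> = E (V a) Y \<cdot> ((phi a \<boxtimes> \<iota> (V a \<otimes> Y)) \<cdot> ((\<iota> a \<boxtimes> (E (V b) (V a \<otimes> Y)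
    \<cdot> ((phi b \<boxtimes> \<iota> (V b \<otimes> (V a \<otimes> Y))) \<cdot> (\<iota> b \<boxtimes> ?t)))) \<cdot> \<a> a b ?Z))"
    by (subst ten_E2) (simp_all add: asso_nat interchange)
  also have "\<dots> = (K a Y)\<dagger> \<cdot> ((\<iota> a \<boxtimes> ((K b (V a \<otimes> Y))\<dagger> \<cdot> (\<iota> b \<boxtimes> ?t))) \<cdot> \<a> a b ?Z)"
    by (simp add: phi_E2)
  also have "\<dots> = (K (a \<otimes> b) Y)\<dagger>"
    by (simp add: K_tens)
  finally show "E (V (a \<otimes> b)) Y \<cdot> (phi (a \<otimes> b) \<boxtimes> \<iota> ?Z) = E (V (a \<otimes> b)) Y \<cdot> (?R \<boxtimes> \<iota> ?Z)"
    by (simp add: phi_E)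
qed simp_all

lemma K_dm:
  assumes "arr g" "b = src g" "a = tgt g" and [simp]: "Y \<in> Obj C"
  shows "(\<iota> a \<boxtimes> (dm b a g \<boxtimes> \<iota> Y)) \<cdot> K a Y = (g \<boxtimes> \<iota> (V b \<otimes> Y)) \<cdot> K b Y"
proof -
  have [simp]: "arr g" "src g = b" "tgt g = a" "a \<in> Obj C" "b \<in> Obj C"
    using assms by simp_all
  have "dm b a g \<boxtimes> \<iota> Y = (E b (V b \<otimes> Y) \<cdot> (\<iota> (V b) \<boxtimes> K b Y)) \<cdot> (dm b a g \<boxtimes> \<iota> Y)"
    by (simp only: EK(2) \<open>b \<in> Obj C\<close> \<open>Y \<in> Obj C\<close>) simp
  also have "\<dots> = E b (V b \<otimes> Y) \<cdot> ((dm b a g \<boxtimes> \<iota> (b \<otimes> (V b \<otimes> Y))) \<cdot> (\<iota> (V a) \<boxtimes> K b Y))"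
    by (simp add: interchange)
  also have "\<dots> = E a (V b \<otimes> Y) \<cdot> (\<iota> (V a) \<boxtimes> ((g \<boxtimes> \<iota> (V b \<otimes> Y)) \<cdot> K b Y))"
    by (subst dm_E2) (simp_all add: interchange)
  finally have d: "dm b a g \<boxtimes> \<iota> Y = E a (V b \<otimes> Y) \<cdot> (\<iota> (V a) \<boxtimes> ((g \<boxtimes> \<iota> (V b \<otimes> Y)) \<cdot> K b Y))" .
  have "(\<iota> a \<boxtimes> (dm b a g \<boxtimes> \<iota> Y)) \<cdot> K a Y
    = (\<iota> a \<boxtimes> E a (V b \<otimes> Y)) \<cdot> ((\<iota> a \<boxtimes> (\<iota> (V a) \<boxtimes> ((g \<boxtimes> \<iota> (V b \<otimes> Y)) \<cdot> K b Y))) \<cdot> K a Y)"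
    unfolding d by (simp add: interchange)
  also have "(\<iota> a \<boxtimes> (\<iota> (V a) \<boxtimes> ((g \<boxtimes> \<iota> (V b \<otimes> Y)) \<cdot> K b Y))) \<cdot> K a Y
    = K a (a \<otimes> (V b \<otimes> Y)) \<cdot> ((g \<boxtimes> \<iota> (V b \<otimes> Y)) \<cdot> K b Y)"
    using K_nat[of a "(g \<boxtimes> \<iota> (V b \<otimes> Y)) \<cdot> K b Y"] by simp
  finally show ?thesis
    by (simp add: EK)
qed

text \<open>Since \<open>phi\<close> contains the dagger of a coevaluation, \<open>f\<close> must be
  moved across that dagger: \<open>dm_dag\<close> says that the dagger of a dual map is a dual map,
  and \<open>K_dm\<close> moves it across the coevaluation.\<close>

lemma phi_nat:
  assumes "arr f" "a = src f" "b = tgt f"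
  shows "phi b \<cdot> f = dm (V b) (V a) (dm a b f) \<cdot> phi a"
proof (rule E_ext[of "V b"])
  have [simp]: "arr f" "src f = a" "tgt f = b" "a \<in> Obj C" "b \<in> Obj C"
    using assms by simp_all
  fix Y assume [simp]: "Y \<in> Obj C"
  have "E (V b) Y \<cdot> ((dm (V b) (V a) (dm a b f) \<cdot> phi a) \<boxtimes> \<iota> (V b \<otimes> Y))
    = E (V a) Y \<cdot> ((\<iota> (V (V a)) \<boxtimes> (dm a b f \<boxtimes> \<iota> Y)) \<cdot> (phi a \<boxtimes> \<iota> (V b \<otimes> Y)))"
    by (simp add: whisk_right dm_E2)
  also have "\<dots> = E (V a) Y \<cdot> ((phi a \<boxtimes> \<iota> (V a \<otimes> Y)) \<cdot> (\<iota> a \<boxtimes> (dm a b f \<boxtimes> \<iota> Y)))"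
    by (simp add: interchange)
  also have "\<dots> = (K a Y)\<dagger> \<cdot> (\<iota> a \<boxtimes> (dm a b f \<boxtimes> \<iota> Y))"
    by (simp add: phi_E2)
  also have "\<dots> = ((\<iota> a \<boxtimes> (dm b a (f\<dagger>) \<boxtimes> \<iota> Y)) \<cdot> K a Y)\<dagger>"
    by (simp add: dm_dag)
  also have "\<dots> = (K b Y)\<dagger> \<cdot> (f \<boxtimes> \<iota> (V b \<otimes> Y))"
    by (simp add: K_dm)
  also have "\<dots> = E (V b) Y \<cdot> ((phi b \<cdot> f) \<boxtimes> \<iota> (V b \<otimes> Y))"
    by (simp add: whisk_right phi_E2)
  finally show "E (V b) Y \<cdot> ((phi b \<cdot> f) \<boxtimes> \<iota> (V b \<otimes> Y))
      = E (V b) Y \<cdot> ((dm (V b) (V a) (dm a b f) \<cdot> phi a) \<boxtimes> \<iota> (V b \<otimes> Y))" ..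
qed (use assms in simp_all)

section \<open>Unitarity of \<open>phi\<close>\<close>

lemma ev_whisk: "\<lbrakk>c \<in> Obj C; Y \<in> Obj C\<rbrakk> \<Longrightarrow> E c Y \<cdot> \<a> (V c) c Y = \<l> Y \<cdot> (ev D c \<boxtimes> \<iota> Y)"
  unfolding E_def ev_op_def by simp

lemma coev_whisk: "\<lbrakk>c \<in> Obj C; Y \<in> Obj C\<rbrakk> \<Longrightarrow> \<a> c (V c) Y \<cdot> (coev D c \<boxtimes> \<iota> Y) = K c Y \<cdot> \<l> Y"
  unfolding K_def coev_op_def by simp

text \<open>After \<open>ten_E\<close> the coevaluation of \<open>c\<close> meets the evaluation of
  \<open>c\<close>, and the zigzag identity removes both; the evaluation of \<open>V c\<close> is
  what remains.\<close>

lemma dm_coev: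
  assumes [simp]: "c \<in> Obj C"
  shows "dm \<one> (c \<otimes> V c) (coev D c) \<cdot> ten c (V c) = unit_mor \<cdot> ev D (V c)"
proof (rule E_ext[of \<one>])
  fix Y assume [simp]: "Y \<in> Obj C"
  have "E \<one> Y \<cdot> ((dm \<one> (c \<otimes> V c) (coev D c) \<cdot> ten c (V c)) \<boxtimes> \<iota> (\<one> \<otimes> Y))
    = E (c \<otimes> V c) Y \<cdot> ((\<iota> (V (c \<otimes> V c)) \<boxtimes> (coev D c \<boxtimes> \<iota> Y)) \<cdot> (ten c (V c) \<boxtimes> \<iota> (\<one> \<otimes> Y)))"
    by (simp add: whisk_right dm_E2)
  also have "\<dots> = E (c \<otimes> V c) Y \<cdot> ((ten c (V c) \<boxtimes> \<iota> ((c \<otimes> V c) \<otimes> Y))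
    \<cdot> ((\<iota> (V (V c)) \<boxtimes> \<iota> (V c)) \<boxtimes> (coev D c \<boxtimes> \<iota> Y)))"
    by (simp add: interchange)
  also have "\<dots> = E (V c) Y \<cdot> ((\<iota> (V (V c)) \<boxtimes> (E c (V c \<otimes> Y) \<cdot> (\<iota> (V c) \<boxtimes> (\<a> c (V c) Y
    \<cdot> (coev D c \<boxtimes> \<iota> Y))))) \<cdot> \<a> (V (V c)) (V c) (\<one> \<otimes> Y))"
    by (subst ten_E2) (simp_all del: tensm_ident add: asso_nat interchange)
  also have "\<dots> = E (V c) Y \<cdot> ((\<iota> (V (V c)) \<boxtimes> (\<iota> (V c) \<boxtimes> \<l> Y)) \<cdot> \<a> (V (V c)) (V c) (\<one> \<otimes> Y))"
    unfolding coev_whisk[OF \<open>c \<in> Obj C\<close> \<open>Y \<in> Obj C\<close>] by (simp add: whisk_left[of "\<l> Y"] EK)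
  also have "\<dots> = \<l> Y \<cdot> (\<l> (\<one> \<otimes> Y) \<cdot> (ev D (V c) \<boxtimes> \<iota> (\<one> \<otimes> Y)))"
    by (simp add: E_nat2 ev_whisk)
  also have "\<dots> = E \<one> Y \<cdot> ((unit_mor \<cdot> ev D (V c)) \<boxtimes> \<iota> (\<one> \<otimes> Y))"
    by (simp add: whisk_right unit_mor_E2)
  finally show "E \<one> Y \<cdot> ((dm \<one> (c \<otimes> V c) (coev D c) \<cdot> ten c (V c)) \<boxtimes> \<iota> (\<one> \<otimes> Y))
    = E \<one> Y \<cdot> ((unit_mor \<cdot> ev D (V c)) \<boxtimes> \<iota> (\<one> \<otimes> Y))" .
qed simp_all

text \<open>The dagger of \<open>dm_coev\<close>: this is where unitarity of the tensorator enters the proof that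
  \<open>phi\<close> is unitary.\<close>

lemma dm_coev_dagger:
  assumes [simp]: "c \<in> Obj C"
  shows "dm (c \<otimes> V c) \<one> ((coev D c)\<dagger>) \<cdot> unit_mor = ten c (V c) \<cdot> (ev D (V c))\<dagger>"
proof -
  have u: "unit_mor\<dagger> \<cdot> unit_mor = \<iota> \<one>"
    using unit_mor_unitary by (simp add: unitary_iff)
  have "(ten c (V c))\<dagger> \<cdot> dm (c \<otimes> V c) \<one> ((coev D c)\<dagger>) = (ev D (V c))\<dagger> \<cdot> unit_mor\<dagger>"
    using arg_cong[OF dm_coev[of c], of "dag C"] by (simp add: dm_dag)
  hence "ten c (V c) \<cdot> (((ten c (V c))\<dagger> \<cdot> dm (c \<otimes> V c) \<one> ((coev D c)\<dagger>)) \<cdot> unit_mor)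
    = ten c (V c) \<cdot> (((ev D (V c))\<dagger> \<cdot> unit_mor\<dagger>) \<cdot> unit_mor)"
    by simp
  thus ?thesis
    by (simp add: u)
qed

lemma E_dagger_nat:
  "\<lbrakk>c \<in> Obj C; arr f; Y = tgt f\<rbrakk> \<Longrightarrow> (E c Y)\<dagger> \<cdot> f = (\<iota> (V c) \<boxtimes> (\<iota> c \<boxtimes> f)) \<cdot> (E c (src f))\<dagger>"
  using arg_cong[OF E_nat[of c "f\<dagger>" "src f"], of "dag C"] by simp

text \<open>Expresses the dagger of a coevaluation by evaluations and the dagger of one. The lemma
  \<open>unit_mor_E2\<close> introduces \<open>E \<one>\<close>, \<open>dm_E2\<close> turns the
  dagger of the coevaluation into its dual map, and \<open>dm_coev_dagger\<close> exchanges this for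
  the dagger of an evaluation.\<close>

lemma K_dagger_E:
  assumes [simp]: "c \<in> Obj C" "Y \<in> Obj C"
  shows "(K c Y)\<dagger> = E (V c) Y \<cdot> (\<iota> (V (V c)) \<boxtimes> E c (V c \<otimes> Y)) \<cdot> (E (V c) (c \<otimes> (V c \<otimes> Y)))\<dagger>"
proof -
  let ?Z = "(c \<otimes> V c) \<otimes> Y"
  have e: "\<a> (V (V c)) (V c) ?Z \<cdot> ((ev D (V c))\<dagger> \<boxtimes> \<iota> ?Z) = (E (V c) ?Z)\<dagger> \<cdot> \<l> ?Z"
    unfolding E_def ev_op_def by simp
  have "(K c Y)\<dagger> = \<l> Y \<cdot> (((coev D c)\<dagger> \<boxtimes> \<iota> Y) \<cdot> (\<a> c (V c) Y)\<dagger>)"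
    unfolding K_def coev_op_def by simp
  also have "\<dots> = \<l> Y \<cdot> ((\<l> (\<one> \<otimes> Y) \<cdot> (\<iota> \<one> \<boxtimes> ((coev D c)\<dagger> \<boxtimes> \<iota> Y))) \<cdot> ((\<l> ?Z)\<dagger> \<cdot> (\<a> c (V c) Y)\<dagger>))"
    by (simp add: lunit_nat)
  also have "\<dots> = E \<one> Y \<cdot> ((unit_mor \<boxtimes> \<iota> (\<one> \<otimes> Y)) \<cdot> ((\<iota> \<one> \<boxtimes> ((coev D c)\<dagger> \<boxtimes> \<iota> Y)) \<cdot> ((\<l> ?Z)\<dagger>
    \<cdot> (\<a> c (V c) Y)\<dagger>)))"
    by (simp add: unit_mor_E2)
  also have "\<dots> = E \<one> Y \<cdot> ((\<iota> (V \<one>) \<boxtimes> ((coev D c)\<dagger> \<boxtimes> \<iota> Y)) \<cdot> ((unit_mor \<boxtimes> \<iota> ?Z) \<cdot> ((\<l> ?Z)\<dagger>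
    \<cdot> (\<a> c (V c) Y)\<dagger>)))"
    by (simp add: interchange)
  also have "\<dots> = E (c \<otimes> V c) Y \<cdot> ((dm (c \<otimes> V c) \<one> ((coev D c)\<dagger>) \<boxtimes> \<iota> ?Z) \<cdot> ((unit_mor \<boxtimes> \<iota> ?Z)
    \<cdot> ((\<l> ?Z)\<dagger> \<cdot> (\<a> c (V c) Y)\<dagger>)))"
    by (subst dm_E2) simp_all
  also have "\<dots> = E (c \<otimes> V c) Y \<cdot> ((ten c (V c) \<boxtimes> \<iota> ?Z) \<cdot> (((ev D (V c))\<dagger> \<boxtimes> \<iota> ?Z) \<cdot> ((\<l> ?Z)\<dagger>
    \<cdot> (\<a> c (V c) Y)\<dagger>)))"
    by (simp add: tensm_comp2 dm_coev_dagger)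
  also have "\<dots> = E (V c) Y \<cdot> ((\<iota> (V (V c)) \<boxtimes> (E c (V c \<otimes> Y) \<cdot> (\<iota> (V c) \<boxtimes> \<a> c (V c) Y)))
    \<cdot> ((E (V c) ?Z)\<dagger> \<cdot> (\<a> c (V c) Y)\<dagger>))"
    by (subst ten_E2) (simp_all add: reassoc[OF e])
  also have "\<dots> = E (V c) Y \<cdot> ((\<iota> (V (V c)) \<boxtimes> E c (V c \<otimes> Y)) \<cdot> (E (V c) (c \<otimes> (V c \<otimes> Y)))\<dagger>)"
    by (simp add: E_dagger_nat interchange)
  finally show ?thesis .
qed

text \<open>A second description of \<open>phi\<close>, by evaluations in place of coevaluations.
  Its dagger composed with \<open>phi\<close> is where the two descriptions meet in a
  zigzag.\<close>

lemma phi_whisk: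
  assumes [simp]: "c \<in> Obj C" "Y \<in> Obj C"
  shows "phi c \<boxtimes> \<iota> Y = (\<iota> (V (V c)) \<boxtimes> E c Y) \<cdot> (E (V c) (c \<otimes> Y))\<dagger>"
proof -
  let ?Z = "V (V c) \<otimes> Y"
  have "phi c \<boxtimes> \<iota> Y = (E (V c) ?Z \<cdot> (\<iota> (V (V c)) \<boxtimes> K (V c) Y)) \<cdot> (phi c \<boxtimes> \<iota> Y)"
    by (simp only: EK(2) V_type assms) simp
  also have "\<dots> = E (V c) ?Z \<cdot> ((phi c \<boxtimes> \<iota> (V c \<otimes> ?Z)) \<cdot> (\<iota> c \<boxtimes> K (V c) Y))"
    by (simp add: interchange)
  also have "\<dots> = E (V c) ?Z \<cdot> ((\<iota> (V (V c)) \<boxtimes> E c (V c \<otimes> ?Z)) \<cdot> ((E (V c) (c \<otimes> (V c \<otimes> ?Z)))\<dagger>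
    \<cdot> (\<iota> c \<boxtimes> K (V c) Y)))"
    by (simp add: phi_E2 K_dagger_E)
  also have "\<dots> = E (V c) ?Z \<cdot> ((\<iota> (V (V c)) \<boxtimes> (E c (V c \<otimes> ?Z) \<cdot> (\<iota> (V c) \<boxtimes> (\<iota> c \<boxtimes> K (V c) Y))))
    \<cdot> (E (V c) (c \<otimes> Y))\<dagger>)"
    by (simp add: E_dagger_nat tensm_comp2)
  also have "\<dots> = (\<iota> (V (V c)) \<boxtimes> E c Y) \<cdot> (E (V c) (c \<otimes> Y))\<dagger>"
    by (simp add: E_nat whisk_left EK)
  finally show ?thesis .
qed

text \<open>By \<open>dual_pair_dagger\<close> the object \<open>c\<close> is a second dual of
  \<open>V c\<close>, so uniqueness of duals gives a right inverse \<open>s\<close>. By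
  \<open>phi_whisk\<close> and \<open>phi_E\<close>, \<open>(phi c)\<dagger> \<cdot> phi c\<close>
  reduces to the dagger of a zigzag identity, and therefore \<open>s\<close> is the dagger of
  \<open>phi c\<close>.\<close>

lemma phi_unitary:
  assumes [simp]: "c \<in> Obj C"
  shows "unitary C c (V (V c)) (phi c)"
proof -
  define s where "s = mate (V (V c)) (V c) c ((ev D c)\<dagger>) (ev D (V c))"
  have [simp]: "arr s" "src s = V (V c)" "tgt s = c"
    unfolding s_def by simp_all
  have ps: "phi c \<cdot> s = \<iota> (V (V c))"
    using mates_inverse[OF dual_pairV[of "V c"] dual_pair_dagger[OF dual_pairV[of c]]]
    unfolding s_def phi_mate by simp
  have "((phi c)\<dagger> \<cdot> phi c) \<boxtimes> \<iota> \<one> = (phi c \<boxtimes> \<iota> \<one>)\<dagger> \<cdot> (phi c \<boxtimes> \<iota> \<one>)"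
    by (simp add: tensm_comp)
  also have "\<dots> = E (V c) (c \<otimes> \<one>) \<cdot> ((\<iota> (V (V c)) \<boxtimes> (E c \<one>)\<dagger>) \<cdot> (phi c \<boxtimes> \<iota> \<one>))"
    by (subst phi_whisk) simp_all
  also have "\<dots> = E (V c) (c \<otimes> \<one>) \<cdot> ((phi c \<boxtimes> \<iota> (V c \<otimes> (c \<otimes> \<one>))) \<cdot> (\<iota> c \<boxtimes> (E c \<one>)\<dagger>))"
    by (simp add: interchange)
  also have "\<dots> = ((\<iota> c \<boxtimes> E c \<one>) \<cdot> K c (c \<otimes> \<one>))\<dagger>"
    by (simp add: phi_E2)
  also have "\<dots> = \<iota> c \<boxtimes> \<iota> \<one>"
    by (simp add: EK)
  finally have pp: "(phi c)\<dagger> \<cdot> phi c = \<iota> c"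
    by (rule whisk_right_inj) simp_all
  have "(phi c)\<dagger> = ((phi c)\<dagger> \<cdot> phi c) \<cdot> s"
    by (simp add: ps)
  hence "(phi c)\<dagger> = s"
    by (simp add: pp)
  thus ?thesis
    using ps pp by (simp add: unitary_iff)
qed

theorem bi_involutive_induced_bar: "bi_involutive_structure C (induced_bar C D)"
proof -
  let ?B = "induced_bar C D"
  have "conjugate_linear_dagger_functor C ?B"
    unfolding conjugate_linear_dagger_functor_def induced_bar_def
    by (simp add: dm_ident dm_dag dm_comp dm_scale dm_add dagger_scale dagger_add)
  moreover have "anti_monoidal_tensorator C ?B"
    unfolding anti_monoidal_tensorator_def induced_bar_def
    by (simp add: ten_unitary dm_dag ten_nat ten_asso)
  moreover have "unit_constraint C ?B unit_mor"
    unfolding unit_constraint_def induced_bar_def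
    by (simp add: unit_mor_unitary dm_dag ten_unit_left ten_unit_right)
  ultimately show ?thesis
    unfolding bi_involutive_structure_def
    using phi_unitary phi_unit phi_nat phi_tens
    by (auto intro!: exI[of _ unit_mor] simp: induced_bar_def dm_dag)
qed

text \<open>The action of the conjugation functor of \<open>induced_bar C D\<close> on morphisms.\<close>

definition br where "br f = dm (tgt f) (src f) (f\<dagger>)"

lemma br_type [simp]:
  assumes "arr f"
  shows "arr (br f)" "src (br f) = V (src f)" "tgt (br f) = V (tgt f)"
  using assms unfolding br_def by simp_all

lemma br_comp: "\<lbrakk>arr f; arr g; src g = tgt f\<rbrakk> \<Longrightarrow> br (g \<cdot> f) = br g \<cdot> br f"
  unfolding br_def by (simp add: dm_comp)

lemma br_ident [simp]: "a \<in> Obj C \<Longrightarrow> br (\<iota> a) = \<iota> (V a)"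
  unfolding br_def by (simp add: dm_ident)

lemma br_add: "\<lbrakk>arr f; arr g; src g = src f; tgt g = tgt f\<rbrakk> \<Longrightarrow> br (add_mor C f g)
  = add_mor C (br f) (br g)"
  unfolding br_def by (simp add: dm_add dagger_add)

lemma br_scale: "arr f \<Longrightarrow> br (scale_mor C z f) = scale_mor C (cnj z) (br f)"
  unfolding br_def by (simp add: dm_scale dagger_scale)

lemma br_zero [simp]: "\<lbrakk>a \<in> Obj C; b \<in> Obj C\<rbrakk> \<Longrightarrow> br (zero a b) = zero (V a) (V b)"
  using br_scale[of "zero a b" 0] scale_0[of "br (zero a b)"] by simp

lemma br_dagger: "arr f \<Longrightarrow> (br f)\<dagger> = br (f\<dagger>)"
  unfolding br_def by (simp add: dm_dag)

lemma br_ten: "\<lbrakk>arr f; arr g\<rbrakk> \<Longrightarrow> br (f \<boxtimes> g) \<cdot> ten (src f) (src g) = ten (tgt f) (tgt g) \<cdot> (br g \<boxtimes> br f)"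
  unfolding br_def by (simp add: ten_nat)

lemma br_phi: "arr f \<Longrightarrow> phi (tgt f) \<cdot> f = br (br f) \<cdot> phi (src f)"
  unfolding br_def by (simp add: dm_dag phi_nat)

lemma phi_cancel [simp]:
  assumes "a \<in> Obj C"
  shows "(phi a)\<dagger> \<cdot> phi a = \<iota> a" "phi a \<cdot> (phi a)\<dagger> = \<iota> (V (V a))"
    "\<lbrakk>arr x; tgt x = a\<rbrakk> \<Longrightarrow> (phi a)\<dagger> \<cdot> (phi a \<cdot> x) = x"
proof -
  show *: "(phi a)\<dagger> \<cdot> phi a = \<iota> a" "phi a \<cdot> (phi a)\<dagger> = \<iota> (V (V a))"
    using phi_unitary[OF assms] assms by (simp_all add: unitary_iff)
  show "\<lbrakk>arr x; tgt x = a\<rbrakk> \<Longrightarrow> (phi a)\<dagger> \<cdot> (phi a \<cdot> x) = x"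
    using assms by (simp add: reassoc[OF *(1)])
qed

lemma br_recover: "arr f \<Longrightarrow> f = (phi (tgt f))\<dagger> \<cdot> (br (br f) \<cdot> phi (src f))"
  by (simp flip: br_phi)

lemma br_eq_zero:
  assumes "br f = zero (V (src f)) (V (tgt f))" "arr f"
  shows "f = zero (src f) (tgt f)"
  using br_recover[OF assms(2)] assms by simp

lemma V_nonzero: "\<lbrakk>\<iota> a \<noteq> zero a a; a \<in> Obj C\<rbrakk> \<Longrightarrow> \<iota> (V a) \<noteq> zero (V a) (V a)"
  using br_eq_zero[of "\<iota> a"] by auto

text \<open>\<open>br\<close> is full, since \<open>br \<circ> br\<close> is conjugate to the identity.\<close>

lemma End_V:
  assumes a: "a \<in> Obj C" and sc: "\<And>f. \<lbrakk>arr f; src f = a; tgt f = a\<rbrakk> \<Longrightarrow> \<exists>z. f = scale_mor C z (\<iota> a)"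
    and g [simp]: "arr g" "src g = V a" "tgt g = V a"
  shows "\<exists>z. g = scale_mor C z (\<iota> (V a))"
proof -
  note [simp] = a
  obtain z where z: "(phi a)\<dagger> \<cdot> (br g \<cdot> phi a) = scale_mor C z (\<iota> a)"
    using sc[of "(phi a)\<dagger> \<cdot> (br g \<cdot> phi a)"] by auto
  have "br g = phi a \<cdot> (((phi a)\<dagger> \<cdot> (br g \<cdot> phi a)) \<cdot> (phi a)\<dagger>)"
    by (simp add: reassoc[OF phi_cancel(2)])
  also have "\<dots> = scale_mor C z (\<iota> (V (V a)))"
    unfolding z by (simp add: bilinear)
  finally have "br (br g) = scale_mor C (cnj z) (\<iota> (V (V (V a))))"
    by (simp add: br_scale)
  hence "g = scale_mor C (cnj z) (\<iota> (V a))"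
    using br_recover[of g] by (simp add: bilinear)
  thus ?thesis ..
qed

end

section \<open>Comparison of two unitary dual functors\<close>

locale two_unitary_duals = unitary_multitensor_category C + U1: unitary_dual C D1 + U2: unitary_dual C D2
  for C :: "('o, 'm) moncat" (structure) and D1 D2
begin

abbreviation zeta where "zeta \<equiv> dual_comparison C D1 D2"

lemma zeta_mate: "zeta c = mate (U1.V c) c (U2.V c) (coev D2 c) (ev D1 c)"
  unfolding dual_comparison_def mate_def ..

lemma zeta_type [simp]:
  assumes "c \<in> Obj C"
  shows "arr (zeta c)" "src (zeta c) = U1.V c" "tgt (zeta c) = U2.V c"
  using assms by (simp_all add: zeta_mate)

lemma zeta_E:
  assumes "c \<in> Obj C" "Y \<in> Obj C"
  shows "U2.E c Y \<cdot> (zeta c \<boxtimes> \<iota> (c \<otimes> Y)) = U1.E c Y"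
  using assms mate_ev_op[OF U2.dual_pairV, of c "U1.V c" Y "ev D1 c"]
  unfolding U1.E_def U2.E_def by (simp add: zeta_mate)

lemma zeta_E2:
  assumes "c \<in> Obj C" "Y \<in> Obj C" "arr x" "tgt x = U1.V c \<otimes> (c \<otimes> Y)"
  shows "U2.E c Y \<cdot> ((zeta c \<boxtimes> \<iota> (c \<otimes> Y)) \<cdot> x) = U1.E c Y \<cdot> x"
  using assms by (subst reassoc[OF zeta_E]) simp_all

lemma zeta_iso:
  assumes "c \<in> Obj C"
  obtains g where "arr g" "src g = U2.V c" "tgt g = U1.V c" "g \<cdot> zeta c = \<iota> (U1.V c)" "zeta c \<cdot> g
    = \<iota> (U2.V c)"
proof
  let ?g = "mate (U2.V c) c (U1.V c) (coev D1 c) (ev D2 c)"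
  show "?g \<cdot> zeta c = \<iota> (U1.V c)"
    unfolding zeta_mate by (rule mates_inverse[OF U1.dual_pairV U2.dual_pairV]) (rule assms)+
  show "zeta c \<cdot> ?g = \<iota> (U2.V c)"
    unfolding zeta_mate by (rule mates_inverse[OF U2.dual_pairV U1.dual_pairV]) (rule assms)+
qed (use assms in simp_all)

lemma zeta_dm:
  assumes "arr f" "a = src f" "b = tgt f"
  shows "U2.dm a b f \<cdot> zeta b = zeta a \<cdot> U1.dm a b f"
proof (rule U2.E_ext[of a])
  have [simp]: "arr f" "src f = a" "tgt f = b" "a \<in> Obj C" "b \<in> Obj C"
    using assms by simp_all
  fix Y assume [simp]: "Y \<in> Obj C"
  have "U2.E a Y \<cdot> ((U2.dm a b f \<cdot> zeta b) \<boxtimes> \<iota> (a \<otimes> Y))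
    = U2.E b Y \<cdot> ((\<iota> (U2.V b) \<boxtimes> (f \<boxtimes> \<iota> Y)) \<cdot> (zeta b \<boxtimes> \<iota> (a \<otimes> Y)))"
    by (simp add: whisk_right U2.dm_E2)
  also have "\<dots> = U2.E b Y \<cdot> ((zeta b \<boxtimes> \<iota> (b \<otimes> Y)) \<cdot> (\<iota> (U1.V b) \<boxtimes> (f \<boxtimes> \<iota> Y)))"
    by (simp add: interchange)
  also have "\<dots> = U2.E a Y \<cdot> ((zeta a \<cdot> U1.dm a b f) \<boxtimes> \<iota> (a \<otimes> Y))"
    by (simp add: whisk_right zeta_E2 U1.dm_E)
  finally show "U2.E a Y \<cdot> ((U2.dm a b f \<cdot> zeta b) \<boxtimes> \<iota> (a \<otimes> Y)) = U2.E a Y \<cdot> ((zeta a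
    \<cdot> U1.dm a b f) \<boxtimes> \<iota> (a \<otimes> Y))" .
qed (use assms in simp_all)

lemma zeta_br:
  assumes "arr f" "a = src f" "b = tgt f"
  shows "zeta b \<cdot> U1.br f = U2.br f \<cdot> zeta a"
  unfolding U1.br_def U2.br_def using assms zeta_dm[of "f\<dagger>" b a] by simp

lemma zeta_ten:
  assumes [simp]: "a \<in> Obj C" "b \<in> Obj C"
  shows "zeta (a \<otimes> b) \<cdot> U1.ten a b = U2.ten a b \<cdot> (zeta b \<boxtimes> zeta a)"
proof (rule U2.E_ext[of "a \<otimes> b"])
  fix Y assume [simp]: "Y \<in> Obj C"
  let ?Z = "(a \<otimes> b) \<otimes> Y"
  have "U2.E (a \<otimes> b) Y \<cdot> ((U2.ten a b \<cdot> (zeta b \<boxtimes> zeta a)) \<boxtimes> \<iota> ?Z)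
    = U2.E (a \<otimes> b) Y \<cdot> ((U2.ten a b \<boxtimes> \<iota> ?Z) \<cdot> ((zeta b \<boxtimes> zeta a) \<boxtimes> \<iota> ?Z))"
    by (simp add: whisk_right)
  also have "\<dots> = U2.E b Y \<cdot> ((zeta b \<boxtimes> \<iota> (b \<otimes> Y)) \<cdot> ((\<iota> (U1.V b) \<boxtimes> (U2.E a (b \<otimes> Y)
    \<cdot> ((zeta a \<boxtimes> \<iota> (a \<otimes> (b \<otimes> Y))) \<cdot> (\<iota> (U1.V a) \<boxtimes> \<a> a b Y))))
      \<cdot> \<a> (U1.V b) (U1.V a) ?Z))"
    by (subst U2.ten_E2) (simp_all add: asso_nat interchange)
  also have "\<dots> = U2.E (a \<otimes> b) Y \<cdot> ((zeta (a \<otimes> b) \<cdot> U1.ten a b) \<boxtimes> \<iota> ?Z)"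
    by (simp add: zeta_E2 whisk_right U1.ten_E)
  finally show "U2.E (a \<otimes> b) Y \<cdot> ((zeta (a \<otimes> b) \<cdot> U1.ten a b) \<boxtimes> \<iota> ?Z)
    = U2.E (a \<otimes> b) Y \<cdot> ((U2.ten a b \<cdot> (zeta b \<boxtimes> zeta a)) \<boxtimes> \<iota> ?Z)" ..
qed simp_all

lemma zeta_K:
  assumes "c \<in> Obj C" "Y \<in> Obj C"
  shows "(\<iota> c \<boxtimes> (zeta c \<boxtimes> \<iota> Y)) \<cdot> U1.K c Y = U2.K c Y"
proof (rule U2.K_ext)
  fix f assume [simp]: "arr f"
  show "((\<iota> c \<boxtimes> (zeta c \<boxtimes> \<iota> (tgt f))) \<cdot> U1.K c (tgt f)) \<cdot> f
    = (\<iota> c \<boxtimes> (\<iota> (U2.V c) \<boxtimes> f)) \<cdot> (\<iota> c \<boxtimes> (zeta c \<boxtimes> \<iota> (src f))) \<cdot> U1.K c (src f)"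
    using assms by (simp add: U1.K_nat interchange)
next
  fix Y assume "Y \<in> Obj C"
  thus "(\<iota> c \<boxtimes> U2.E c Y) \<cdot> (\<iota> c \<boxtimes> (zeta c \<boxtimes> \<iota> (c \<otimes> Y))) \<cdot> U1.K c (c \<otimes> Y) = \<iota> (c \<otimes> Y)"
    using assms by (simp add: tensm_comp2 zeta_E U1.EK)
qed (use assms in simp_all)

text \<open>The comparison is compatible with \<open>phi\<close> although it need not be unitary, because
  \<open>phi\<close> is itself defined with the dagger of the coevaluation.\<close>

lemma zeta_phi:
  assumes [simp]: "a \<in> Obj C"
  shows "U2.br (zeta a) \<cdot> zeta (U1.V a) \<cdot> U1.phi a = U2.phi a"
proof (rule U2.E_ext[of "U2.V a"])
  fix Y assume [simp]: "Y \<in> Obj C"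
  let ?W = "U2.V a \<otimes> Y"
  have "U2.E (U2.V a) Y \<cdot> ((U2.br (zeta a) \<cdot> zeta (U1.V a) \<cdot> U1.phi a) \<boxtimes> \<iota> ?W)
    = U2.E (U1.V a) Y \<cdot> ((\<iota> (U2.V (U1.V a)) \<boxtimes> ((zeta a)\<dagger> \<boxtimes> \<iota> Y)) \<cdot> ((zeta (U1.V a) \<cdot> U1.phi a) \<boxtimes> \<iota> ?W))"
    unfolding U2.br_def by (subst whisk_right) (simp_all add: U2.dm_E2)
  also have "\<dots> = U2.E (U1.V a) Y \<cdot> ((zeta (U1.V a) \<boxtimes> \<iota> (U1.V a \<otimes> Y)) \<cdot> ((U1.phi a \<boxtimes> \<iota> (U1.V a \<otimes> Y))
    \<cdot> (\<iota> a \<boxtimes> ((zeta a)\<dagger> \<boxtimes> \<iota> Y))))"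
    by (simp add: interchange)
  also have "\<dots> = (U1.K a Y)\<dagger> \<cdot> (\<iota> a \<boxtimes> ((zeta a)\<dagger> \<boxtimes> \<iota> Y))"
    by (simp add: zeta_E2 U1.phi_E2)
  also have "\<dots> = ((\<iota> a \<boxtimes> (zeta a \<boxtimes> \<iota> Y)) \<cdot> U1.K a Y)\<dagger>"
    by simp
  also have "\<dots> = (U2.K a Y)\<dagger>"
    by (simp only: zeta_K assms \<open>Y \<in> Obj C\<close>)
  finally show "U2.E (U2.V a) Y \<cdot> ((U2.br (zeta a) \<cdot> zeta (U1.V a) \<cdot> U1.phi a) \<boxtimes> \<iota> ?W)
    = U2.E (U2.V a) Y \<cdot> (U2.phi a \<boxtimes> \<iota> ?W)"
    by (simp add: U2.phi_E)
qed simp_all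

section \<open>Modulus of the comparison and weights of simple objects\<close>

text \<open>The square of the positive part in the polar decomposition of
  \<open>zeta c\<close>.\<close>

definition modulus where "modulus c = (zeta c)\<dagger> \<cdot> zeta c"

lemma modulus_type [simp]:
  assumes "c \<in> Obj C"
  shows "arr (modulus c)" "src (modulus c) = U1.V c" "tgt (modulus c) = U1.V c"
  using assms unfolding modulus_def by simp_all

lemma modulus_nat:
  assumes "arr f" "a = src f" "b = tgt f"
  shows "modulus b \<cdot> U1.br f = U1.br f \<cdot> modulus a"
proof -
  have [simp]: "arr f" "src f = a" "tgt f = b" "a \<in> Obj C" "b \<in> Obj C"
    using assms by simp_all
  have z: "(zeta b)\<dagger> \<cdot> U2.br f = U1.br f \<cdot> (zeta a)\<dagger>"
    using arg_cong[OF zeta_br[of "f\<dagger>" b a], of "dag C"] by (simp add: U1.br_dagger U2.br_dagger)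
  have "modulus b \<cdot> U1.br f = ((zeta b)\<dagger> \<cdot> U2.br f) \<cdot> zeta a"
    unfolding modulus_def using zeta_br[of f a b] by simp
  also have "\<dots> = U1.br f \<cdot> modulus a"
    unfolding z modulus_def by simp
  finally show ?thesis .
qed

text \<open>By \<open>End_V\<close> the endomorphisms of \<open>U1.V s\<close> are scalars because
  those of \<open>s\<close> are, which avoids showing that \<open>U1.V s\<close> is simple. The
  scalar is positive by \<open>dagger_comp_pos\<close>, as \<open>zeta s\<close> is invertible and
  \<open>U1.V s\<close> nonzero.\<close>

lemma modulus_simple:
  assumes s: "simple_object C s"
  shows "\<exists>r>0. modulus s = scale_mor C (complex_of_real r) (\<iota> (U1.V s))"
proof -
  have [simp]: "s \<in> Obj C"
    using s by simp
  obtain z where z: "modulus s = scale_mor C z (\<iota> (U1.V s))"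
    using U1.End_V[of s "modulus s"] End_simple[OF s] by auto
  obtain g where "arr g" "src g = U2.V s" "tgt g = U1.V s" "g \<cdot> zeta s = \<iota> (U1.V s)"
    using zeta_iso[of s] by auto
  hence "zeta s \<noteq> zero_mor C (U1.V s) (U2.V s)"
    using U1.V_nonzero[OF simple_nonzero[OF s]] by auto
  then obtain r where "r > 0" "z = complex_of_real r"
    using dagger_comp_pos[of "zeta s" "U1.V s" "U2.V s" z] z unfolding modulus_def by auto
  thus ?thesis
    using z by blast
qed

definition weight where
  "weight s = (SOME r. r > 0 \<and> modulus s = scale_mor C (complex_of_real r) (\<iota> (U1.V s)))"

lemma weight:
  assumes "simple_object C s"
  shows "weight s > 0" "modulus s = scale_mor C (complex_of_real (weight s)) (\<iota> (U1.V s))"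
  using someI_ex[OF modulus_simple[OF assms]] unfolding weight_def by auto

text \<open>Naturality of the modulus compares the two scalars on \<open>U1.br f\<close>, which is
  nonzero because conjugation is faithful. Used for isomorphic simple objects and for the simple
  summands of any object with scalar modulus.\<close>

lemma weight_eq:
  assumes s: "simple_object C s" and f: "arr f" "src f = s" "tgt f = c" "f \<noteq> zero_mor C s c"
    and m: "modulus c = scale_mor C (complex_of_real r) (\<iota> (U1.V c))"
  shows "weight s = r"
proof -
  have [simp]: "arr f" "src f = s" "tgt f = c" "s \<in> Obj C" "c \<in> Obj C"
    using s f src_Obj[OF f(1)] tgt_Obj[OF f(1)] by simp_all
  have "scale_mor C (complex_of_real (weight s)) (U1.br f) = scale_mor C (complex_of_real r) (U1.br f)"
    using modulus_nat[of f s c] unfolding m weight(2)[OF s] by (simp add: bilinear)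
  thus ?thesis
    using scale_cancel[of "complex_of_real (weight s)" "U1.br f" "complex_of_real r"] U1.br_eq_zero[of f] f(4) by auto
qed

section \<open>The rescaling automorphism of the identity functor\<close>

definition inv_sqrt_weight where "inv_sqrt_weight s = complex_of_real (1 / sqrt (weight s))"

definition T where
  "T c = (SOME T. arr T \<and> src T = c \<and> tgt T = c \<and>
    (\<forall>s g. simple_object C s \<and> arr g \<and> src g = s \<and> tgt g = c \<longrightarrow> T \<cdot> g = scale_mor C (inv_sqrt_weight s) g))"

lemma T_ex:
  assumes "c \<in> Obj C"
  shows "arr (T c) \<and> src (T c) = c \<and> tgt (T c) = c \<and>
    (\<forall>s g. simple_object C s \<and> arr g \<and> src g = s \<and> tgt g = c \<longrightarrow> T c \<cdot> g = scale_mor C (inv_sqrt_weight s) g)"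
proof -
  have "inv_sqrt_weight s = inv_sqrt_weight s'"
    if "simple_object C s" "simple_object C s'" "arr f" "src f = s" "tgt f
      = s'" "f \<noteq> zero_mor C s s'" for s s' f
    using that weight_eq[of s f s' "weight s'"] weight(2)[of s'] unfolding inv_sqrt_weight_def by simp
  from central_exists[of inv_sqrt_weight c, OF this assms] show ?thesis
    unfolding T_def by (rule someI_ex)
qed

lemma T_type [simp]:
  assumes "c \<in> Obj C"
  shows "arr (T c)" "src (T c) = c" "tgt (T c) = c"
  using T_ex[OF assms] by simp_all

lemma T_simple:
  "\<lbrakk>simple_object C s; arr g; src g = s; tgt g = c\<rbrakk> \<Longrightarrow> T c \<cdot> g = scale_mor C (inv_sqrt_weight s) g"
  using T_ex[of c] tgt_Obj[of g] by auto

text \<open>A morphism from a simple \<open>s\<close>, composed with either side, is multiplied by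
  the same scalar, which depends on \<open>s\<close> alone.\<close>

lemma T_nat:
  assumes [simp]: "arr f"
  shows "T (tgt f) \<cdot> f = f \<cdot> T (src f)"
  by (rule simple_ext[of _ _ "src f"]) (simp_all add: T_simple bilinear)

lemma T_on_simple: "simple_object C s \<Longrightarrow> T s = scale_mor C (inv_sqrt_weight s) (\<iota> s)"
  using T_simple[of s "\<iota> s" s] by simp

lemma cnj_inv_sqrt_weight [simp]: "cnj (inv_sqrt_weight s) = inv_sqrt_weight s"
  unfolding inv_sqrt_weight_def by simp

lemma T_dagger [simp]:
  assumes [simp]: "c \<in> Obj C"
  shows "(T c)\<dagger> = T c"
proof (rule simple_ext[of _ _ c])
  fix s g assume s: "simple_object C s" and [simp]: "arr g" "src g = s" "tgt g = c"
  have "g\<dagger> \<cdot> T c = T s \<cdot> g\<dagger>"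
    using T_nat[of "g\<dagger>"] by simp
  hence "(g\<dagger> \<cdot> T c)\<dagger> = (scale_mor C (inv_sqrt_weight s) (g\<dagger>))\<dagger>"
    using s by (simp add: T_on_simple bilinear)
  thus "(T c)\<dagger> \<cdot> g = T c \<cdot> g"
    using s by (simp add: dagger_scale T_simple)
qed simp_all

text \<open>By \<open>weight_eq\<close> all simple objects that map nontrivially to \<open>c\<close>
  have weight \<open>r\<close>. It computes \<open>T\<close> on products and duals of simple objects
  without decomposing them.\<close>

lemma T_scalar:
  assumes m: "modulus c = scale_mor C (complex_of_real r) (\<iota> (U1.V c))" and [simp]: "c \<in> Obj C"
  shows "T c = scale_mor C (complex_of_real (1 / sqrt r)) (\<iota> c)"
proof (rule simple_ext[of _ _ c])
  fix s g assume s: "simple_object C s" and [simp]: "arr g" "src g = s" "tgt g = c"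
  show "T c \<cdot> g = scale_mor C (complex_of_real (1 / sqrt r)) (\<iota> c) \<cdot> g"
  proof (cases "g = zero_mor C s c")
    case False
    thus ?thesis
      using weight_eq[OF s _ _ _ False m] s by (simp add: T_simple bilinear inv_sqrt_weight_def)
  qed (use s in simp)
qed simp_all

lemma inv_sqrt_weight_square: "simple_object C s \<Longrightarrow> inv_sqrt_weight s * (inv_sqrt_weight s * complex_of_real (weight s)) = 1"
  using weight(1)[of s] unfolding inv_sqrt_weight_def by (simp flip: of_real_mult)

section \<open>The unitary equivalence\<close>

text \<open>The unitary part in the polar decomposition of \<open>zeta c\<close>: the factor
  \<open>U1.br (T c)\<close> is the inverse square root of \<open>modulus c\<close>. The scalars of
  \<open>T\<close> are real, so the conjugate-linear \<open>U1.br\<close> preserves them.\<close>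

definition chi where "chi c = zeta c \<cdot> U1.br (T c)"

lemma chi_type [simp]:
  assumes "c \<in> Obj C"
  shows "arr (chi c)" "src (chi c) = U1.V c" "tgt (chi c) = U2.V c"
  using assms unfolding chi_def by simp_all

lemma chi_nat:
  assumes "arr f" "a = src f" "b = tgt f"
  shows "chi b \<cdot> U1.br f = U2.br f \<cdot> chi a"
proof -
  have [simp]: "arr f" "src f = a" "tgt f = b" "a \<in> Obj C" "b \<in> Obj C"
    using assms by simp_all
  have "U1.br (T b) \<cdot> U1.br f = U1.br f \<cdot> U1.br (T a)"
    using T_nat[of f] by (simp flip: U1.br_comp)
  hence "chi b \<cdot> U1.br f = (zeta b \<cdot> U1.br f) \<cdot> U1.br (T a)"
    unfolding chi_def by simp
  also have "\<dots> = U2.br f \<cdot> chi a"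
    using zeta_br[of f a b] unfolding chi_def by simp
  finally show ?thesis .
qed

lemma chi_simple: "simple_object C s \<Longrightarrow> chi s = scale_mor C (inv_sqrt_weight s) (zeta s)"
  unfolding chi_def by (simp add: T_on_simple U1.br_scale bilinear)

text \<open>Conjugation is applied to the decomposition of \<open>\<iota> c\<close> from
  \<open>ident_induct\<close>, so no decomposition of \<open>U1.V c\<close> itself is
  needed.\<close>

lemma ident_from_simples:
  assumes [simp]: "c \<in> Obj C" and x: "arr x" "src x = U1.V c" and y: "arr y" "src y = U1.V c" "tgt y
    = tgt x"
    and eq: "\<And>s i. \<lbrakk>simple_object C s; arr i; src i = s; tgt i = c\<rbrakk> \<Longrightarrow> x \<cdot> U1.br i = y \<cdot> U1.br i"
  shows "x = y"
proof -
  have "x \<cdot> U1.br (\<iota> c) = y \<cdot> U1.br (\<iota> c)"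
  proof (rule ident_induct)
    fix s i p assume "simple_object C s" "arr i" "src i = s" "tgt i = c" "arr p" "src p = c" "tgt p = s"
    thus "x \<cdot> U1.br (i \<cdot> p) = y \<cdot> U1.br (i \<cdot> p)"
      using reassoc[OF eq, of s i "U1.br p"] x y by (simp add: U1.br_comp)
  qed (use x y in \<open>auto simp: U1.br_add bilinear\<close>)
  thus ?thesis
    using x y by simp
qed

lemma chi_dagger_nat:
  assumes "arr f" "a = src f" "b = tgt f"
  shows "(chi b)\<dagger> \<cdot> U2.br f = U1.br f \<cdot> (chi a)\<dagger>"
  using assms arg_cong[OF chi_nat[of "f\<dagger>" b a], of "dag C"] by (simp add: U1.br_dagger U2.br_dagger)

lemma chi_unitary:
  assumes [simp]: "c \<in> Obj C"
  shows "unitary C (U1.V c) (U2.V c) (chi c)"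
proof -
  have simple: "(chi s)\<dagger> \<cdot> chi s = \<iota> (U1.V s)" if s: "simple_object C s" for s
    using s weight(2)[OF s] inv_sqrt_weight_square[OF s] unfolding modulus_def
    by (simp add: chi_simple bilinear dagger_scale mult.assoc)
  have 1: "(chi c)\<dagger> \<cdot> chi c = \<iota> (U1.V c)"
  proof (rule ident_from_simples[of c])
    fix s i assume s: "simple_object C s" and [simp]: "arr i" "src i = s" "tgt i = c"
    have "((chi c)\<dagger> \<cdot> chi c) \<cdot> U1.br i = ((chi c)\<dagger> \<cdot> U2.br i) \<cdot> chi s"
      using s by (simp add: chi_nat[of i s c])
    also have "\<dots> = U1.br i"
      using s by (subst chi_dagger_nat[of i s c]) (simp_all add: simple)
    finally show "((chi c)\<dagger> \<cdot> chi c) \<cdot> U1.br i = \<iota> (U1.V c) \<cdot> U1.br i"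
      by simp
  qed simp_all
  \<comment> \<open>An isometry need not be unitary. For the other half,
    \<open>(zeta c)\<dagger>\<close> is rewritten as \<open>modulus c \<cdot> g\<close>, so that
    \<open>t\<close> cancels the modulus against the two factors \<open>U1.br (T c)\<close>.\<close>
  obtain g where [simp]: "arr g" "src g = U2.V c" "tgt g = U1.V c" and g: "zeta c \<cdot> g = \<iota> (U2.V c)"
    using zeta_iso[of c] by auto
  have "U1.br (T c) \<cdot> modulus c \<cdot> U1.br (T c) = \<iota> (U1.V c)"
    using 1 unfolding chi_def modulus_def by (simp add: U1.br_dagger)
  moreover have "modulus c \<cdot> U1.br (T c) = U1.br (T c) \<cdot> modulus c"
    by (rule modulus_nat) simp_all
  ultimately have t: "U1.br (T c) \<cdot> U1.br (T c) \<cdot> modulus c = \<iota> (U1.V c)"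
    by simp
  have "chi c \<cdot> (chi c)\<dagger> = zeta c \<cdot> ((U1.br (T c) \<cdot> U1.br (T c) \<cdot> modulus c) \<cdot> g)"
    unfolding chi_def modulus_def by (simp add: g U1.br_dagger)
  hence "chi c \<cdot> (chi c)\<dagger> = \<iota> (U2.V c)"
    unfolding t by (simp add: g)
  with 1 show ?thesis
    by (simp add: unitary_iff)
qed

section \<open>Compatibility of the rescaling with tensor products and conjugation\<close>

text \<open>By \<open>zeta_ten\<close> the comparison on a product is conjugate to
  \<open>zeta s' \<boxtimes> zeta s\<close> through tensorators. As these are unitary, they
  conjugate the moduli as well, and a conjugated scalar does not change.\<close>

lemma modulus_tens:
  assumes "simple_object C s" "simple_object C s'"
  shows "modulus (s \<otimes> s') = scale_mor C (complex_of_real (weight s * weight s')) (\<iota> (U1.V (s \<otimes> s')))"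
proof -
  have [simp]: "s \<in> Obj C" "s' \<in> Obj C"
    using assms by simp_all
  have "zeta (s \<otimes> s') = (zeta (s \<otimes> s') \<cdot> U1.ten s s') \<cdot> (U1.ten s s')\<dagger>"
    by simp
  also have "\<dots> = U2.ten s s' \<cdot> (zeta s' \<boxtimes> zeta s) \<cdot> (U1.ten s s')\<dagger>"
    unfolding zeta_ten[OF \<open>s \<in> Obj C\<close> \<open>s' \<in> Obj C\<close>] by simp
  finally have "modulus (s \<otimes> s') = U1.ten s s' \<cdot> (modulus s' \<boxtimes> modulus s) \<cdot> (U1.ten s s')\<dagger>"
    unfolding modulus_def by (simp add: tensm_comp2)
  thus ?thesis
    unfolding weight(2)[OF assms(1)] weight(2)[OF assms(2)] by (simp add: bilinear mult.commute)
qed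

text \<open>A morphism from a simple object to \<open>a \<otimes> b\<close> need not be of the form
  \<open>i \<boxtimes> j\<close>, so \<open>simple_ext\<close> does not apply directly. Instead the
  identities of \<open>a\<close> and of \<open>b\<close> are decomposed one after the other, which
  reduces the claim to products of simple objects.\<close>

lemma T_tens:
  assumes [simp]: "a \<in> Obj C" "b \<in> Obj C"
  shows "T (a \<otimes> b) = T a \<boxtimes> T b"
proof -
  have simple: "T (a \<otimes> b) \<cdot> (i \<boxtimes> j) = (T a \<boxtimes> T b) \<cdot> (i \<boxtimes> j)"
    if s: "simple_object C s" "simple_object C s'"
      and [simp]: "arr i" "src i = s" "tgt i = a" "arr j" "src j = s'" "tgt j = b" for s s' i j
  proof -
    have "T (s \<otimes> s') = scale_mor C (inv_sqrt_weight s * inv_sqrt_weight s') (\<iota> (s \<otimes> s'))"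
      using T_scalar[OF modulus_tens[OF s]] s by (simp add: inv_sqrt_weight_def real_sqrt_mult)
    thus ?thesis
      using T_nat[of "i \<boxtimes> j"] s by (simp add: tensm_comp T_simple bilinear mult.commute)
  qed
  have right: "T (a \<otimes> b) \<cdot> (i \<boxtimes> \<iota> b) = (T a \<boxtimes> T b) \<cdot> (i \<boxtimes> \<iota> b)"
    if s: "simple_object C s" and [simp]: "arr i" "src i = s" "tgt i = a" for s i
  proof (rule ident_induct[where a = b])
    fix s' j q assume s': "simple_object C s'" and [simp]: "arr j" "src j = s'" "tgt j
      = b" "arr q" "src q = b" "tgt q = s'"
    have "i \<boxtimes> (j \<cdot> q) = (i \<boxtimes> j) \<cdot> (\<iota> s \<boxtimes> q)"
      using s s' by (simp add: tensm_comp)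
    thus "T (a \<otimes> b) \<cdot> (i \<boxtimes> (j \<cdot> q)) = (T a \<boxtimes> T b) \<cdot> (i \<boxtimes> (j \<cdot> q))"
      using s s' by (simp add: reassoc[OF simple[OF s s']] )
  qed (use s in \<open>auto simp: bilinear\<close>)
  have "T (a \<otimes> b) \<cdot> (\<iota> a \<boxtimes> \<iota> b) = (T a \<boxtimes> T b) \<cdot> (\<iota> a \<boxtimes> \<iota> b)"
  proof (rule ident_induct[where a = a])
    fix s i p assume s: "simple_object C s" and [simp]: "arr i" "src i = s" "tgt i
      = a" "arr p" "src p = a" "tgt p = s"
    have "(i \<cdot> p) \<boxtimes> \<iota> b = (i \<boxtimes> \<iota> b) \<cdot> (p \<boxtimes> \<iota> b)"
      using s by (simp add: tensm_comp)
    thus "T (a \<otimes> b) \<cdot> ((i \<cdot> p) \<boxtimes> \<iota> b) = (T a \<boxtimes> T b) \<cdot> ((i \<cdot> p) \<boxtimes> \<iota> b)"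
      using s by (simp add: reassoc[OF right[OF s]])
  qed (auto simp: bilinear)
  thus ?thesis
    by simp
qed

lemma chi_ten:
  assumes [simp]: "a \<in> Obj C" "b \<in> Obj C"
  shows "chi (a \<otimes> b) \<cdot> U1.ten a b = U2.ten a b \<cdot> (chi b \<boxtimes> chi a)"
proof -
  have "chi (a \<otimes> b) \<cdot> U1.ten a b = zeta (a \<otimes> b) \<cdot> (U1.ten a b \<cdot> (U1.br (T b) \<boxtimes> U1.br (T a)))"
    using U1.br_ten[of "T a" "T b"] unfolding chi_def by (simp add: T_tens)
  also have "\<dots> = U2.ten a b \<cdot> (chi b \<boxtimes> chi a)"
    unfolding chi_def by (simp add: reassoc[OF zeta_ten] tensm_comp)
  finally show ?thesis .
qed

text \<open>By \<open>zeta_phi\<close>, \<open>?w\<close> is the composite of the unitaries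
  \<open>U2.phi s\<close> and \<open>(U1.phi s)\<dagger>\<close>. On the other hand
  \<open>?w\<dagger> \<cdot> ?w\<close> is the modulus of \<open>U1.V s\<close> multiplied by the
  weight of \<open>s\<close>.\<close>

lemma modulus_V:
  assumes s: "simple_object C s"
  shows "modulus (U1.V s) = scale_mor C (complex_of_real (1 / weight s)) (\<iota> (U1.V (U1.V s)))"
proof -
  have [simp]: "s \<in> Obj C"
    using s by simp
  let ?z = "complex_of_real (weight s)"
  let ?w = "U2.br (zeta s) \<cdot> zeta (U1.V s)"
  have br: "U2.br ((zeta s)\<dagger>) \<cdot> U2.br (zeta s) = scale_mor C ?z (\<iota> (U2.V (U1.V s)))"
    using arg_cong[OF weight(2)[OF s], of U2.br] unfolding modulus_def
    by (simp add: U2.br_comp U2.br_scale)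
  have "?w = (?w \<cdot> U1.phi s) \<cdot> (U1.phi s)\<dagger>"
    by simp
  hence w: "?w = U2.phi s \<cdot> (U1.phi s)\<dagger>"
    using zeta_phi[of s] by simp
  have "scale_mor C ?z (modulus (U1.V s)) = (zeta (U1.V s))\<dagger> \<cdot> ((U2.br ((zeta s)\<dagger>) \<cdot> U2.br (zeta s))
    \<cdot> zeta (U1.V s))"
    unfolding br modulus_def by (simp add: bilinear)
  also have "\<dots> = ?w\<dagger> \<cdot> ?w"
    by (simp add: U2.br_dagger)
  also have "\<dots> = \<iota> (U1.V (U1.V s))"
    unfolding w by simp
  finally have "scale_mor C (1 / ?z) (scale_mor C ?z (modulus (U1.V s)))
    = scale_mor C (1 / ?z) (\<iota> (U1.V (U1.V s)))"
    by simp
  thus ?thesis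
    using weight(1)[OF s] by simp
qed

text \<open>On the conjugate of a morphism from a simple \<open>s\<close>, the first factor acts by
  the inverse square root of the weight and, by \<open>modulus_V\<close>, the second by its square
  root. This is the cancellation that \<open>chi_phi\<close> needs.\<close>

lemma T_V:
  assumes [simp]: "a \<in> Obj C"
  shows "U1.br (T a) \<cdot> T (U1.V a) = \<iota> (U1.V a)"
proof (rule ident_from_simples[of a])
  fix s i assume s: "simple_object C s" and [simp]: "arr i" "src i = s" "tgt i = a"
  have c: "inv_sqrt_weight s * complex_of_real (1 / sqrt (1 / weight s)) = 1"
    using weight(1)[OF s] unfolding inv_sqrt_weight_def by (simp add: real_sqrt_divide flip: of_real_mult)
  have "(U1.br (T a) \<cdot> T (U1.V a)) \<cdot> U1.br i = U1.br (T a) \<cdot> (U1.br i \<cdot> T (U1.V s))"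
    using T_nat[of "U1.br i"] by simp
  also have "\<dots> = U1.br (T a \<cdot> i) \<cdot> T (U1.V s)"
    using s by (simp add: U1.br_comp)
  also have "\<dots> = scale_mor C (inv_sqrt_weight s * complex_of_real (1 / sqrt (1 / weight s))) (U1.br i)"
    using s T_scalar[OF modulus_V[OF s]] by (simp add: T_simple U1.br_scale bilinear)
  finally show "(U1.br (T a) \<cdot> T (U1.V a)) \<cdot> U1.br i = \<iota> (U1.V a) \<cdot> U1.br i"
    unfolding c by simp
qed simp_all

text \<open>Naturality of \<open>zeta\<close> brings the two conjugates of \<open>T\<close> next to
  each other; there they cancel by \<open>T_V\<close>, and \<open>zeta_phi\<close> remains.\<close>

lemma chi_phi:
  assumes [simp]: "a \<in> Obj C"
  shows "U2.br (chi a) \<cdot> chi (U1.V a) \<cdot> U1.phi a = U2.phi a"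
proof -
  have "U2.br (chi a) \<cdot> chi (U1.V a) \<cdot> U1.phi a
    = U2.br (zeta a) \<cdot> (U2.br (U1.br (T a)) \<cdot> zeta (U1.V a)) \<cdot> U1.br (T (U1.V a)) \<cdot> U1.phi a"
    unfolding chi_def by (simp add: U2.br_comp)
  also have "U2.br (U1.br (T a)) \<cdot> zeta (U1.V a) = zeta (U1.V a) \<cdot> U1.br (U1.br (T a))"
    by (rule zeta_br[symmetric]) simp_all
  also have "U2.br (zeta a) \<cdot> (zeta (U1.V a) \<cdot> U1.br (U1.br (T a))) \<cdot> U1.br (T (U1.V a)) \<cdot> U1.phi a
    = U2.br (zeta a) \<cdot> zeta (U1.V a) \<cdot> (U1.br (U1.br (T a)) \<cdot> U1.br (T (U1.V a))) \<cdot> U1.phi a"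
    by simp
  also have "U1.br (U1.br (T a)) \<cdot> U1.br (T (U1.V a)) = \<iota> (U1.V (U1.V a))"
    using arg_cong[OF T_V[of a], of U1.br] by (simp add: U1.br_comp)
  finally show ?thesis
    by (simp add: zeta_phi)
qed

section \<open>Uniqueness and conclusion\<close>

text \<open>On a simple \<open>s\<close> the isometry condition reads
  \<open>t * t * weight s = 1\<close>, and positivity selects the root
  \<open>1 / sqrt (weight s)\<close>. Naturality extends the agreement to all objects.\<close>

lemma unitary_positive_unique:
  assumes un: "\<And>c. c \<in> Obj C \<Longrightarrow> unitary C (U1.V c) (U2.V c) (x c)"
    and nat: "\<And>f. arr f \<Longrightarrow> x (tgt f) \<cdot> U1.br f = U2.br f \<cdot> x (src f)"
    and pos: "\<And>s. simple_object C s \<Longrightarrow> \<exists>t>0. x s = scale_mor C (complex_of_real t) (zeta s)"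
    and c [simp]: "c \<in> Obj C"
  shows "x c = chi c"
proof -
  have x [simp]: "arr (x c)" "src (x c) = U1.V c" "tgt (x c) = U2.V c" "(x c)\<dagger> \<cdot> x c = \<iota> (U1.V c)"
    if "c \<in> Obj C" for c
    using un[OF that] that by (simp_all add: unitary_iff)
  have simple: "x s = chi s" if s: "simple_object C s" for s
  proof -
    obtain t where t: "t > 0" "x s = scale_mor C (complex_of_real t) (zeta s)"
      using pos[OF s] by blast
    have "(x s)\<dagger> \<cdot> x s = scale_mor C (complex_of_real (t * t * weight s)) (\<iota> (U1.V s))"
      using weight(2)[OF s] s unfolding t(2) modulus_def by (simp add: bilinear dagger_scale mult.assoc)
    hence "scale_mor C 1 (\<iota> (U1.V s)) = scale_mor C (complex_of_real (t * t * weight s)) (\<iota> (U1.V s))"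
      using s by simp
    hence "1 = complex_of_real (t * t * weight s)"
      by (rule scale_cancel) (use s U1.V_nonzero[OF simple_nonzero[OF s]] in simp_all)
    hence tt: "1 = t * t * weight s"
      by (metis of_real_1 of_real_eq_iff)
    have "1 / sqrt (weight s) = t"
    proof -
      have "t * sqrt (weight s) = sqrt (t * t * weight s)"
        using t(1) by (simp add: real_sqrt_mult)
      hence "t * sqrt (weight s) = 1"
        unfolding tt[symmetric] by simp
      thus ?thesis
        using weight(1)[OF s] by (simp add: field_simps)
    qed
    thus ?thesis
      using t(2) s by (simp add: chi_simple inv_sqrt_weight_def)
  qed
  show ?thesis
  proof (rule ident_from_simples[of c])
    fix s i assume s: "simple_object C s" and [simp]: "arr i" "src i = s" "tgt i = c"
    show "x c \<cdot> U1.br i = chi c \<cdot> U1.br i"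
      using nat[of i] chi_nat[of i s c] simple[OF s] by simp
  qed simp_all
qed

end

text \<open>Uniqueness ranges over all unitary natural isomorphisms that are positive on simples,
  hence in particular over all such equivalences. It is stated on \<open>Obj C\<close> because the
  components of a family elsewhere carry no meaning.\<close>

theorem corollaryB:
  fixes C :: "('o, 'm) moncat" and D1 D2 :: "('o, 'm) dual_data"
  assumes "unitary_multitensor_category C"
    and "unitary_dual_functor C D1"
    and "unitary_dual_functor C D2"
  shows "bi_involutive_structure C (induced_bar C D1) \<and>
    bi_involutive_structure C (induced_bar C D2) \<and>
    (\<exists>\<chi>. unitary_equivalence C (induced_bar C D1) (induced_bar C D2) \<chi> \<and>
      positive_on_simples C D1 D2 \<chi> \<and>
      (\<forall>\<chi>'. unitary_natural_iso C (induced_bar C D1) (induced_bar C D2) \<chi>' \<and>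
         positive_on_simples C D1 D2 \<chi>' \<longrightarrow> (\<forall>c \<in> Obj C. \<chi>' c = \<chi> c)))"
proof -
  interpret unitary_multitensor_category C
    by (rule assms)
  interpret two_unitary_duals C D1 D2
    by unfold_locales (rule assms)+
  let ?B1 = "induced_bar C D1" and ?B2 = "induced_bar C D2"
  have B: "bob ?B1 = U1.V" "bob ?B2 = U2.V" "binv ?B1 = U1.phi" "binv ?B2 = U2.phi"
    "bten ?B1 a b = U1.ten b a" "bten ?B2 a b = U2.ten b a" for a b
    unfolding induced_bar_def by simp_all
  \<comment> \<open>\<open>bmor\<close> receives source and target as arguments, while
    \<open>br\<close> reads them off the morphism.\<close>
  have bmor: "bmor ?B1 (src f) (tgt f) f = U1.br f" "bmor ?B2 (src f) (tgt f) f = U2.br f" if "arr f" for f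
    using that unfolding induced_bar_def U1.br_def U2.br_def by (simp_all add: U1.dm_dag U2.dm_dag)
  have nat_iso: "unitary_natural_iso C ?B1 ?B2 x \<longleftrightarrow>
    (\<forall>c \<in> Obj C. unitary C (U1.V c) (U2.V c) (x c)) \<and> (\<forall>f. arr f \<longrightarrow> x (tgt f) \<cdot>\<^bsub>C\<^esub> U1.br f = U2.br f \<cdot>\<^bsub>C\<^esub> x (src f))" for x
    unfolding unitary_natural_iso_def B using bmor by (metis hom_iff src_Obj tgt_Obj)
  have "unitary_natural_iso C ?B1 ?B2 chi"
    unfolding nat_iso using chi_unitary chi_nat by blast
  moreover have "bmor ?B2 (U1.V a) (U2.V a) (chi a) = U2.br (chi a)" if "a \<in> Obj C" for a
    using bmor(2)[of "chi a"] that by simp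
  ultimately have "unitary_equivalence C ?B1 ?B2 chi"
    unfolding unitary_equivalence_def B using chi_ten chi_phi by simp
  moreover have "positive_on_simples C D1 D2 chi"
    unfolding positive_on_simples_def
  proof (intro allI impI)
    fix s assume s: "simple_object C s"
    show "\<exists>t>0. chi s = scale_mor C (complex_of_real t) (zeta s)"
      by (rule exI[of _ "1 / sqrt (weight s)"]) (use weight(1)[OF s] chi_simple[OF s] in \<open>simp add: inv_sqrt_weight_def\<close>)
  qed
  moreover have "\<chi>' c = chi c"
    if "unitary_natural_iso C ?B1 ?B2 \<chi>'" "positive_on_simples C D1 D2 \<chi>'" "c \<in> Obj C" for \<chi>' c
    by (rule unitary_positive_unique) (use that in \<open>auto simp: nat_iso positive_on_simples_def\<close>)
  ultimately show ?thesis
    using U1.bi_involutive_induced_bar U2.bi_involutive_induced_bar by blast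
qed

end
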